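(* Let $k \geq 4$, and let $H_0$ be a connected $k$-critical graph with $h$ vertices. Let $H$ be a graph on $t$ vertices obtained from $H_0$ by adding $t-h$ pendant edges, where $t \geq (1000kh)^{10} h^{10k}$. Then $H$ is a bonbon. In particular, $c(H)=(k-1)^{1-t}$.
   Context: All graphs are finite and simple, and $\chi(H)$ denotes the chromatic number of $H$. A graph is $k$-critical if it has chromatic number $k$ and there exists at least one edge whose deletion lowers the chromatic number (it is not required that every edge have this property). A graph $H$ is obtained from $H_0$ by adding pendant edges if $H_0$ is an induced subgraph of $H$, and every vertex in $V(H)\setminus V(H_0)$ has degree $1$ in $H$ with its unique neighbor lying in $V(H_0)$ (no assumption is made on which vertices of $H_0$ are these neighbors). For a graph $H$ on $t$ vertices and a two-coloring $\chi:E(K_n)\to\{\text{red},\text{blue}\}$, let $m(H,\chi)$ be the number of monochromatic labeled copies of $H$, i.e. injections $V(H)\to V(K_n)$ mapping all edges of $H$ to edges of the same color. Let $m(H,n)$ be the minimum of $m(H,\chi)$ over all two-colorings of $E(K_n)$, let $(n)_t=n(n-1)\cdots(n-t+1)$, and let $c(H)=\lim_{n\to\infty} m(H,n)/(n)_t$ (this limit exists); $c(H)$ is the Ramsey multiplicity constant of $H$. The Turán coloring of $E(K_n)$ with $p$ parts is the two-coloring in which $V(K_n)$ is partitioned into $p$ parts, each of size $\lfloor n/p\rfloor$ or $\lceil n/p\rceil$, all edges inside parts are red, and all edges between different parts are blue. A connected graph $H$ is a bonbon if, for every sufficiently large $n$, the Turán coloring of $E(K_n)$ with $\chi(H)-1$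 parts is the unique two-edge-coloring of $K_n$ with the minimum number of monochromatic copies of $H$, up to permuting the colors and the vertices. *)

theory Defs
  imports Complex_Main "HOL-Library.FuncSet" "HOL-Library.Ramsey"
begin

section \<open>Finite simple graphs\<close>

record 'a sgraph =
  verts :: "'a set"
  edges :: "'a set set"

definition simple_graph :: "'a sgraph \<Rightarrow> bool" where
  "simple_graph G \<longleftrightarrow> finite (verts G) \<and> edges G \<subseteq> nsets (verts G) 2"

definition neighbours :: "'a sgraph \<Rightarrow> 'a \<Rightarrow> 'a set" where
  "neighbours G v = {u. {u, v} \<in> edges G}"

definition degree :: "'a sgraph \<Rightarrow> 'a \<Rightarrow> nat" where
  "degree G v = card (neighbours G v)"

definition connected_graph :: "'a sgraph \<Rightarrow> bool" where
  "connected_graph G \<longleftrightarrow> verts G \<noteq> {} \<and>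
     (\<forall>u\<in>verts G. \<forall>v\<in>verts G. (u, v) \<in> {(x, y). {x, y} \<in> edges G}\<^sup>*)"

definition proper_colouring :: "'a sgraph \<Rightarrow> nat \<Rightarrow> ('a \<Rightarrow> nat) \<Rightarrow> bool" where
  "proper_colouring G k f \<longleftrightarrow>
     f \<in> verts G \<rightarrow> {..<k} \<and> (\<forall>u v. {u, v} \<in> edges G \<longrightarrow> f u \<noteq> f v)"

definition chromatic_number :: "'a sgraph \<Rightarrow> nat" where
  "chromatic_number G = (LEAST k. \<exists>f. proper_colouring G k f)"

definition delete_edge :: "'a sgraph \<Rightarrow> 'a set \<Rightarrow> 'a sgraph" where
  "delete_edge G e = G\<lparr>edges := edges G - {e}\<rparr>"

text \<open>Only one edge is required to be critical, not every edge.\<close>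

definition critical :: "nat \<Rightarrow> 'a sgraph \<Rightarrow> bool" where
  "critical k G \<longleftrightarrow> chromatic_number G = k \<and>
     (\<exists>e\<in>edges G. chromatic_number (delete_edge G e) < chromatic_number G)"

definition induced_subgraph :: "'a sgraph \<Rightarrow> 'a sgraph \<Rightarrow> bool" where
  "induced_subgraph G0 G \<longleftrightarrow>
     verts G0 \<subseteq> verts G \<and> edges G0 = {e \<in> edges G. e \<subseteq> verts G0}"

definition adds_pendant_edges :: "'a sgraph \<Rightarrow> 'a sgraph \<Rightarrow> bool" where
  "adds_pendant_edges H0 H \<longleftrightarrow> induced_subgraph H0 H \<and>
     (\<forall>v\<in>verts H - verts H0. degree H v = 1 \<and> neighbours H v \<subseteq> verts H0)"

section \<open>Two-edge-colourings and the Ramsey multiplicity constant\<close>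

text \<open>The vertex set of \<open>K\<^sub>n\<close> is \<open>{..<n}\<close>. Colourings and labelled copies are
  extensional functions, so that distinct ones can be counted and compared.\<close>

datatype colour = Red | Blue

definition edge_colourings :: "nat \<Rightarrow> (nat set \<Rightarrow> colour) set" where
  "edge_colourings n = nsets {..<n} 2 \<rightarrow>\<^sub>E UNIV"

definition mono_copies :: "'a sgraph \<Rightarrow> nat \<Rightarrow> (nat set \<Rightarrow> colour) \<Rightarrow> nat" where
  "mono_copies H n c = card {f \<in> verts H \<rightarrow>\<^sub>E {..<n}.
     inj_on f (verts H) \<and> (\<exists>col. \<forall>e\<in>edges H. c (f ` e) = col)}"

definition min_mono_copies :: "'a sgraph \<Rightarrow> nat \<Rightarrow> nat" where
  "min_mono_copies H n = Min (mono_copies H n ` edge_colourings n)"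

definition falling_factorial :: "nat \<Rightarrow> nat \<Rightarrow> real" where
  "falling_factorial n t = (\<Prod>i<t. real n - real i)"

definition mono_density :: "'a sgraph \<Rightarrow> nat \<Rightarrow> real" where
  "mono_density H n = real (min_mono_copies H n) / falling_factorial n (card (verts H))"

definition ramsey_multiplicity_constant :: "'a sgraph \<Rightarrow> real" where
  "ramsey_multiplicity_constant H = lim (mono_density H)"

section \<open>Turan colourings and bonbons\<close>

definition turan_colouring :: "nat \<Rightarrow> nat \<Rightarrow> (nat set \<Rightarrow> colour) \<Rightarrow> bool" where
  "turan_colouring n p c \<longleftrightarrow> c \<in> edge_colourings n \<and>
     (\<exists>part \<in> {..<n} \<rightarrow> {..<p}.
        (\<forall>i<p. int (card {v \<in> {..<n}. part v = i})
                 \<in> {\<lfloor>real n / real p\<rfloor>, \<lceil>real n / real p\<rceil>}) \<and>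
        (\<forall>u<n. \<forall>v<n. u \<noteq> v \<longrightarrow> c {u, v} = (if part u = part v then Red else Blue)))"

definition colouring_equiv ::
    "nat \<Rightarrow> (nat set \<Rightarrow> colour) \<Rightarrow> (nat set \<Rightarrow> colour) \<Rightarrow> bool" where
  "colouring_equiv n c d \<longleftrightarrow> (\<exists>\<sigma> \<pi>. bij_betw \<sigma> {..<n} {..<n} \<and> bij \<pi> \<and>
     (\<forall>e\<in>nsets {..<n} 2. c e = \<pi> (d (\<sigma> ` e))))"

text \<open>A Turan colouring with a given number of parts is unique up to a permutation of the
  vertices, so which one is chosen as \<open>T\<close> below is immaterial.\<close>

definition bonbon :: "'a sgraph \<Rightarrow> bool" where
  "bonbon H \<longleftrightarrow> connected_graph H \<and>
     (\<forall>\<^sub>F n in sequentially.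
        \<exists>T. turan_colouring n (chromatic_number H - 1) T \<and>
            mono_copies H n T = min_mono_copies H n \<and>
            (\<forall>c\<in>edge_colourings n.
               mono_copies H n c = min_mono_copies H n \<longrightarrow> colouring_equiv n c T))"

end

theory Submission imports Defs "HOL-Combinatorics.Transposition" begin

text \<open>
  Let \<open>p = k - 1\<close>. A monochromatic copy of \<open>H0\<close> on vertices of degrees \<open>d\<close> in its colour extends to
  about \<open>d ^ (t - h)\<close> copies of \<open>H\<close>, while the Turan colouring has only about \<open>p (n / p) ^ t\<close> copies. As
  \<open>t\<close> is huge, in a minimal colouring the vertices of red degree at least \<open>(1 / p + \<epsilon>) n\<close> span
  extremely few red copies of \<open>H0\<close>, hence few red \<open>K\<^sub>k\<close>, and likewise for blue. This forces one colour
  (red) to be close to a disjoint union of \<open>p\<close> cliques of size \<open>n / p\<close>. Replacing a vertex by a clone of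
  another shows that all vertices lie in about equally many copies, so every single vertex
  fits the partition. Comparing with the recolouring of one edge inside a part, and then of all pairs
  between the parts, shows that the colouring is exactly complete multipartite; convexity of the
  falling factorial balances the parts.
\<close>

text \<open>The obstacle is that nothing is known about where the pendant edges sit. They multiply a
  core copy by a product of degrees, and only pigeonhole guarantees a core vertex carrying about t/h
  of them. A gain at that vertex must pay for a relative loss at all the others, so the margins used
  for a single vertex are \<open>h\<close> times larger than the errors of the partition. All
  constants are powers of one base L = 1000 k h: degree excess e = L^-7, partition error \<omega> =
  L^-2, clique density \<gamma> = L^(-10 k^2). Supersaturation turns clique density \<gamma> into
  core density \<gamma>^(h^k), which an exponential in t must outweigh; this brings a power of h
  with exponent proportional to k into the bound on t. Criticality enters twice. As the core has no
  proper \<open>p\<close>-colouring, the colour between the parts contains no copies at all. As it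
  has one that fails only at the edge \<open>x0 y0\<close>, a single wrong edge inside a part, or a
  single vertex joined in colour \<open>b\<close> to all parts, already creates a large number of
  copies.\<close>

section \<open>Counting homomorphisms and cliques\<close>

text \<open>The coordinates in \<open>Z\<close> are filled one at a time in an order left to finite
  induction, so the lower bound \<open>m x\<close> on the admissible values is demanded for every
  intermediate domain \<open>Y\<close>. Core vertices and pendant vertices are both placed this
  way.\<close>

lemma greedy_count:
  fixes good :: "'a set \<Rightarrow> ('a \<Rightarrow> 'v) \<Rightarrow> bool" and m :: "'a \<Rightarrow> real"
  assumes fin: "finite X" "finite Z" "finite V" and disj: "X \<inter> Z = {}"
    and m: "\<And>x. x \<in> Z \<Longrightarrow> 0 \<le> m x"
    and step: "\<And>Y g x. X \<subseteq> Y \<Longrightarrow> Y \<subseteq> X \<union> Z \<Longrightarrow> x \<in> Z - Y \<Longrightarrow> g \<in> Y \<rightarrow>\<^sub>E V \<Longrightarrow> good Y g \<Longrightarrow>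
       m x \<le> card {v \<in> V. good (insert x Y) (g(x := v))}"
  shows "card {g \<in> X \<rightarrow>\<^sub>E V. good X g} * prod m Z \<le> card {g \<in> X \<union> Z \<rightarrow>\<^sub>E V. good (X \<union> Z) g}"
proof -
  define S where "S Y = {g \<in> Y \<rightarrow>\<^sub>E V. good Y g}" for Y
  have "card (S X) * prod m Z' \<le> card (S (X \<union> Z'))" if "Z' \<subseteq> Z" for Z'
    using finite_subset[OF that fin(2)] that
  proof (induction Z' rule: finite_induct)
    case empty
    then show ?case by simp
  next
    case (insert x Z')
    define Y where "Y = X \<union> Z'"
    define B where "B g = {v \<in> V. good (insert x Y) (g(x := v))}" for g
    have x: "x \<notin> Y" using insert disj Y_def by auto
    have finY: "finite Y" using fin insert Y_def by auto
    have finS: "finite (S Y)" "finite (S (insert x Y))"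
      using finite_PiE[of Y "\<lambda>_. V"] finite_PiE[of "insert x Y" "\<lambda>_. V"] fin finY by (auto simp: S_def)
    have finB: "finite (B g)" for g using fin by (simp add: B_def)
    have inj: "inj_on (\<lambda>(g,v). g(x:=v)) (SIGMA g:S Y. B g)"
    proof (rule inj_onI, clarify)
      fix g v g' v' assume *: "g \<in> S Y" "g' \<in> S Y" "g(x := v) = g'(x := v')"
      have "v = v'" using fun_cong[OF *(3), of x] by simp
      moreover have "g y = g' y" for y
      proof (cases "y = x")
        case True
        then show ?thesis using * x by (auto simp: S_def PiE_def extensional_def)
      next
        case False
        then show ?thesis using fun_cong[OF *(3), of y] by simp
      qed
      ultimately show "g = g' \<and> v = v'" by auto
    qed
    have img: "(\<lambda>(g,v). g(x:=v)) ` (SIGMA g:S Y. B g) \<subseteq> S (insert x Y)"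
      by (auto simp: S_def B_def PiE_def extensional_def Pi_def)
    have "card (S Y) * m x = (\<Sum>g\<in>S Y. m x)" by simp
    also have "\<dots> \<le> (\<Sum>g\<in>S Y. real (card (B g)))"
    proof (rule sum_mono)
      fix g assume "g \<in> S Y"
      then show "m x \<le> real (card (B g))" unfolding B_def using insert x
        by (intro step) (auto simp: S_def Y_def)
    qed
    also have "\<dots> = real (card (SIGMA g:S Y. B g))"
      using card_SigmaI[of "S Y" B] finS finB by simp
    also have "\<dots> \<le> card (S (insert x Y))"
      using card_inj_on_le[OF inj img finS(2)] by simp
    finally have 1: "card (S Y) * m x \<le> card (S (insert x Y))" .
    have "card (S X) * prod m (insert x Z') = (card (S X) * prod m Z') * m x"
      using insert by simp
    also have "\<dots> \<le> card (S Y) * m x"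
      using insert m[of x] unfolding Y_def by (intro mult_right_mono) auto
    finally show ?case using 1 unfolding Y_def by simp
  qed
  from this[of Z] show ?thesis unfolding S_def by simp
qed

text \<open>Convexity of the power without derivatives: multiplying the bound for \<open>s\<close>
  by \<open>a\<close> exceeds the bound for \<open>Suc s\<close> by a nonnegative multiple of (a -
  m)^2.\<close>

lemma power_above_tangent:
  fixes a m :: real
  assumes "0 \<le> a" "0 \<le> m"
  shows "m ^ Suc s + Suc s * m ^ s * (a - m) \<le> a ^ Suc s"
proof (induction s)
  case 0
  then show ?case by simp
next
  case (Suc s)
  have "a * (m ^ Suc s + Suc s * m ^ s * (a - m)) \<le> a * a ^ Suc s"
    by (intro mult_left_mono Suc assms)
  moreover have "a * (m ^ Suc s + Suc s * m ^ s * (a - m)) - (m ^ Suc (Suc s) + Suc (Suc s) * m ^ Suc s * (a - m))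
     = Suc s * m ^ s * (a - m)^2"
    by (simp add: algebra_simps power2_eq_square)
  moreover have "0 \<le> Suc s * m ^ s * (a - m)^2" using assms by simp
  ultimately show ?case by simp
qed

text \<open>The tangent is taken at the mean, where the linear terms cancel in the sum; multiplying
  through by powers of the cardinality removes the quotients.\<close>

lemma power_mean:
  fixes a :: "'i \<Rightarrow> real"
  assumes "finite I" "\<And>i. i \<in> I \<Longrightarrow> 0 \<le> a i"
  shows "(sum a I) ^ Suc s \<le> card I ^ s * (\<Sum>i\<in>I. a i ^ Suc s)"
proof (cases "I = {}")
  case False
  define N where "N = real (card I)"
  have N: "N > 0" using False assms by (simp add: N_def card_gt_0_iff)
  define m where "m = sum a I / N"
  have m: "m \<ge> 0" unfolding m_def using assms N by (simp add: sum_nonneg)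
  have "N * m ^ Suc s = (\<Sum>i\<in>I. m ^ Suc s + Suc s * m ^ s * (a i - m))"
  proof -
    have "(\<Sum>i\<in>I. a i - m) = 0" using N by (simp add: sum_subtractf m_def N_def)
    then show ?thesis by (simp add: sum.distrib N_def flip: sum_distrib_left)
  qed
  also have "\<dots> \<le> (\<Sum>i\<in>I. a i ^ Suc s)"
    by (intro sum_mono power_above_tangent assms m)
  finally have "N ^ s * (N * m ^ Suc s) \<le> N ^ s * (\<Sum>i\<in>I. a i ^ Suc s)"
    using N by (intro mult_left_mono) auto
  moreover have "N ^ s * (N * m ^ Suc s) = (sum a I) ^ Suc s"
    using N by (simp add: m_def power_divide)
  ultimately show ?thesis by (simp add: N_def)
qed auto

text \<open>Homomorphisms of the complete multipartite graph on \<open>I\<close> whose parts are the fibres of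
  \<open>col\<close>. An injective \<open>col\<close> gives ordered cliques, and \<open>col\<close> a proper colouring of a graph on \<open>I\<close>
  gives homomorphisms of that graph.\<close>

definition cmult :: "('v \<Rightarrow> 'v \<Rightarrow> bool) \<Rightarrow> 'v set \<Rightarrow> ('a \<Rightarrow> nat) \<Rightarrow> 'a set \<Rightarrow> ('a \<Rightarrow> 'v) set" where
  "cmult E A col I = {f \<in> I \<rightarrow>\<^sub>E A. \<forall>a\<in>I. \<forall>b\<in>I. col a \<noteq> col b \<longrightarrow> E (f a) (f b)}"

lemma finite_cmult: "finite A \<Longrightarrow> finite I \<Longrightarrow> finite (cmult E A col I)"
  unfolding cmult_def by (rule finite_subset[OF _ finite_PiE[of I "\<lambda>_. A"]]) auto

text \<open>The vertex \<open>u\<close> is replaced by \<open>card J\<close> twins. Given a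
  placement \<open>g\<close> of \<open>I\<close>, every twin may independently take any of the
  candidates \<open>D g\<close> for \<open>u\<close>; the power mean over all \<open>g\<close>
  compares the two totals.\<close>

lemma cmult_blowup:
  assumes fin: "finite A" "finite I" "finite J" and u: "u \<notin> I" and J: "J \<noteq> {}" "J \<inter> I = {}"
    and col: "\<And>j. j \<in> J \<Longrightarrow> col j = col u" and E: "symp E"
  shows "real (card (cmult E A col (insert u I))) ^ card J
     \<le> real (card A) ^ (card I * (card J - 1)) * card (cmult E A col (I \<union> J))"
proof -
  define D where "D g = {v \<in> A. g(u := v) \<in> cmult E A col (insert u I)}" for g
  define P where "P = I \<rightarrow>\<^sub>E A"
  have finP: "finite P" unfolding P_def using fin by (simp add: finite_PiE)
  have finD: "finite (D g)" for g using fin by (simp add: D_def)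
  have c1: "card (cmult E A col (insert u I)) \<le> card (SIGMA g:P. D g)"
  proof (rule card_inj_on_le)
    show "inj_on (\<lambda>f. (restrict f I, f u)) (cmult E A col (insert u I))"
    proof (rule inj_onI, clarify)
      fix f g assume *: "f \<in> cmult E A col (insert u I)" "g \<in> cmult E A col (insert u I)"
        "restrict f I = restrict g I" "f u = g u"
      show "f = g"
      proof (rule ext)
        fix x
        consider "x = u" | "x \<in> I" | "x \<notin> insert u I" by auto
        then show "f x = g x"
        proof cases
          case 2
          then show ?thesis using fun_cong[OF *(3), of x] by simp
        qed (use * in \<open>auto simp: cmult_def PiE_def extensional_def\<close>)
      qed
    qed
    have "(restrict f I)(u := f u) = f" if "f \<in> cmult E A col (insert u I)" for f
      using that by (auto simp: cmult_def PiE_def extensional_def)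
    then show "(\<lambda>f. (restrict f I, f u)) ` cmult E A col (insert u I) \<subseteq> (SIGMA g:P. D g)"
      by (auto simp: P_def D_def) (auto simp: cmult_def)
    show "finite (SIGMA g:P. D g)" using finP finD by simp
  qed
  have c2: "card (SIGMA g:P. J \<rightarrow>\<^sub>E D g) \<le> card (cmult E A col (I \<union> J))"
  proof (rule card_inj_on_le)
    let ?m = "\<lambda>(g,k) x. if x \<in> J then k x else g x"
    show "inj_on ?m (SIGMA g:P. J \<rightarrow>\<^sub>E D g)"
    proof (rule inj_onI, clarify)
      fix g k g' k' assume *: "g \<in> P" "k \<in> J \<rightarrow>\<^sub>E D g" "g' \<in> P" "k' \<in> J \<rightarrow>\<^sub>E D g'"
        "(\<lambda>x. if x \<in> J then k x else g x) = (\<lambda>x. if x \<in> J then k' x else g' x)"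
      have "g x = g' x" for x
        using fun_cong[OF *(5), of x] * J unfolding P_def
        by (cases "x \<in> J") (auto simp: PiE_def extensional_def disjoint_iff)
      moreover have "k x = k' x" for x
        using fun_cong[OF *(5), of x] * J
        by (cases "x \<in> J") (auto simp: PiE_def extensional_def)
      ultimately show "g = g' \<and> k = k'" by auto
    qed
    show "?m ` (SIGMA g:P. J \<rightarrow>\<^sub>E D g) \<subseteq> cmult E A col (I \<union> J)"
    proof clarify
      fix g k assume g: "g \<in> P" and k: "k \<in> J \<rightarrow>\<^sub>E D g"
      have kD: "k j \<in> D g" if "j \<in> J" for j using k that by auto
      have kE: "E (k j) (g b)" if "j \<in> J" "b \<in> I" "col j \<noteq> col b" for j b
      proof -
        have "E ((g(u := k j)) u) ((g(u := k j)) b)"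
          using kD[OF that(1)] that col[OF that(1)] unfolding D_def cmult_def by simp
        then show ?thesis using that u by (metis fun_upd_apply)
      qed
      \<comment> \<open>The edges inside \<open>I\<close> are inherited from the candidate chosen
        for any one twin, so there must be a twin.\<close>
      obtain j where j: "j \<in> J" using J by auto
      have gE: "E (g a) (g b)" if "a \<in> I" "b \<in> I" "col a \<noteq> col b" for a b
      proof -
        have "E ((g(u := k j)) a) ((g(u := k j)) b)"
          using kD[OF j] that unfolding D_def cmult_def by blast
        then show ?thesis using that u by (metis fun_upd_apply)
      qed
      have kE': "E (g b) (k j)" if "j \<in> J" "b \<in> I" "col b \<noteq> col j" for j b
        using kE[of j b] that E by (auto dest: sympD)
      show "(\<lambda>x. if x \<in> J then k x else g x) \<in> cmult E A col (I \<union> J)"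
        using g k kE kE' gE col kD
        by (auto simp: cmult_def P_def PiE_def extensional_def D_def Pi_def)
    qed
    show "finite (cmult E A col (I \<union> J))" using fin by (simp add: finite_cmult)
  qed
  obtain s where s: "card J = Suc s" using J fin by (metis card_eq_0_iff not0_implies_Suc)
  have "real (card (cmult E A col (insert u I))) ^ card J \<le> (\<Sum>g\<in>P. real (card (D g))) ^ Suc s"
    unfolding s using c1 card_SigmaI[of P D] finP finD
    by (intro power_mono) (simp_all flip: of_nat_sum)
  also have "\<dots> \<le> card P ^ s * (\<Sum>g\<in>P. real (card (D g)) ^ Suc s)"
    by (rule power_mean) (use finP in auto)
  also have "(\<Sum>g\<in>P. real (card (D g)) ^ Suc s) = real (card (SIGMA g:P. J \<rightarrow>\<^sub>E D g))"
    using finP finD fin s by (simp add: card_SigmaI finite_PiE card_PiE)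
  also have "card P ^ s * real (card (SIGMA g:P. J \<rightarrow>\<^sub>E D g)) \<le> card P ^ s * real (card (cmult E A col (I \<union> J)))"
    using c2 by (intro mult_left_mono) auto
  also have "real (card P ^ s) = real (card A) ^ (card I * (card J - 1))"
    using fin by (simp add: P_def card_PiE s power_mult)
  finally show ?thesis by simp
qed

abbreviation cliq :: "('v \<Rightarrow> 'v \<Rightarrow> bool) \<Rightarrow> nat \<Rightarrow> 'v set \<Rightarrow> (nat \<Rightarrow> 'v) set" where
  "cliq E s A \<equiv> cmult E A (\<lambda>i. i) {..<s}"

text \<open>Starting from one representative per colour, the colour classes are unfolded one after the
  other; by \<open>cmult_blowup\<close> each step raises the homomorphism density to the power of the class size.\<close>

lemma cmult_supersaturation:
  fixes n :: real
  assumes fin: "finite U" "finite A" and phi: "\<phi> ` U = {..<k}" and n: "real (card A) \<le> n" "n > 0"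
    and g: "0 < \<gamma>" "\<gamma> \<le> 1" and E: "symp E"
    and many: "\<gamma> * n ^ k \<le> card (cliq E k A)"
  shows "\<gamma> ^ (card U ^ k) * n ^ card U \<le> card (cmult E A \<phi> U)"
proof -
  have "\<forall>j<k. \<exists>x\<in>U. \<phi> x = j" using phi by (metis imageE lessThan_iff)
  then obtain r where r: "\<And>j. j < k \<Longrightarrow> r j \<in> U \<and> \<phi> (r j) = j" by metis
  define C where "C j = {x \<in> U. \<phi> x = j}" for j
  define I where "I j = {x \<in> U. \<phi> x < j} \<union> r ` {j..<k}" for j
  have finI: "finite (I j)" for j using fin by (simp add: I_def)
  have "\<gamma> ^ (\<Prod>i<j. card (C i)) * n ^ card (I j) \<le> card (cmult E A \<phi> (I j))" if "j \<le> k" for j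
    using that
  proof (induction j)
    case 0
    have I0: "I 0 = r ` {..<k}" by (auto simp: I_def)
    have "inj_on r {..<k}" by (metis inj_onI lessThan_iff r)
    then have cI: "card (I 0) = k" by (simp add: I0 card_image)
    have "card (cliq E k A) \<le> card (cmult E A \<phi> (I 0))"
    proof (rule card_inj_on_le)
      show "inj_on (\<lambda>x. restrict (x \<circ> \<phi>) (I 0)) (cliq E k A)"
      proof (rule inj_onI)
        fix x y assume *: "x \<in> cliq E k A" "y \<in> cliq E k A"
          "restrict (x \<circ> \<phi>) (I 0) = restrict (y \<circ> \<phi>) (I 0)"
        show "x = y"
        proof (rule ext)
          fix i
          show "x i = y i"
          proof (cases "i < k")
            case True
            then show ?thesis using fun_cong[OF *(3), of "r i"] r[OF True] by (auto simp: I0)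
          next
            case False
            then show ?thesis using * by (auto simp: cmult_def PiE_def extensional_def)
          qed
        qed
      qed
      show "(\<lambda>x. restrict (x \<circ> \<phi>) (I 0)) ` cliq E k A \<subseteq> cmult E A \<phi> (I 0)"
        using r by (auto simp: cmult_def I0 PiE_def Pi_def)
      show "finite (cmult E A \<phi> (I 0))" using fin finI by (simp add: finite_cmult)
    qed
    then show ?case using many cI by simp
  next
    case (Suc j)
    define I' where "I' = I j - {r j}"
    define s where "s = card (C j)"
    have rj: "r j \<in> U" "\<phi> (r j) = j" using r Suc by auto
    have Ij: "I j = insert (r j) I'" using Suc by (auto simp: I'_def I_def)
    have IS: "I (Suc j) = I' \<union> C j"
    proof -
      have "{j..<k} = insert j {Suc j..<k}" using Suc by auto
      then have 1: "I j = {x \<in> U. \<phi> x < j} \<union> insert (r j) (r ` {Suc j..<k})" by (auto simp: I_def)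
      have 2: "{x \<in> U. \<phi> x < Suc j} = {x \<in> U. \<phi> x < j} \<union> C j" by (auto simp: C_def less_Suc_eq)
      have 3: "r j \<notin> r ` {Suc j..<k}"
      proof
        assume "r j \<in> r ` {Suc j..<k}"
        then obtain i where "i \<in> {Suc j..<k}" "r j = r i" by auto
        then show False using r[of i] rj by auto
      qed
      have "r j \<in> C j" "r j \<notin> {x \<in> U. \<phi> x < j}" using rj by (auto simp: C_def)
      then show ?thesis using 1 2 3 unfolding I'_def I_def[of "Suc j"] by auto
    qed
    have disj: "C j \<inter> I' = {}" using r Suc by (auto simp: I'_def I_def C_def) 
    have finI': "finite I'" "finite (C j)" using finI fin by (auto simp: I'_def C_def)
    have ne: "C j \<noteq> {}" using rj by (auto simp: C_def)
    then have s1: "s \<ge> 1" using finI' by (simp add: s_def Suc_le_eq card_gt_0_iff)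
    define i where "i = card I'"
    have "r j \<notin> I'" by (simp add: I'_def)
    then have cIj: "card (I j) = Suc i" using finI' by (simp add: Ij i_def)
    have cIS: "card (I (Suc j)) = i + s" using finI' disj by (simp add: IS card_Un_disjoint i_def s_def Int_commute)
    define P where "P = (\<Prod>i<j. card (C i))"
    have "(\<gamma> ^ P * n ^ Suc i) ^ s \<le> real (card (cmult E A \<phi> (I j))) ^ s"
      using Suc g n by (intro power_mono) (simp_all add: P_def cIj)
    also have "\<dots> \<le> real (card A) ^ (i * (s - 1)) * card (cmult E A \<phi> (I (Suc j)))"
      unfolding Ij IS s_def i_def
      by (rule cmult_blowup) (use fin finI' disj ne E rj in \<open>auto simp: I'_def C_def\<close>)
    also have "\<dots> \<le> n ^ (i * (s - 1)) * card (cmult E A \<phi> (I (Suc j)))"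
      using n by (intro mult_right_mono power_mono) auto
    finally have "(\<gamma> ^ P * n ^ Suc i) ^ s \<le> n ^ (i * (s - 1)) * card (cmult E A \<phi> (I (Suc j)))" .
    \<comment> \<open>Splits off exactly the power of \<open>n\<close> that the blow-up loses, so
      that it cancels.\<close>
    moreover have "Suc i * s = i * (s - 1) + (i + s)" using s1 by (cases s) auto
    then have "(\<gamma> ^ P * n ^ Suc i) ^ s = n ^ (i * (s - 1)) * (\<gamma> ^ (P * s) * n ^ (i + s))"
      by (metis (no_types, lifting) mult.left_commute power_add power_mult power_mult_distrib)
    ultimately have "n ^ (i * (s - 1)) * (\<gamma> ^ (P * s) * n ^ (i + s)) \<le> n ^ (i * (s - 1)) * card (cmult E A \<phi> (I (Suc j)))"
      by simp
    then have "\<gamma> ^ (P * s) * n ^ (i + s) \<le> card (cmult E A \<phi> (I (Suc j)))"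
      using n by (simp add: mult_le_cancel_left)
    then show ?case by (simp add: P_def s_def cIS)
  qed
  from this[of k] have *: "\<gamma> ^ (\<Prod>i<k. card (C i)) * n ^ card (I k) \<le> card (cmult E A \<phi> (I k))" by simp
  have Ik: "I k = U" using phi by (auto simp: I_def)
  \<comment> \<open>Bounding each class crudely by \<open>card U\<close> gives the exponent
    \<open>card U ^ k\<close>, which later has to be matched by the size of
    \<open>t\<close>.\<close>
  have "(\<Prod>i<k. card (C i)) \<le> (\<Prod>i<k. card U)"
    by (intro prod_mono) (auto simp: C_def intro!: card_mono fin)
  then have "\<gamma> ^ (card U ^ k) \<le> \<gamma> ^ (\<Prod>i<k. card (C i))"
    using g by (intro power_decreasing) auto
  then have "\<gamma> ^ (card U ^ k) * n ^ card U \<le> \<gamma> ^ (\<Prod>i<k. card (C i)) * n ^ card U"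
    using n by (intro mult_right_mono) auto
  then show ?thesis using * unfolding Ik by simp
qed

section \<open>Recursions for clique counts; counting versions of the theorems of Turan and
  Ramsey\<close>

lemma card_cmult_empty [simp]: "card (cmult E A col {}) = 1"
proof -
  have "cmult E A col {} = {\<lambda>_. undefined}" by (auto simp: cmult_def)
  then show ?thesis by simp
qed

lemma card_cliq_Suc_ext:
  assumes "finite A" "symp E"
  shows "card (cliq E (Suc s) A) = (\<Sum>x\<in>cliq E s A. card {v \<in> A. \<forall>i<s. E (x i) v})"
proof -
  have "bij_betw (\<lambda>(x,v). x(s := v)) (SIGMA x:cliq E s A. {v \<in> A. \<forall>i<s. E (x i) v}) (cliq E (Suc s) A)"
  proof (rule bij_betwI[where g = "\<lambda>x. (restrict x {..<s}, x s)"], goal_cases)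
    case 1
    then show ?case using assms(2)
      by (auto simp: cmult_def PiE_def Pi_def extensional_def less_Suc_eq dest: sympD)
  next
    case 2
    then show ?case using assms(2)
      by (auto simp: cmult_def PiE_def Pi_def extensional_def less_Suc_eq dest: sympD)
  next
    case (3 x)
    then show ?case by (auto simp: cmult_def PiE_def extensional_def restrict_def fun_eq_iff)
  next
    case (4 y)
    then show ?case by (auto simp: cmult_def PiE_def extensional_def restrict_def fun_eq_iff less_Suc_eq)
  qed
  from bij_betw_same_card[OF this] show ?thesis
    using assms finite_cmult[of A "{..<s}"] by (simp add: card_SigmaI)
qed

text \<open>Here the last vertex is chosen first and the rest is a clique in its neighbourhood, the
  form that suits the Turan and Ramsey inductions. The companion \<open>card_cliq_Suc_ext\<close>
  chooses it last, which suits \<open>typical_clique\<close>.\<close>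

lemma card_cliq_Suc_nb:
  assumes "finite A" "symp E"
  shows "card (cliq E (Suc s) A) = (\<Sum>v\<in>A. card (cliq E s {w \<in> A. E v w}))"
proof -
  have "bij_betw (\<lambda>(v,x). x(s := v)) (SIGMA v:A. cliq E s {w \<in> A. E v w}) (cliq E (Suc s) A)"
  proof (rule bij_betwI[where g = "\<lambda>x. (x s, restrict x {..<s})"], goal_cases)
    case 1
    then show ?case using assms(2)
      by (auto simp: cmult_def PiE_def Pi_def extensional_def less_Suc_eq dest: sympD)
  next
    case 2
    then show ?case using assms(2)
      by (auto simp: cmult_def PiE_def Pi_def extensional_def less_Suc_eq dest: sympD)
  next
    case (3 x)
    then show ?case by (auto simp: cmult_def PiE_def extensional_def restrict_def fun_eq_iff)
  next
    case (4 y)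
    then show ?case by (auto simp: cmult_def PiE_def extensional_def restrict_def fun_eq_iff less_Suc_eq)
  qed
  from bij_betw_same_card[OF this] show ?thesis
    using assms by (simp add: card_SigmaI finite_cmult)
qed

lemma card_cliq_1:
  assumes "finite A" "symp E"
  shows "card (cliq E (Suc 0) A) = card A"
  using card_cliq_Suc_nb[OF assms, of 0] by simp

lemma card_cliq_2:
  assumes "finite A" "symp E"
  shows "card (cliq E 2 A) = (\<Sum>v\<in>A. card {w \<in> A. E v w})"
  using card_cliq_Suc_nb[OF assms, of 1] assms by (simp add: card_cliq_1 numeral_2_eq_2)

lemma cliq_mono: "A \<subseteq> B \<Longrightarrow> cliq E s A \<subseteq> cliq E s B"
  by (auto simp: cmult_def PiE_def Pi_def)

text \<open>Moon--Moser style: the induction applies the bound inside every neighbourhood. Measuring the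
  error as \<open>z * card A\<close>, linear in \<open>A\<close>, lets the slack \<open>z\<close> survive the induction unchanged.\<close>

lemma turan_cliq:
  fixes z :: real
  assumes A: "finite A" and E: "symp E" and z: "z > 0"
  shows "card (cliq E 2 A) \<le> (1 - 1 / real (Suc q)) * card A ^ 2 + z * card A + card (cliq E (q + 2) A) / z ^ q"
  using A
proof (induction q arbitrary: A)
  case 0
  then show ?case using z by (simp add: numeral_2_eq_2)
next
  case (Suc q A)
  define N where "N v = {w \<in> A. E v w}" for v
  define d where "d v = real (card (N v))" for v
  define m where "m = real (card A)"
  define h2 where "h2 = real (card (cliq E 2 A))"
  define Q where "Q = (\<Sum>v\<in>A. d v ^ 2)"
  define r where "r = real (Suc q)"
  define K where "K = real (card (cliq E (q + 3) A))"
  have r: "r > 0" by (simp add: r_def)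
  have finN: "finite (N v)" for v using Suc by (simp add: N_def)
  have h2: "h2 = (\<Sum>v\<in>A. d v)" unfolding h2_def card_cliq_2[OF Suc.prems E] d_def N_def by simp
  have card3: "card (cliq E 3 A) = (\<Sum>v\<in>A. card (cliq E 2 (N v)))"
    using card_cliq_Suc_nb[OF Suc.prems E, of 2] by (simp add: N_def numeral_3_eq_3 numeral_2_eq_2)
  \<comment> \<open>The ends of an edge have at least \<open>d v + d w - m\<close> common
    neighbours. Summed over ordered edges, this bounds the triangles from below by squared degrees,
    while the induction hypothesis bounds them from above.\<close>
  have "2 * Q - m * h2 = (\<Sum>v\<in>A. \<Sum>w\<in>N v. d v + d w - m)"
  proof -
    have "(\<Sum>v\<in>A. \<Sum>w\<in>N v. d w) = (\<Sum>v\<in>A. \<Sum>w\<in>A. if E v w then d w else 0)"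
      using Suc.prems by (auto simp: N_def sum.If_cases Int_def intro!: sum.cong)
    also have "\<dots> = (\<Sum>w\<in>A. \<Sum>v\<in>A. if E v w then d w else 0)" by (rule sum.swap)
    also have "\<dots> = (\<Sum>w\<in>A. \<Sum>v\<in>N w. d w)"
    proof (rule sum.cong[OF refl])
      fix w assume "w \<in> A"
      have "{v \<in> A. E v w} = N w" using E by (auto simp: N_def dest: sympD)
      then show "(\<Sum>v\<in>A. if E v w then d w else 0) = (\<Sum>v\<in>N w. d w)"
        using Suc.prems by (simp add: sum.If_cases Int_def)
    qed
    also have "\<dots> = Q" by (simp add: Q_def d_def power2_eq_square)
    finally have *: "(\<Sum>v\<in>A. \<Sum>w\<in>N v. d w) = Q" .
    show ?thesis unfolding h2
      by (simp add: sum.distrib sum_subtractf *) (simp add: Q_def d_def power2_eq_square sum_distrib_left mult.commute)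
  qed
  also have "\<dots> \<le> (\<Sum>v\<in>A. \<Sum>w\<in>N v. real (card {x \<in> N v. E w x}))"
  proof (intro sum_mono)
    fix v w assume "v \<in> A" "w \<in> N v"
    have "card (N v) + card (N w) = card (N v \<union> N w) + card (N v \<inter> N w)"
      using card_Un_Int[OF finN finN] .
    moreover have "card (N v \<union> N w) \<le> card A" using Suc.prems by (intro card_mono) (auto simp: N_def)
    moreover have "N v \<inter> N w = {x \<in> N v. E w x}" by (auto simp: N_def)
    ultimately show "d v + d w - m \<le> card {x \<in> N v. E w x}" by (simp add: d_def m_def)
  qed
  also have "\<dots> = card (cliq E 3 A)" unfolding card3 by (simp add: card_cliq_2[OF finN E])
  also have "\<dots> \<le> (\<Sum>v\<in>A. (1 - 1 / r) * d v ^ 2 + z * d v + card (cliq E (q + 2) (N v)) / z ^ q)"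
    unfolding card3 of_nat_sum d_def r_def using Suc.IH[OF finN] by (intro sum_mono) (simp del: of_nat_Suc)
  also have "\<dots> = (1 - 1 / r) * Q + z * h2 + K / z ^ q"
  proof -
    have "K = (\<Sum>v\<in>A. real (card (cliq E (q + 2) (N v))))"
      using card_cliq_Suc_nb[OF Suc.prems E, of "q+2"] by (simp add: K_def N_def eval_nat_numeral)
    then show ?thesis unfolding Q_def h2 by (simp add: sum.distrib sum_distrib_left sum_divide_distrib)
  qed
  finally have main: "(1 + 1 / r) * Q \<le> m * h2 + z * h2 + K / z ^ q" by (simp add: algebra_simps)
  have CS: "h2 ^ 2 \<le> m * Q"
    using power_mean[OF Suc.prems, of d 1] unfolding h2 Q_def m_def
    by (simp add: numeral_2_eq_2 d_def)
  have K0: "K \<ge> 0" by (simp add: K_def)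
  have m0: "m \<ge> 0" by (simp add: m_def)
  have "h2 \<le> (1 - 1 / (r + 1)) * m ^ 2 + z * m + K / z ^ Suc q"
  \<comment> \<open>With at most \<open>z * m\<close> edges the slack alone suffices. Otherwise
    \<open>m\<close> is below \<open>h2 / z\<close>, so the clique error, which carries a factor
    \<open>m\<close>, can be divided by \<open>h2\<close> at the cost of one more power of
    \<open>z\<close>.\<close>
  proof (cases "h2 \<le> z * m")
    case True
    have "0 \<le> (1 - 1 / (r + 1)) * m ^ 2" using r by simp
    moreover have "0 \<le> K / z ^ Suc q" using K0 z by simp
    ultimately show ?thesis using True by linarith
  next
    case False
    then have hp: "h2 > z * m" "h2 > 0" using z m0 by (auto simp: not_le) (meson less_le_trans mult_nonneg_nonneg not_le less_imp_le)
    have "(1 + 1 / r) * h2 ^ 2 \<le> (1 + 1 / r) * (m * Q)" using CS r by (intro mult_left_mono) auto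
    also have "\<dots> = m * ((1 + 1 / r) * Q)" by simp
    also have "\<dots> \<le> m * (m * h2 + z * h2 + K / z ^ q)" using main m0 by (intro mult_left_mono) auto
    also have "\<dots> = (m ^ 2 + z * m) * h2 + m * (K / z ^ q)" by (simp add: algebra_simps power2_eq_square)
    also have "m * (K / z ^ q) \<le> (h2 / z) * (K / z ^ q)"
      using hp z K0 by (intro mult_right_mono) (auto simp: field_simps)
    also have "\<dots> = h2 * (K / z ^ Suc q)" using z by simp
    finally have "h2 * ((1 + 1 / r) * h2) \<le> h2 * (m ^ 2 + z * m + K / z ^ Suc q)"
      by (simp add: algebra_simps power2_eq_square)
    then have *: "(1 + 1 / r) * h2 \<le> m ^ 2 + z * m + K / z ^ Suc q" using hp by (simp add: mult_le_cancel_left)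
    have "r + r * r > 0" using r by (simp add: add_pos_pos)
    then have rr: "(1 - 1 / (r + 1)) * (1 + 1 / r) = 1" using r by (simp add: field_simps)
    have "h2 = (1 - 1 / (r + 1)) * ((1 + 1 / r) * h2)" using rr by (metis mult.assoc mult_1)
    also have "\<dots> \<le> (1 - 1 / (r + 1)) * (m ^ 2 + z * m + K / z ^ Suc q)"
      using r * by (intro mult_left_mono) auto
    also have "\<dots> = (1 - 1 / (r + 1)) * m ^ 2 + (1 - 1 / (r + 1)) * (z * m + K / z ^ Suc q)"
      by (simp add: algebra_simps)
    also have "(1 - 1 / (r + 1)) * (z * m + K / z ^ Suc q) \<le> 1 * (z * m + K / z ^ Suc q)"
      using r z m0 K0 by (intro mult_right_mono) auto
    finally show ?thesis by simp
  qed
  then show ?case unfolding h2_def m_def K_def r_def by (simp add: numeral_3_eq_3 add.commute)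
qed

text \<open>Every vertex has degree at least \<open>m / 4\<close> in one of the relations, and the
  same one serves for half of the vertices. Inside their neighbourhoods, either a single one already
  contains enough cliques of the other kind, or each contributes its share and there are at least
  \<open>y\<close> of them. The factor 4 per step is the shrinking of the vertex set.\<close>

lemma ramsey_cliq:
  fixes y :: real
  assumes A: "finite A" and E: "symp E1" "symp E2"
    and tot: "\<And>u v. u \<in> A \<Longrightarrow> v \<in> A \<Longrightarrow> u \<noteq> v \<Longrightarrow> E1 u v \<or> E2 u v"
    and y: "y \<ge> 1" and big: "4 ^ (a + b) * y \<le> card A"
  shows "y ^ a \<le> card (cliq E1 a A) \<or> y ^ b \<le> card (cliq E2 b A)"
  using A tot big
proof (induction "a + b" arbitrary: a b A)
  case 0
  then show ?case by simp
next
  case (Suc s)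
  show ?case
  proof (cases "a = 0 \<or> b = 0")
    case True
    then show ?thesis by fastforce
  next
    case False
    then obtain a' b' where ab: "a = Suc a'" "b = Suc b'" by (metis not0_implies_Suc)
    define m where "m = real (card A)"
    define N1 where "N1 v = {w \<in> A. E1 v w}" for v
    define N2 where "N2 v = {w \<in> A. E2 v w}" for v
    have s4: "4 ^ (a + b) * y = 4 * (4 ^ s * y)" using Suc(2) by (metis mult.assoc power_Suc)
    have "4 ^ s * y \<ge> 1" using y by (metis mult_mono' one_le_numeral one_le_power mult_1 zero_le_one)
    then have m4: "m \<ge> 4" using Suc.prems(3) s4 unfolding m_def by linarith
    have finN: "finite (N1 v)" "finite (N2 v)" for v using Suc.prems by (auto simp: N1_def N2_def)
    define A1 where "A1 = {v \<in> A. m / 4 \<le> card (N1 v)}"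
    define A2 where "A2 = {v \<in> A. m / 4 \<le> card (N2 v)}"
    have "A \<subseteq> A1 \<union> A2"
    proof
      fix v assume v: "v \<in> A"
      have "A - {v} \<subseteq> N1 v \<union> N2 v" using Suc.prems(2) v by (auto simp: N1_def N2_def)
      then have "card (A - {v}) \<le> card (N1 v) + card (N2 v)"
        by (meson card_Un_le card_mono finN finite_UnI le_trans)
      moreover have "real (card (A - {v})) = m - 1" using v Suc.prems m4 by (simp add: m_def card_Diff_singleton)
      ultimately have "m - 1 \<le> real (card (N1 v)) + real (card (N2 v))" by linarith
      then show "v \<in> A1 \<union> A2" using v m4 by (auto simp: A1_def A2_def)
    qed
    moreover have "A1 \<union> A2 \<subseteq> A" by (auto simp: A1_def A2_def)
    ultimately have "card A \<le> card (A1 \<union> A2)" by (simp add: subset_antisym)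
    also have "\<dots> \<le> card A1 + card A2" by (rule card_Un_le)
    finally have "card A \<le> card A1 + card A2" .
    then have m2: "m / 2 \<le> card A1 \<or> m / 2 \<le> card A2" unfolding m_def by linarith
    have big: "4 ^ s * y \<le> m / 4" using Suc.prems(3) s4 by (simp add: m_def)
    have y2: "y \<le> m / 2"
    proof -
      have "1 * y \<le> 4 ^ s * y" using y by (intro mult_right_mono) auto
      then show ?thesis using big m4 by linarith
    qed
    have A12: "A1 \<subseteq> A" "A2 \<subseteq> A" by (auto simp: A1_def A2_def)
    have yk: "y * y ^ j \<le> real (card B) * y ^ j" if "m / 2 \<le> card B" for B :: "'a set" and j
      using y y2 that by (intro mult_right_mono) auto
    from m2 show ?thesis
    proof
      assume m2: "m / 2 \<le> card A1"
      have IH: "y ^ a' \<le> card (cliq E1 a' (N1 v)) \<or> y ^ b \<le> card (cliq E2 b (N1 v))" if "v \<in> A1" for v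
        using Suc(1)[of a' b "N1 v"] Suc(2) ab that big Suc.prems finN(1)
        by (fastforce simp: A1_def N1_def)
      show ?thesis
      proof (cases "\<exists>v\<in>A1. y ^ b \<le> card (cliq E2 b (N1 v))")
        case True
        then obtain v where v: "v \<in> A1" "y ^ b \<le> card (cliq E2 b (N1 v))" by auto
        have "card (cliq E2 b (N1 v)) \<le> card (cliq E2 b A)"
          using Suc.prems by (intro card_mono finite_cmult cliq_mono) (auto simp: N1_def)
        then show ?thesis using v(2) by linarith
      next
        case False
        have "y * y ^ a' \<le> real (card A1) * y ^ a'" using yk m2 by blast
        also have "\<dots> = (\<Sum>v\<in>A1. y ^ a')" by simp
        also have "\<dots> \<le> (\<Sum>v\<in>A1. real (card (cliq E1 a' (N1 v))))" using IH False by (intro sum_mono) auto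
        also have "\<dots> \<le> (\<Sum>v\<in>A. real (card (cliq E1 a' (N1 v))))" using A12 Suc.prems by (intro sum_mono2) auto
        also have "\<dots> = card (cliq E1 a A)" unfolding ab card_cliq_Suc_nb[OF Suc.prems(1) E(1)] N1_def by simp
        finally show ?thesis by (simp add: ab)
      qed
    next
      assume m2: "m / 2 \<le> card A2"
      have IH: "y ^ a \<le> card (cliq E1 a (N2 v)) \<or> y ^ b' \<le> card (cliq E2 b' (N2 v))" if "v \<in> A2" for v
        using Suc(1)[of a b' "N2 v"] Suc(2) ab that big Suc.prems finN(2)
        by (fastforce simp: A2_def N2_def)
      show ?thesis
      proof (cases "\<exists>v\<in>A2. y ^ a \<le> card (cliq E1 a (N2 v))")
        case True
        then obtain v where v: "v \<in> A2" "y ^ a \<le> card (cliq E1 a (N2 v))" by auto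
        have "card (cliq E1 a (N2 v)) \<le> card (cliq E1 a A)"
          using Suc.prems by (intro card_mono finite_cmult cliq_mono) (auto simp: N2_def)
        then show ?thesis using v(2) by linarith
      next
        case False
        have "y * y ^ b' \<le> real (card A2) * y ^ b'" using yk m2 by blast
        also have "\<dots> = (\<Sum>v\<in>A2. y ^ b')" by simp
        also have "\<dots> \<le> (\<Sum>v\<in>A2. real (card (cliq E2 b' (N2 v))))" using IH False by (intro sum_mono) auto
        also have "\<dots> \<le> (\<Sum>v\<in>A. real (card (cliq E2 b' (N2 v))))" using A12 Suc.prems by (intro sum_mono2) auto
        also have "\<dots> = card (cliq E2 b A)" unfolding ab card_cliq_Suc_nb[OF Suc.prems(1) E(2)] N2_def by simp
        finally show ?thesis by (simp add: ab)
      qed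
    qed
  qed
qed

section \<open>Two-colourings with few monochromatic cliques of high degree\<close>

text \<open>The inequality excludes the singleton \<open>{v}\<close>, where a colouring still takes
  some unspecified value.\<close>

definition adj :: "(nat set \<Rightarrow> colour) \<Rightarrow> colour \<Rightarrow> nat \<Rightarrow> nat \<Rightarrow> bool" where
  "adj c col u v \<longleftrightarrow> u \<noteq> v \<and> c {u, v} = col"

definition nb :: "(nat set \<Rightarrow> colour) \<Rightarrow> nat \<Rightarrow> colour \<Rightarrow> nat \<Rightarrow> nat set" where
  "nb c n col v = {w \<in> {..<n}. adj c col v w}"

lemma symp_adj: "symp (adj c col)"
  by (auto simp: symp_def adj_def insert_commute)

lemma adj_sym: "adj c col u v \<longleftrightarrow> adj c col v u"
  by (auto simp: adj_def insert_commute)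

lemma colour_cases: "(a::colour) \<noteq> b \<Longrightarrow> x = a \<or> x = b"
  by (cases a; cases b; cases x) auto

lemma adj_other: "a \<noteq> b \<Longrightarrow> u \<noteq> v \<Longrightarrow> adj c a u v \<longleftrightarrow> \<not> adj c b u v"
  using colour_cases[of a b "c {u, v}"] by (auto simp: adj_def)

lemma adj_excl: "a \<noteq> b \<Longrightarrow> adj c a u v \<Longrightarrow> \<not> adj c b u v"
  by (auto simp: adj_def)

lemma not_adj_self [simp]: "\<not> adj c a v v"
  by (auto simp: adj_def)

lemma finite_nb [simp]: "finite (nb c n col v)"
  by (simp add: nb_def)

lemma card_two_colours:
  assumes "a \<noteq> b" "finite A"
  shows "card {w \<in> A. adj c a v w} + card {w \<in> A. adj c b v w} = card (A - {v})"
proof -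
  have "A - {v} = {w \<in> A. adj c a v w} \<union> {w \<in> A. adj c b v w}"
    using colour_cases[OF assms(1)] by (auto simp: adj_def)
  moreover have "{w \<in> A. adj c a v w} \<inter> {w \<in> A. adj c b v w} = {}"
    using assms by (auto simp: adj_def)
  ultimately show ?thesis using assms by (simp add: card_Un_disjoint)
qed

lemma sum_card_swap:
  assumes "finite P" "finite Q"
  shows "(\<Sum>v\<in>P. card {w \<in> Q. R v w}) = (\<Sum>w\<in>Q. card {v \<in> P. R v w})"
proof -
  have "(\<Sum>v\<in>P. card {w \<in> Q. R v w}) = (\<Sum>v\<in>P. \<Sum>w\<in>Q. if R v w then 1 else 0)"
    using assms by (simp add: sum.If_cases Int_def)
  also have "\<dots> = (\<Sum>w\<in>Q. \<Sum>v\<in>P. if R v w then 1 else 0)" by (rule sum.swap)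
  also have "\<dots> = (\<Sum>w\<in>Q. card {v \<in> P. R v w})"
    using assms by (simp add: sum.If_cases Int_def)
  finally show ?thesis .
qed

text \<open>With few \<open>b\<close>-cliques of size \<open>p + 1\<close>, Turan forces about
  \<open>card P ^ 2 / p\<close> ordered \<open>a\<close>-pairs inside \<open>P\<close>. They use up
  part of the low \<open>a\<close>-degrees, whose total is about \<open>card P * n / p\<close>; what
  is left for \<open>Q\<close> is about \<open>card P * (n - card P) / p\<close>.\<close>

lemma low_degree_cross_edges:
  fixes e \<gamma> :: real
  assumes ab: "a \<noteq> b" and p: "p \<ge> 3" and e: "0 < e" "1 \<le> e * n"
    and g: "\<gamma> \<le> (e / 2) ^ p"
    and PQ: "P \<subseteq> {..<n}" "Q \<subseteq> {..<n}" "P \<inter> Q = {}"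
    and low: "\<And>v. v \<in> P \<Longrightarrow> card (nb c n a v) \<le> (1 / p + e) * n"
    and few: "card (cliq (adj c b) (p + 1) P) \<le> \<gamma> * real n ^ (p + 1)"
    and rest: "real n - card P - card Q \<le> e * n"
  shows "real (\<Sum>v\<in>P. card {w \<in> Q. adj c a v w}) \<le> real (card P) * real (card Q) / p + 4 * e * real n ^ 2"
proof -
  have finP: "finite P" "finite Q" using finite_subset[OF PQ(1)] finite_subset[OF PQ(2)] by auto
  have n0: "real n > 0" using e by (metis mult_zero_right not_one_le_zero of_nat_0_less_iff of_nat_0 gr0I)
  define P1 where "P1 = real (card P)"
  define Q1 where "Q1 = real (card Q)"
  have P1: "0 \<le> P1" "P1 \<le> n" and Q1: "0 \<le> Q1" unfolding P1_def Q1_def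
    using card_mono[OF _ PQ(1)] by auto
  have nn: "real n \<le> e * real n ^ 2" using mult_right_mono[OF e(2), of n] by (simp add: power2_eq_square)
  have pp: "real (Suc (p - 1)) = p" "p - 1 + 2 = p + 1" using p by auto
  \<comment> \<open>With this slack the linear error and the clique error of Turan are both at most
    \<open>e * n ^ 2 / 2\<close>.\<close>
  define z where "z = e * n / 2"
  have z: "z > 0" using e n0 by (simp add: z_def)
  have "card (cliq (adj c b) (p + 1) P) / z ^ (p - 1) \<le> (e / 2) ^ p * real n ^ (p + 1) / z ^ (p - 1)"
    using order_trans[OF few mult_right_mono[OF g]] z by (intro divide_right_mono) auto
  also have "\<dots> = e * real n ^ 2 / 2"
  proof -
    have "(e / 2) ^ p * real n ^ (p + 1) = z ^ (p - 1) * (e * real n ^ 2 / 2)"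
    proof -
      obtain q where q: "p = Suc q" using p by (cases p) auto
      show ?thesis by (simp add: q z_def power_mult_distrib power_divide power2_eq_square mult_ac)
    qed
    then show ?thesis using z by simp
  qed
  finally have c1: "card (cliq (adj c b) (p + 1) P) / z ^ (p - 1) \<le> e * real n ^ 2 / 2" .
  have c2: "z * P1 \<le> e * real n ^ 2 / 2"
    using mult_left_mono[OF P1(2), of z] z by (simp add: z_def power2_eq_square)
  have "real (\<Sum>v\<in>P. card {w \<in> P. adj c b v w})
      \<le> (1 - 1 / p) * P1 ^ 2 + z * P1 + card (cliq (adj c b) (p + 1) P) / z ^ (p - 1)"
    using turan_cliq[OF finP(1) symp_adj z, of c b "p - 1"]
    unfolding card_cliq_2[OF finP(1) symp_adj] P1_def pp of_nat_power .
  then have b2: "real (\<Sum>v\<in>P. card {w \<in> P. adj c b v w}) \<le> (1 - 1 / p) * P1 ^ 2 + e * real n ^ 2"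
    using c1 c2 by linarith
  have tot: "real (\<Sum>v\<in>P. card {w \<in> P. adj c a v w}) + real (\<Sum>v\<in>P. card {w \<in> P. adj c b v w}) = P1 ^ 2 - P1"
  proof -
    have "(\<Sum>v\<in>P. card {w \<in> P. adj c a v w}) + (\<Sum>v\<in>P. card {w \<in> P. adj c b v w}) = (\<Sum>v\<in>P. card P - 1)"
      unfolding sum.distrib[symmetric] using finP
      by (intro sum.cong) (simp_all add: card_two_colours[OF ab finP(1)])
    also have "real \<dots> = P1 * (P1 - 1)"
      by (cases "card P") (auto simp: P1_def algebra_simps)
    finally show ?thesis by (simp add: power2_eq_square algebra_simps)
  qed
  have "real (\<Sum>v\<in>P. card {w \<in> Q. adj c a v w}) + real (\<Sum>v\<in>P. card {w \<in> P. adj c a v w})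
      = (\<Sum>v\<in>P. real (card {w \<in> Q. adj c a v w} + card {w \<in> P. adj c a v w}))"
    by (simp add: sum.distrib)
  also have "\<dots> \<le> (\<Sum>v\<in>P. (1 / p + e) * n)"
  proof (rule sum_mono)
    fix v assume v: "v \<in> P"
    have "card {w \<in> Q. adj c a v w} + card {w \<in> P. adj c a v w} = card ({w \<in> Q. adj c a v w} \<union> {w \<in> P. adj c a v w})"
      using finP PQ(3) by (intro card_Un_disjoint[symmetric]) auto
    also have "\<dots> \<le> card (nb c n a v)" using PQ by (intro card_mono) (auto simp: nb_def)
    finally show "real (card {w \<in> Q. adj c a v w} + card {w \<in> P. adj c a v w}) \<le> (1 / p + e) * n"
      using low[OF v] by linarith
  qed
  also have "\<dots> = P1 * n / p + P1 * (e * n)" by (simp add: P1_def algebra_simps)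
  also have "P1 * (e * n) \<le> e * real n ^ 2" using mult_right_mono[OF P1(2), of "e * n"] e n0
    by (simp add: power2_eq_square mult_ac)
  finally have 1: "real (\<Sum>v\<in>P. card {w \<in> Q. adj c a v w}) \<le> P1 * n / p + e * real n ^ 2 - (P1 ^ 2 - P1 - ((1 - 1 / p) * P1 ^ 2 + e * real n ^ 2))"
    using tot b2 by linarith
  have "P1 * n \<le> P1 * (P1 + Q1 + e * n)" using rest P1 by (intro mult_left_mono) (auto simp: P1_def Q1_def)
  also have "\<dots> \<le> P1 ^ 2 + P1 * Q1 + e * real n ^ 2"
    using mult_right_mono[OF P1(2), of "e * n"] e n0 by (simp add: power2_eq_square algebra_simps)
  finally have "P1 * n / p \<le> (P1 ^ 2 + P1 * Q1 + e * real n ^ 2) / p" by (intro divide_right_mono) auto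
  also have "\<dots> = P1 ^ 2 / p + P1 * Q1 / p + e * real n ^ 2 / p" by (simp add: add_divide_distrib)
  also have "e * real n ^ 2 / p \<le> e * real n ^ 2 / 1" using p e by (intro divide_left_mono) auto
  finally have 2: "P1 * n / p \<le> P1 ^ 2 / p + P1 * Q1 / p + e * real n ^ 2" by simp
  have "P1 ^ 2 - (1 - 1 / p) * P1 ^ 2 = P1 ^ 2 / p" by (simp add: algebra_simps)
  then show ?thesis using 1 2 nn P1 unfolding P1_def[symmetric] Q1_def[symmetric] by linarith
qed

text \<open>Vertices of large degree in both colours are few by Ramsey. Of the remaining ones, those with
  low red degree and those with low blue degree form two classes; by Turan inside each class, either
  colour occupies at most about \<open>1 / p\<close> of the pairs between them. As \<open>2 / p < 1\<close>, one class is small.\<close>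

lemma one_colour_dominates:
  fixes e \<gamma> :: real
  assumes p: "p \<ge> 3" and e: "0 < e" "1 \<le> e * n" "100 * e \<le> 1"
    and g: "\<gamma> \<le> (e / 2) ^ p" "\<gamma> \<le> (e / 16 ^ (p + 1)) ^ (p + 1)" and n: "16 ^ (p + 1) \<le> e * n"
    and F: "\<And>col A. A \<subseteq> {..<n} \<Longrightarrow> (\<And>v. v \<in> A \<Longrightarrow> (1 / p + e) * n \<le> card (nb c n col v)) \<Longrightarrow>
       card (cliq (adj c col) (p + 1) A) < \<gamma> * real n ^ (p + 1)"
  obtains a b B where "a \<noteq> b" "B \<subseteq> {..<n}" "\<And>v. v \<in> B \<Longrightarrow> card (nb c n a v) \<le> (1 / p + e) * n"
    "(1 - 73 * e) * n \<le> card B" "card (cliq (adj c b) (p + 1) B) < \<gamma> * real n ^ (p + 1)"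
proof -
  have n0: "real n > 0" using e by (metis mult_zero_right not_one_le_zero of_nat_0_less_iff of_nat_0 gr0I)
  define D where "D = (1 / p + e) * n"
  define low where "low col = {v \<in> {..<n}. card (nb c n col v) < D}" for col
  define S where "S = {..<n} - low Red - low Blue"
  have low_sub: "low col \<subseteq> {..<n}" for col by (auto simp: low_def)
  have fin: "finite (low col)" "finite S" for col by (auto simp: low_def S_def)
  \<comment> \<open>Twice the threshold stays below \<open>n - 1\<close> because \<open>p\<close> is
    at least 3; so a vertex that is low in one colour is high in the other, and the two classes are
    disjoint.\<close>
  have D2: "2 * D \<le> n - 1"
  proof -
    have "1 / real p \<le> 1 / 3" using p by (intro divide_left_mono) auto
    then have "(1 / p + e) \<le> 1 / 3 + e" by simp
    then have "D \<le> (1 / 3 + e) * n" unfolding D_def using n0 by (intro mult_right_mono) auto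
    moreover have "100 * e * n \<le> n" using mult_right_mono[OF e(3), of n] by simp
    ultimately show ?thesis using e(2) by (simp add: algebra_simps)
  qed
  have deg: "card (nb c n Red v) + card (nb c n Blue v) = n - 1" if "v < n" for v
    using card_two_colours[of Red Blue "{..<n}" c v] that by (simp add: nb_def)
  have high: "D \<le> card (nb c n b v)" if "v \<in> low a" "a \<noteq> b" for a b v
  proof -
    have v: "v < n" "card (nb c n a v) < D" using that by (auto simp: low_def)
    have "real (card (nb c n a v)) + real (card (nb c n b v)) = n - 1"
      using deg[OF v(1)] v(1) that(2) by (cases a; cases b) (auto simp flip: of_nat_add)
    then show ?thesis using v(2) D2 by linarith
  qed
  have disj: "low Red \<inter> low Blue = {}" using high[of _ Red Blue] by (fastforce simp: low_def)
  have nsum: "real n = card (low Red) + card (low Blue) + card S"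
  proof -
    have "{..<n} = (low Red \<union> low Blue) \<union> S" using low_sub by (auto simp: S_def)
    then have "n = card ((low Red \<union> low Blue) \<union> S)" by (metis card_lessThan)
    also have "\<dots> = card (low Red) + card (low Blue) + card S"
      using fin disj by (subst card_Un_disjoint) (auto simp: card_Un_disjoint S_def)
    finally show ?thesis by linarith
  qed
  have S: "card S \<le> e * n"
  proof (rule ccontr)
    assume "\<not> ?thesis"
    \<comment> \<open>The power of 16 is the Ramsey loss 4^(2 (p + 1)); the second bound on
      \<open>\<gamma>\<close> is tailored to this \<open>y\<close>.\<close>
    define y where "y = e * n / 16 ^ (p + 1)"
    have y: "y \<ge> 1" using n by (simp add: y_def field_simps)
    have "4 ^ ((p + 1) + (p + 1)) * y = e * n"
      by (simp add: y_def power_add flip: power_mult_distrib)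
    then have "4 ^ ((p + 1) + (p + 1)) * y \<le> card S" using \<open>\<not> card S \<le> e * n\<close> by linarith
    from ramsey_cliq[OF fin(2) symp_adj symp_adj _ y this, of c Red c Blue]
    have "y ^ (p + 1) \<le> card (cliq (adj c Red) (p + 1) S) \<or> y ^ (p + 1) \<le> card (cliq (adj c Blue) (p + 1) S)"
      using adj_other[of Red Blue] by blast
    then obtain col where col: "y ^ (p + 1) \<le> card (cliq (adj c col) (p + 1) S)" by blast
    have "\<forall>v\<in>S. D \<le> card (nb c n col v)" by (cases col) (auto simp: S_def low_def not_less)
    then have "card (cliq (adj c col) (p + 1) S) < \<gamma> * real n ^ (p + 1)"
      using F[of S col] unfolding D_def by (auto simp: S_def)
    also have "\<dots> \<le> (e / 16 ^ (p + 1)) ^ (p + 1) * real n ^ (p + 1)" using g by (intro mult_right_mono) auto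
    also have "\<dots> = y ^ (p + 1)" by (simp add: y_def power_divide power_mult_distrib)
    finally show False using col by simp
  qed
  have few: "card (cliq (adj c b) (p + 1) (low a)) < \<gamma> * real n ^ (p + 1)" if "a \<noteq> b" for a b
    using F[of "low a" b] high[OF _ that] low_sub unfolding D_def by blast
  have lowD: "card (nb c n a v) \<le> (1 / p + e) * n" if "v \<in> low a" for a v
    using that by (auto simp: low_def D_def)
  define P where "P = real (card (low Red))"
  define Q where "Q = real (card (low Blue))"
  have PQ0: "P \<ge> 0" "Q \<ge> 0" by (auto simp: P_def Q_def)
  have R1: "real (\<Sum>v\<in>low Red. card {w \<in> low Blue. adj c Red v w}) \<le> P * Q / p + 4 * e * real n ^ 2"
    unfolding P_def Q_def using few[of Red Blue] lowD disj S nsum low_sub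
    by (intro low_degree_cross_edges[of Red Blue p e n \<gamma>]) (use p e g in auto)
  have "real (\<Sum>v\<in>low Blue. card {w \<in> low Red. adj c Blue v w}) \<le> Q * P / p + 4 * e * real n ^ 2"
    unfolding P_def Q_def using few[of Blue Red] lowD disj S nsum low_sub
    by (intro low_degree_cross_edges[of Blue Red p e n \<gamma>]) (use p e g in auto)
  also have "(\<Sum>v\<in>low Blue. card {w \<in> low Red. adj c Blue v w}) = (\<Sum>v\<in>low Red. card {w \<in> low Blue. adj c Blue v w})"
    using sum_card_swap[of "low Blue" "low Red" "adj c Blue", OF fin(1) fin(1)] by (simp add: adj_sym[of c Blue])
  finally have R2: "real (\<Sum>v\<in>low Red. card {w \<in> low Blue. adj c Blue v w}) \<le> Q * P / p + 4 * e * real n ^ 2" .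
  have "P * Q = (\<Sum>v\<in>low Red. real (card {w \<in> low Blue. adj c Red v w} + card {w \<in> low Blue. adj c Blue v w}))"
  proof -
    have "card {w \<in> low Blue. adj c Red v w} + card {w \<in> low Blue. adj c Blue v w} = card (low Blue)" if "v \<in> low Red" for v
      using card_two_colours[of Red Blue "low Blue" c v] fin disj that by (auto simp: disjoint_iff)
    then show ?thesis by (simp add: P_def Q_def)
  qed
  also have "\<dots> \<le> 2 * (P * Q / p) + 8 * e * real n ^ 2"
  proof -
    have "Q * P / p = P * Q / p" by (simp add: mult.commute)
    then show ?thesis using R1 R2 unfolding of_nat_add sum.distrib of_nat_sum by linarith
  qed
  also have "P * Q / p \<le> P * Q / 3" using p PQ0 by (intro divide_left_mono) auto
  finally have PQ: "P * Q \<le> 24 * e * real n ^ 2" by simp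
  have sum: "P + Q \<ge> (1 - e) * n" using nsum S by (simp add: P_def Q_def algebra_simps)
  have en: "100 * (e * n) \<le> n" using mult_right_mono[OF e(3), of n] by simp
  \<comment> \<open>The larger class has at least n/3 vertices, so the product bound 24 e n^2 leaves
    at most 72 e n for the smaller one. The e n vertices outside both classes make it 73.\<close>
  have key: "(1 - 73 * e) * n \<le> x" if "x * y \<le> 24 * e * real n ^ 2" "x + y \<ge> (1 - e) * n" "y \<le> x" "0 \<le> y" for x y
  proof -
    have "x \<ge> n / 3" using that(2,3) en by (simp add: algebra_simps)
    then have "(n / 3) * y \<le> 24 * e * real n ^ 2" using that mult_right_mono[of "n / 3" x y] by linarith
    then have "n * y \<le> n * (72 * e * n)" by (simp add: power2_eq_square mult_ac)
    then have "y \<le> 72 * e * n" using n0 by (simp add: mult_le_cancel_left)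
    then show ?thesis using that(2) by (simp add: algebra_simps)
  qed
  show thesis
  proof (cases "Q \<le> P")
    case True
    then have "(1 - 73 * e) * n \<le> P" using key[of P Q] PQ sum PQ0 by simp
    then show thesis using that[of Red Blue "low Red"] few[of Red Blue] lowD low_sub unfolding P_def by blast
  next
    case False
    then have "(1 - 73 * e) * n \<le> Q" using key[of Q P] PQ sum PQ0 by (simp add: mult.commute add.commute)
    then show thesis using that[of Blue Red "low Blue"] few[of Blue Red] lowD low_sub unfolding Q_def by blast
  qed
qed

definition ext_set where
  "ext_set c b p B x = {v \<in> B. \<forall>i<p. adj c b (x i) v}"

text \<open>A \<open>b\<close>-edge whose ends are both attached to the clique \<open>x\<close> in
  colour \<open>b\<close> except at position \<open>i\<close> gives such a pair. Few pairs thus mean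
  few \<open>b\<close>-edges inside the \<open>i\<close>-th prospective part.\<close>

definition swap_pairs where
  "swap_pairs c b p B i x = {(y, z) \<in> B \<times> B. x(i := y, p := z) \<in> cliq (adj c b) (Suc p) B}"

text \<open>An averaging argument. Low \<open>a\<close>-degrees let every \<open>b\<close>-clique of
  size below \<open>p\<close> be extended in at least n/(2p) ways, so there are at least (n/(2p))^p
  cliques of size \<open>p\<close>, whereas those of size \<open>p + 1\<close> are rare. The weight
  \<open>n\<close> on the extensions puts them on the same scale as the pairs.\<close>

lemma typical_clique:
  fixes e \<gamma> :: real
  assumes ab: "a \<noteq> b" and p: "p \<ge> 3" and e: "0 < e" "1 \<le> e * n" "1000 * p ^ 2 * e \<le> 1"
    and g: "(p + 1) * \<gamma> * (2 * real p) ^ p \<le> e"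
    and B: "B \<subseteq> {..<n}" and low: "\<And>v. v \<in> B \<Longrightarrow> card (nb c n a v) \<le> (1 / p + e) * n"
    and big: "(1 - 73 * e) * n \<le> card B"
    and few: "card (cliq (adj c b) (p + 1) B) < \<gamma> * real n ^ (p + 1)"
  obtains x where "x \<in> cliq (adj c b) p B"
    "n * real (card (ext_set c b p B x)) + (\<Sum>i<p. real (card (swap_pairs c b p B i x))) \<le> e * real n ^ 2"
proof -
  have n0: "real n > 0" using e by (metis mult_zero_right not_one_le_zero of_nat_0_less_iff of_nat_0 gr0I)
  have finB: "finite B" using B finite_subset by auto
  define T where "T s = cliq (adj c b) s B" for s
  have finT: "finite (T s)" for s using finB by (simp add: T_def finite_cmult)
  have low_ext: "n / (2 * p) \<le> card (ext_set c b s B x)" if "x \<in> T s" "s < p" for x s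
  proof -
    have xB: "x i \<in> B" if "i < s" for i using \<open>x \<in> T s\<close> that by (auto simp: T_def cmult_def)
    let ?U = "\<Union>i<s. insert (x i) (nb c n a (x i))"
    have "B - ?U \<subseteq> ext_set c b s B x"
    proof
      fix w assume w: "w \<in> B - ?U"
      have "adj c b (x i) w" if "i < s" for i
        using w that B adj_other[OF ab, of "x i" w c] by (auto simp: nb_def)
      then show "w \<in> ext_set c b s B x" using w by (simp add: ext_set_def)
    qed
    then have "card (B - ?U) \<le> card (ext_set c b s B x)" using finB by (intro card_mono) (auto simp: ext_set_def)
    moreover have "card B - card ?U \<le> card (B - ?U)" by (rule diff_card_le_card_Diff) auto
    moreover have "real (card ?U) \<le> s * ((1 / p + e) * n + 1)"
    proof -
      have "card ?U \<le> (\<Sum>i<s. card (insert (x i) (nb c n a (x i))))" by (rule card_UN_le) simp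
      also have "real \<dots> \<le> (\<Sum>i<s. (1 / p + e) * n + 1)"
        unfolding of_nat_sum
      proof (rule sum_mono)
        fix i assume "i \<in> {..<s}"
        then have "real (card (nb c n a (x i))) \<le> (1 / p + e) * n" using low xB by auto
        then show "real (card (insert (x i) (nb c n a (x i)))) \<le> (1 / p + e) * n + 1"
          by (simp add: card_insert_if)
      qed
      finally show ?thesis by simp
    qed
    ultimately have 1: "(1 - 73 * e) * n - s * ((1 / p + e) * n + 1) \<le> card (ext_set c b s B x)"
      using big by linarith
    have "(1 / p + e) * n + 1 \<le> (1 / p + 2 * e) * n" using e by (simp add: algebra_simps)
    moreover have "0 \<le> (1 / p + 2 * e) * n" using e n0 by simp
    ultimately have "s * ((1 / p + e) * n + 1) \<le> real (p - 1) * ((1 / p + 2 * e) * n)"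
      using that e n0 by (intro mult_mono) auto
    also have "\<dots> = (real p - 1) * (1 / p + 2 * e) * n" using p by (simp add: of_nat_diff)
    finally have 2: "s * ((1 / p + e) * n + 1) \<le> (real p - 1) * (1 / p + 2 * e) * n" .
    \<comment> \<open>At most \<open>p - 1\<close> vertices exclude about n/p candidates each; of
      the remaining n/p, half is surrendered to the error terms.\<close>
    have "n / (2 * p) \<le> ((1 - 73 * e) - (real p - 1) * (1 / p + 2 * e)) * n"
    proof -
      have pp: "real p \<ge> 3" using p by simp
      have "(73 + 2 * real p) * (2 * p) * e \<le> 1000 * p ^ 2 * e"
      proof (rule mult_right_mono)
        have "3 * real p \<le> real p * real p" using pp by (intro mult_right_mono) auto
        then have "73 * (2 * real p) + 4 * (real p * real p) \<le> 1000 * (real p * real p)" using pp by linarith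
        then show "(73 + 2 * real p) * (2 * p) \<le> 1000 * p ^ 2"
          by (simp add: algebra_simps power2_eq_square)
      qed (use e in auto)
      then have "(73 + 2 * real p) * e \<le> 1 / (2 * p)" using e(3) pp by (simp add: field_simps)
      moreover have "(1 - 73 * e) - (real p - 1) * (1 / p + 2 * e) = 1 / p - (71 + 2 * p) * e"
        using pp by (simp add: field_simps)
      moreover have "1 / real p = 1 / (2 * p) + 1 / (2 * p)" by simp
      moreover have "(71 + 2 * p) * e \<le> (73 + 2 * real p) * e" using e by (intro mult_right_mono) auto
      ultimately have "1 / (2 * p) \<le> (1 - 73 * e) - (real p - 1) * (1 / p + 2 * e)" by linarith
      from mult_right_mono[OF this, of n] show ?thesis by simp
    qed
    then show ?thesis using 1 2 by (simp add: algebra_simps)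
  qed
  have lowT: "(n / (2 * p)) ^ s \<le> card (T s)" if "s \<le> p" for s
    using that
  proof (induction s)
    case 0
    then show ?case by (simp add: T_def)
  next
    case (Suc s)
    have "(n / (2 * p)) ^ Suc s \<le> card (T s) * (n / (2 * p))"
      using Suc mult_right_mono[of "(n / (2 * p)) ^ s" "card (T s)" "n / (2 * p)"] by (simp add: mult.commute)
    also have "\<dots> = (\<Sum>x\<in>T s. n / (2 * p))" by simp
    also have "\<dots> \<le> (\<Sum>x\<in>T s. real (card (ext_set c b s B x)))"
      using Suc low_ext by (intro sum_mono) auto
    also have "\<dots> = card (T (Suc s))"
      unfolding T_def card_cliq_Suc_ext[OF finB symp_adj] ext_set_def by simp
    finally show ?case .
  qed
  define K where "K = real (card (T (Suc p)))"
  have K: "K < \<gamma> * real n ^ (p + 1)" using few by (simp add: K_def T_def)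
  have s1: "(\<Sum>x\<in>T p. real (card (ext_set c b p B x))) = K"
    unfolding K_def T_def card_cliq_Suc_ext[OF finB symp_adj] ext_set_def by simp
  have s2: "(\<Sum>x\<in>T p. real (card (swap_pairs c b p B i x))) \<le> n * K" if i: "i < p" for i
  proof -
    have finsp: "finite (swap_pairs c b p B i x)" for x
      by (rule finite_subset[of _ "B \<times> B"]) (use finB in \<open>auto simp: swap_pairs_def\<close>)
    have "(\<Sum>x\<in>T p. card (swap_pairs c b p B i x)) = card (SIGMA x:T p. swap_pairs c b p B i x)"
      using finT finsp by (simp add: card_SigmaI)
    also have "\<dots> \<le> card (B \<times> T (Suc p))"
    proof (rule card_inj_on_le)
      \<comment> \<open>The entry \<open>x i\<close> is overwritten and has to be recorded
        separately, which costs the factor \<open>n\<close>.\<close>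
      show "inj_on (\<lambda>(x, y, z). (x i, x(i := y, p := z))) (SIGMA x:T p. swap_pairs c b p B i x)"
      proof (rule inj_onI)
        fix t t'
        assume tt: "t \<in> (SIGMA x:T p. swap_pairs c b p B i x)" "t' \<in> (SIGMA x:T p. swap_pairs c b p B i x)"
          "(case t of (x, y, z) \<Rightarrow> (x i, x(i := y, p := z))) = (case t' of (x, y, z) \<Rightarrow> (x i, x(i := y, p := z)))"
        obtain x y z x' y' z' where t: "t = (x, y, z)" "t' = (x', y', z')" by (metis prod_cases3)
        have *: "x \<in> T p" "x' \<in> T p" "x i = x' i" "x(i := y, p := z) = x'(i := y', p := z')"
          using tt by (auto simp: t)
        have ip: "i \<noteq> p" using i by simp
        have "x j = x' j" for j
        proof -
          have "x p = x' p" using *(1,2) by (auto simp: T_def cmult_def PiE_def extensional_def)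
          moreover have "j \<noteq> p \<Longrightarrow> j \<noteq> i \<Longrightarrow> x j = x' j" using fun_cong[OF *(4), of j] by simp
          ultimately show ?thesis using *(3) by metis
        qed
        moreover have "y = y'" using fun_cong[OF *(4), of i] ip by simp
        moreover have "z = z'" using fun_cong[OF *(4), of p] by simp
        ultimately show "t = t'" by (auto simp: t)
      qed
      show "(\<lambda>(x, y, z). (x i, x(i := y, p := z))) ` (SIGMA x:T p. swap_pairs c b p B i x) \<subseteq> B \<times> T (Suc p)"
        using i by (auto simp: swap_pairs_def T_def) (auto simp: cmult_def)
      show "finite (B \<times> T (Suc p))" using finB finT by simp
    qed
    also have "\<dots> = card B * card (T (Suc p))" by (simp add: card_cartesian_product)
    also have "\<dots> \<le> n * card (T (Suc p))" using card_mono[OF _ B] by (intro mult_right_mono) auto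
    finally show ?thesis unfolding K_def by (simp flip: of_nat_sum of_nat_mult)
  qed
  show thesis
  proof (rule ccontr)
    assume neg: "\<not> thesis"
    have "card (T p) * (e * real n ^ 2) = (\<Sum>x\<in>T p. e * real n ^ 2)" by simp
    also have "\<dots> \<le> (\<Sum>x\<in>T p. n * real (card (ext_set c b p B x)) + (\<Sum>i<p. real (card (swap_pairs c b p B i x))))"
    proof (rule sum_mono)
      fix x assume "x \<in> T p"
      then show "e * real n ^ 2 \<le> n * real (card (ext_set c b p B x)) + (\<Sum>i<p. real (card (swap_pairs c b p B i x)))"
        using neg that[of x] unfolding T_def by force
    qed
    also have "\<dots> = n * K + (\<Sum>i<p. \<Sum>x\<in>T p. real (card (swap_pairs c b p B i x)))"
      unfolding sum.distrib s1[symmetric] by (simp add: sum_distrib_left sum.swap[of _ "T p"])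
    also have "(\<Sum>i<p. \<Sum>x\<in>T p. real (card (swap_pairs c b p B i x))) \<le> (\<Sum>i<p. n * K)"
      using s2 by (intro sum_mono) auto
    finally have "card (T p) * (e * real n ^ 2) \<le> (p + 1) * n * K" by (simp add: algebra_simps)
    moreover have "(n / (2 * p)) ^ p * (e * real n ^ 2) \<le> card (T p) * (e * real n ^ 2)"
      using lowT[of p] e by (intro mult_right_mono) auto
    moreover have "(p + 1) * n * K < (p + 1) * n * (\<gamma> * real n ^ (p + 1))"
      using K n0 by (intro mult_strict_left_mono) (auto simp: add_pos_nonneg)
    ultimately have "(n / (2 * p)) ^ p * (e * real n ^ 2) < (p + 1) * n * (\<gamma> * real n ^ (p + 1))" by linarith
    then have "real n ^ (p + 2) * (e / (2 * real p) ^ p) < real n ^ (p + 2) * ((p + 1) * \<gamma>)"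
      by (simp add: power_divide power_add power2_eq_square algebra_simps)
    then have "e / (2 * real p) ^ p < (p + 1) * \<gamma>"
      using n0 mult_less_cancel_left_pos[of "real n ^ (p + 2)"] by (simp only: zero_less_power)
    moreover have "(0::real) < (2 * real p) ^ p" using p by simp
    ultimately have "e < (p + 1) * \<gamma> * (2 * real p) ^ p" by (simp add: divide_less_eq)
    then show False using g by (simp add: add.commute)
  qed
qed

text \<open>Colour \<open>a\<close> lives inside the parts and \<open>b\<close> between them. The
  parts are only cores: they need not cover all vertices, and the \<open>b\<close>-condition already
  concerns all vertices outside \<open>V i\<close>, including uncovered ones.\<close>

definition parts_structure :: "(nat set \<Rightarrow> colour) \<Rightarrow> nat \<Rightarrow> colour \<Rightarrow> colour \<Rightarrow> nat \<Rightarrow> real \<Rightarrow> (nat \<Rightarrow> nat set) \<Rightarrow> bool" where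
  "parts_structure c n a b p \<omega> V \<longleftrightarrow>
     (\<forall>i<p. V i \<subseteq> {..<n} \<and> (1 / p - \<omega>) * n \<le> card (V i)) \<and>
     (\<forall>i<p. \<forall>j<p. i \<noteq> j \<longrightarrow> V i \<inter> V j = {}) \<and>
     (\<forall>i<p. \<forall>v\<in>V i. real (card {w \<in> V i. \<not> adj c a v w}) \<le> \<omega> * n \<and>
                     real (card {w \<in> {..<n} - V i. \<not> adj c b v w}) \<le> \<omega> * n)"

text \<open>For a clique \<open>x\<close> in colour \<open>b\<close> that has few extensions, the \<open>a\<close>-neighbourhoods of its vertices
  nearly partition \<open>B\<close>, and a \<open>b\<close>-edge inside one of them yields a larger \<open>b\<close>-clique.\<close>

lemma rough_partition:
  fixes e \<gamma> :: real
  assumes ab: "a \<noteq> b" and p: "p \<ge> 3" and e: "0 < e" "1 \<le> e * n" "1000 * p ^ 2 * e \<le> 1"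
    and g: "(p + 1) * \<gamma> * (2 * real p) ^ p \<le> e"
    and B: "B \<subseteq> {..<n}" and low: "\<And>v. v \<in> B \<Longrightarrow> card (nb c n a v) \<le> (1 / p + e) * n"
    and big: "(1 - 73 * e) * n \<le> real (card B)"
    and few: "card (cliq (adj c b) (p + 1) B) < \<gamma> * real n ^ (p + 1)"
  obtains V where "\<And>i. i < p \<Longrightarrow> V i \<subseteq> B" "\<And>i j. i < p \<Longrightarrow> j < p \<Longrightarrow> i \<noteq> j \<Longrightarrow> V i \<inter> V j = {}"
    "\<And>i. i < p \<Longrightarrow> (1 / p - (147 + 4 * p) * e) * n \<le> card (V i)"
    "\<And>i. i < p \<Longrightarrow> card {(y, z) \<in> V i \<times> V i. adj c b y z} \<le> e * real n ^ 2"
proof -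
  have n0: "real n > 0" using e by (metis mult_zero_right not_one_le_zero of_nat_0_less_iff of_nat_0 gr0I)
  have finB: "finite B" using finite_subset[OF B] by auto
  obtain x where x: "x \<in> cliq (adj c b) p B"
    and sm: "n * real (card (ext_set c b p B x)) + (\<Sum>i<p. real (card (swap_pairs c b p B i x))) \<le> e * real n ^ 2"
    using typical_clique[OF ab p e g B low big few] by blast
  have xB: "x i \<in> B" if "i < p" for i using x that by (auto simp: cmult_def)
  have xx: "adj c b (x i) (x j)" if "i < p" "j < p" "i \<noteq> j" for i j using x that by (auto simp: cmult_def)
  define X where "X = ext_set c b p B x"
  have XB: "X \<subseteq> B" by (auto simp: X_def ext_set_def)
  have pr0: "0 \<le> (\<Sum>i<p. real (card (swap_pairs c b p B i x)))" by (intro sum_nonneg) auto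
  have Xsm: "card X \<le> e * n"
  proof -
    have "real n * card X \<le> real n * (e * n)" using sm pr0 by (simp add: X_def power2_eq_square mult_ac)
    then show ?thesis using n0 by (simp add: mult_le_cancel_left)
  qed
  define V where "V i = {w \<in> B. adj c a (x i) w \<and> (\<forall>j<p. j \<noteq> i \<longrightarrow> adj c b (x j) w)}" for i
  define M where "M i = {w \<in> B. adj c a (x i) w}" for i
  have VB: "V i \<subseteq> B" for i by (auto simp: V_def)
  have finV: "finite (V i)" "finite (M i)" for i using finB by (auto simp: V_def M_def)
  have disj: "V i \<inter> V j = {}" if "i < p" "j < p" "i \<noteq> j" for i j
    using that adj_excl[OF ab] by (auto simp: V_def)
  have Mc: "card (M i) \<le> (1 / p + e) * n" if "i < p" for i
  proof -
    have "card (M i) \<le> card (nb c n a (x i))" using B by (intro card_mono) (auto simp: M_def nb_def)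
    then show ?thesis using low[OF xB[OF that]] by linarith
  qed
  have VM: "card (V i) \<le> card (M i)" for i using finV by (intro card_mono) (auto simp: V_def M_def)
  \<comment> \<open>Up to \<open>X\<close> and the clique itself, a vertex has an
    \<open>a\<close>-neighbour in the clique. If it has just one, it is counted once by an
    \<open>M i\<close> and once by a \<open>V i\<close>; otherwise at least twice by the
    \<open>M i\<close>. The total size of the \<open>M i\<close> is barely above \<open>n\<close>,
    so the \<open>V i\<close> must nearly cover \<open>B\<close>.\<close>
  have cover: "2 * card B \<le> (\<Sum>i<p. card (M i)) + (\<Sum>i<p. card (V i)) + 2 * p + 2 * card X"
  proof -
    define r where "r w = card {i \<in> {..<p}. adj c a (x i) w}" for w
    define q where "q w = card {i \<in> {..<p}. w \<in> V i}" for w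
    have "2 \<le> r w + q w + 2 * card {i \<in> {..<p}. x i = w} + 2 * (if w \<in> X then 1 else 0)" if w: "w \<in> B" for w
    proof -
      consider "w \<in> X" | i where "i < p" "x i = w" | "w \<notin> X" "\<And>i. i < p \<Longrightarrow> x i \<noteq> w" by blast
      then show ?thesis
      proof cases
        case 1
        then show ?thesis by simp
      next
        case 2
        then have "card {i \<in> {..<p}. x i = w} \<ge> 1" by (auto simp: Suc_le_eq card_gt_0_iff)
        then show ?thesis by linarith
      next
        case 3
        then obtain i where i: "i < p" "\<not> adj c b (x i) w" using w by (auto simp: X_def ext_set_def)
        then have ai: "adj c a (x i) w" using adj_other[OF ab] 3 by blast
        show ?thesis
        proof (cases "w \<in> V i")
          case True
          then have "q w \<ge> 1" using i by (auto simp: q_def Suc_le_eq card_gt_0_iff)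
          moreover have "r w \<ge> 1" using i ai by (auto simp: r_def Suc_le_eq card_gt_0_iff)
          ultimately show ?thesis by linarith
        next
          case False
          then obtain j where j: "j < p" "j \<noteq> i" "\<not> adj c b (x j) w" using w ai by (auto simp: V_def)
          then have "adj c a (x j) w" using adj_other[OF ab] 3 by blast
          then have "{i, j} \<subseteq> {i \<in> {..<p}. adj c a (x i) w}" using i j ai by auto
          then have "card {i, j} \<le> r w" unfolding r_def by (intro card_mono) auto
          then show ?thesis using j by simp
        qed
      qed
    qed
    then have "(\<Sum>w\<in>B. 2) \<le> (\<Sum>w\<in>B. r w + q w + 2 * card {i \<in> {..<p}. x i = w} + 2 * (if w \<in> X then 1 else 0))"
      by (intro sum_mono) auto
    also have "\<dots> = (\<Sum>w\<in>B. r w) + (\<Sum>w\<in>B. q w) + 2 * (\<Sum>w\<in>B. card {i \<in> {..<p}. x i = w}) + 2 * card X"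
      using finB XB by (simp add: sum.distrib sum.If_cases Int_absorb1 flip: sum_distrib_left)
    also have "(\<Sum>w\<in>B. r w) = (\<Sum>i<p. card (M i))" unfolding r_def M_def using finB by (intro sum_card_swap) auto
    also have "(\<Sum>w\<in>B. q w) = (\<Sum>i<p. card {w \<in> B. w \<in> V i})" unfolding q_def using finB by (intro sum_card_swap) auto
    also have "\<dots> = (\<Sum>i<p. card (V i))" using VB by (intro sum.cong arg_cong[of _ _ card]) auto
    also have "(\<Sum>w\<in>B. card {i \<in> {..<p}. x i = w}) = (\<Sum>i<p. card {w \<in> B. x i = w})" using finB by (intro sum_card_swap) auto
    also have "\<dots> \<le> (\<Sum>i<p. 1)"
    proof (rule sum_mono)
      fix i
      have "card {w \<in> B. x i = w} \<le> card {x i}" by (intro card_mono) auto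
      then show "card {w \<in> B. x i = w} \<le> 1" by simp
    qed
    finally show ?thesis by simp
  qed
  have Vc: "(1 / p - (147 + 4 * p) * e) * n \<le> card (V i)" if i: "i < p" for i
  proof -
    have pp: "real p > 0" using p by simp
    have "(\<Sum>i<p. real (card (M i))) \<le> (\<Sum>i<p. (1 / p + e) * n)" using Mc by (intro sum_mono) auto
    also have "\<dots> = (1 + p * e) * n" using pp by (simp add: algebra_simps)
    finally have 1: "(\<Sum>i<p. real (card (M i))) \<le> (1 + p * e) * n" .
    have "(\<Sum>i<p. real (card (V i))) = real (card (V i)) + (\<Sum>j\<in>{..<p} - {i}. real (card (V j)))"
      using i by (subst sum.remove[of _ i]) auto
    also have "(\<Sum>j\<in>{..<p} - {i}. real (card (V j))) \<le> (\<Sum>j\<in>{..<p} - {i}. (1 / p + e) * n)"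
      using Mc VM by (intro sum_mono) (meson DiffD1 lessThan_iff of_nat_mono order_trans)
    also have "\<dots> = (real p - 1) * ((1 / p + e) * n)" using i by (simp add: of_nat_diff)
    also have "\<dots> = (1 - 1 / p + (real p - 1) * e) * n" using pp by (simp add: field_simps)
    finally have 2: "(\<Sum>i<p. real (card (V i))) \<le> real (card (V i)) + (1 - 1 / p + (real p - 1) * e) * n" by simp
    have "real (2 * card B) \<le> real ((\<Sum>i<p. card (M i)) + (\<Sum>i<p. card (V i)) + 2 * p + 2 * card X)"
      using cover by (rule of_nat_mono)
    then have "2 * real (card B) \<le> (\<Sum>i<p. real (card (M i))) + (\<Sum>i<p. real (card (V i))) + 2 * p + 2 * real (card X)"
      by simp
    \<comment> \<open>Solving for \<open>card (V i)\<close> yields 147 = 2 * 73 + 2 - 1, and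
      \<open>4 * p\<close> from two sums over the parts and from the \<open>2 * p\<close> clique
      corrections.\<close>
    then have "2 * ((1 - 73 * e) * n) \<le> (1 + p * e) * n + (card (V i) + (1 - 1 / p + (real p - 1) * e) * n) + 2 * p + 2 * (e * n)"
      using big 1 2 Xsm by linarith
    moreover have "2 * real p \<le> 2 * p * (e * n)" using mult_left_mono[OF e(2), of "2 * real p"] by simp
    moreover have "0 \<le> e * n" using e n0 by simp
    ultimately show ?thesis by (simp add: algebra_simps)
  qed
  have pairs: "card {(y, z) \<in> V i \<times> V i. adj c b y z} \<le> e * real n ^ 2" if i: "i < p" for i
  proof -
    have finsp: "finite (swap_pairs c b p B i x)"
      by (rule finite_subset[of _ "B \<times> B"]) (use finB in \<open>auto simp: swap_pairs_def\<close>)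
    have "{(y, z) \<in> V i \<times> V i. adj c b y z} \<subseteq> swap_pairs c b p B i x"
    proof clarify
      fix y z assume yz: "y \<in> V i" "z \<in> V i" "adj c b y z"
      let ?x = "x(i := y, p := z)"
      have xe: "x \<in> extensional {..<p}" using x by (auto simp: cmult_def PiE_def)
      have "?x \<in> {..<Suc p} \<rightarrow>\<^sub>E B"
        using yz VB[of i] xB xe i by (auto simp: PiE_def extensional_def less_Suc_eq)
      moreover have "adj c b (?x s) (?x t)" if "s < Suc p" "t < Suc p" "s \<noteq> t" for s t
      proof -
        have xy: "adj c b (x j) y" "adj c b y (x j)" "adj c b (x j) z" "adj c b z (x j)" if "j < p" "j \<noteq> i" for j
          using yz that adj_sym[of c b z "x j"] adj_sym[of c b y "x j"] unfolding V_def by blast+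
        have zy: "adj c b z y" using yz(3) by (simp add: adj_sym)
        have "s < p \<or> s = p" "t < p \<or> t = p" using that by auto
        then show ?thesis
          using xy xx[of s t] zy yz(3) i that(3) by (cases "s = i"; cases "t = i") auto
      qed
      ultimately have "?x \<in> cliq (adj c b) (Suc p) B" by (auto simp: cmult_def)
      then show "(y, z) \<in> swap_pairs c b p B i x" using yz VB by (auto simp: swap_pairs_def)
    qed
    then have "card {(y, z) \<in> V i \<times> V i. adj c b y z} \<le> card (swap_pairs c b p B i x)"
      using finsp by (intro card_mono) auto
    also have "real \<dots> \<le> (\<Sum>i<p. real (card (swap_pairs c b p B i x)))"
      using i by (intro member_le_sum) auto
    also have "\<dots> \<le> e * real n ^ 2" using sm by (smt (verit) mult_nonneg_nonneg of_nat_0_le_iff)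
    finally show ?thesis by simp
  qed
  show thesis by (rule that[of V]) (use VB disj Vc pairs in auto)
qed

text \<open>Passes from few wrong pairs in total to few wrong pairs at each vertex. Markov's
  inequality removes few vertices with many wrong pairs inside their part; for the others the bound
  on the \<open>a\<close>-degree also controls the wrong pairs leaving the part.\<close>

lemma parts_structure_exists:
  fixes e \<gamma> L :: real
  assumes p: "p \<ge> 3" and L: "L \<ge> 1000 * (p + 1)" and e: "e = 1 / L ^ 7"
    and g: "\<gamma> \<le> (e / 2) ^ p" "\<gamma> \<le> (e / 16 ^ (p + 1)) ^ (p + 1)" "(p + 1) * \<gamma> * (2 * real p) ^ p \<le> e"
    and n: "16 ^ (p + 1) \<le> e * n"
    and F: "\<And>col A. A \<subseteq> {..<n} \<Longrightarrow> (\<And>v. v \<in> A \<Longrightarrow> (1 / p + e) * n \<le> card (nb c n col v)) \<Longrightarrow>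
       card (cliq (adj c col) (p + 1) A) < \<gamma> * real n ^ (p + 1)"
  obtains a b V where "a \<noteq> b" "parts_structure c n a b p (1 / L ^ 2) V"
proof -
  have L1: "L \<ge> 1000" "L \<ge> 1000 * p" using L p by auto
  have e0: "e > 0" using L1 e by simp
  have Lpow: "1000 * L ^ k \<le> L ^ Suc k" for k using L1 by (simp add: mult_right_mono)
  have Lp: "0 < L ^ k" for k using L1 by simp
  have n1: "1 \<le> e * n" using n by (smt (verit) one_le_power)
  have "1000 * real p ^ 2 \<le> 1000 * L ^ 2" using L1 by (intro mult_left_mono power_mono) auto
  also have "\<dots> \<le> L ^ 7" proof -
    have "1000 * L ^ 2 \<le> L ^ 3" using Lpow[of 2] by (simp add: numeral_3_eq_3)
    also have "\<dots> \<le> L ^ 7" using L1 by (intro power_increasing) auto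
    finally show ?thesis .
  qed
  finally have e2: "1000 * real p ^ 2 * e \<le> 1" using Lp[of 7] by (simp add: e)
  have e1: "100 * e \<le> 1" using L1 power_increasing[of 1 7 L] by (simp add: e)
  have n0: "real n > 0" using n1 by (metis mult_zero_right not_one_le_zero of_nat_0_less_iff of_nat_0 gr0I)
  obtain a b B where ab: "a \<noteq> b" and B: "B \<subseteq> {..<n}"
    and low: "\<And>v. v \<in> B \<Longrightarrow> card (nb c n a v) \<le> (1 / p + e) * n"
    and big: "(1 - 73 * e) * n \<le> card B" and few: "card (cliq (adj c b) (p + 1) B) < \<gamma> * real n ^ (p + 1)"
    using one_colour_dominates[OF p e0 n1 e1 g(1,2) n F] by blast
  obtain V where V: "\<And>i. i < p \<Longrightarrow> V i \<subseteq> B" "\<And>i j. i < p \<Longrightarrow> j < p \<Longrightarrow> i \<noteq> j \<Longrightarrow> V i \<inter> V j = {}"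
    "\<And>i. i < p \<Longrightarrow> (1 / p - (147 + 4 * p) * e) * n \<le> card (V i)"
    "\<And>i. i < p \<Longrightarrow> card {(y, z) \<in> V i \<times> V i. adj c b y z} \<le> e * real n ^ 2"
    by (rule rough_partition[OF ab p e0 n1 e2 g(3) B low big few]) auto
  have VL: "(1 / p - L * e) * n \<le> card (V i)" if "i < p" for i
  proof -
    have "147 + 4 * real p \<le> L" using L1 p by simp
    then have "(147 + 4 * p) * e \<le> L * e" using e0 by (intro mult_right_mono) auto
    then have "(1 / p - L * e) * n \<le> (1 / p - (147 + 4 * p) * e) * n" by (intro mult_right_mono) auto
    then show ?thesis using V(3)[OF that] by linarith
  qed
  \<comment> \<open>Chosen between \<open>e\<close> and the target: the removed vertices make up a
    fraction 2 e/\<mu> = 2/L^4, and all errors together stay below 5/L^3, hence below 1/L^2.\<close>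
  define \<mu> where "\<mu> = 1 / L ^ 3"
  have mu0: "\<mu> > 0" using Lp[of 3] by (simp add: \<mu>_def del: zero_less_power_eq)
  define Nin where "Nin i v = {w \<in> V i. \<not> adj c a v w}" for i v
  define Bad where "Bad i = {v \<in> V i. \<mu> * n < card (Nin i v)}" for i
  define W where "W i = V i - Bad i" for i
  have Vn: "V i \<subseteq> {..<n}" if "i < p" for i using V(1)[OF that] B by blast
  have finV: "finite (V i)" if "i < p" for i using finite_subset[OF Vn[OF that]] by auto
  have BadV: "Bad i \<subseteq> V i" for i by (auto simp: Bad_def)
  have bad: "card (Bad i) \<le> 2 * e / \<mu> * n" if i: "i < p" for i
  proof -
    have "(\<Sum>v\<in>V i. card (Nin i v)) \<le> (\<Sum>v\<in>V i. card {w \<in> V i. adj c b v w} + 1)"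
    proof (rule sum_mono)
      fix v
      have "Nin i v \<subseteq> insert v {w \<in> V i. adj c b v w}" using adj_other[OF ab] by (auto simp: Nin_def)
      then have "card (Nin i v) \<le> card (insert v {w \<in> V i. adj c b v w})" using finV[OF i] by (intro card_mono) auto
      also have "\<dots> \<le> card {w \<in> V i. adj c b v w} + 1" using finV[OF i] by (simp add: card_insert_if)
      finally show "card (Nin i v) \<le> card {w \<in> V i. adj c b v w} + 1" .
    qed
    also have "\<dots> = (\<Sum>v\<in>V i. card {w \<in> V i. adj c b v w}) + card (V i)" unfolding sum.distrib by simp
    also have "(\<Sum>v\<in>V i. card {w \<in> V i. adj c b v w}) = card {(y, z) \<in> V i \<times> V i. adj c b y z}"
    proof -
      have "{(y, z) \<in> V i \<times> V i. adj c b y z} = (SIGMA v:V i. {w \<in> V i. adj c b v w})" by auto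
      then show ?thesis using finV[OF i] by (simp add: card_SigmaI)
    qed
    finally have "real (\<Sum>v\<in>V i. card (Nin i v)) \<le> real (card {(y, z) \<in> V i \<times> V i. adj c b y z} + card (V i))"
      by (rule of_nat_mono)
    moreover have "card (V i) \<le> n" using card_mono[OF _ Vn[OF i]] by simp
    moreover have "real n \<le> e * real n ^ 2" using mult_right_mono[OF n1, of n] by (simp add: power2_eq_square)
    ultimately have 1: "real (\<Sum>v\<in>V i. card (Nin i v)) \<le> 2 * e * real n ^ 2" using V(4)[OF i] by linarith
    have "card (Bad i) * (\<mu> * n) = (\<Sum>v\<in>Bad i. \<mu> * n)" by simp
    also have "\<dots> \<le> (\<Sum>v\<in>Bad i. real (card (Nin i v)))" by (intro sum_mono) (auto simp: Bad_def)
    also have "\<dots> \<le> (\<Sum>v\<in>V i. real (card (Nin i v)))" using finV[OF i] BadV by (intro sum_mono2) auto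
    also have "\<dots> \<le> 2 * e * real n ^ 2" using 1 by simp
    finally have "real n * (card (Bad i) * \<mu>) \<le> real n * (2 * e * n)" by (simp add: power2_eq_square mult_ac)
    then have "card (Bad i) * \<mu> \<le> 2 * e * n" using n0 by (simp add: mult_le_cancel_left)
    then show ?thesis using mu0 by (simp add: field_simps)
  qed
  have small: "(L + 1) * e + \<mu> + 2 * e / \<mu> \<le> 1 / L ^ 2"
  proof -
    have "(L + 1) * e \<le> 2 * L * e" using L1 e0 by (intro mult_right_mono) auto
    also have "\<dots> = 2 / L ^ 6" using L1 by (simp add: e eval_nat_numeral)
    also have "\<dots> \<le> 2 / L ^ 3" using L1 by (intro divide_left_mono power_increasing) auto
    finally have 1: "(L + 1) * e \<le> 2 / L ^ 3" .
    have "2 * e / \<mu> = 2 / L ^ 4" using L1 by (simp add: e \<mu>_def eval_nat_numeral)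
    also have "\<dots> \<le> 2 / L ^ 3" using L1 by (intro divide_left_mono power_increasing) auto
    finally have "(L + 1) * e + \<mu> + 2 * e / \<mu> \<le> 5 / L ^ 3" using 1 unfolding \<mu>_def by simp
    also have "\<dots> \<le> 1 / L ^ 2"
    proof -
      have "5 * L ^ 2 \<le> L ^ 3" using Lpow[of 2] Lp[of 2] unfolding numeral_3_eq_3 numeral_2_eq_2 by linarith
      then show ?thesis using Lp[of 2] Lp[of 3] by (simp add: field_simps)
    qed
    finally show ?thesis .
  qed
  have terms: "0 \<le> (L + 1) * e" "0 \<le> 2 * e / \<mu>" using L1 e0 mu0 by auto
  have mul: "x \<le> 1 / L ^ 2 * n" if "x \<le> y * n" "y \<le> 1 / L ^ 2" for x y :: real
    using that mult_right_mono[OF that(2), of n] by linarith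
  have "parts_structure c n a b p (1 / L ^ 2) W"
    unfolding parts_structure_def
  proof (intro conjI allI impI ballI)
    fix i assume i: "i < p"
    show "W i \<subseteq> {..<n}" using Vn[OF i] by (auto simp: W_def)
    have "real (card (W i)) = card (V i) - real (card (Bad i))"
      using card_Diff_subset[of "Bad i" "V i"] finite_subset[OF BadV finV[OF i]] BadV card_mono[OF finV[OF i] BadV]
      by (simp add: W_def of_nat_diff)
    then have "(1 / p - L * e - 2 * e / \<mu>) * n \<le> card (W i)" using VL[OF i] bad[OF i] by (simp add: algebra_simps)
    moreover have "(1 / p - 1 / L ^ 2) * n \<le> (1 / p - L * e - 2 * e / \<mu>) * n"
      using small mu0 e0 by (intro mult_right_mono) (auto simp: algebra_simps)
    ultimately show "(1 / p - 1 / L ^ 2) * n \<le> card (W i)" by linarith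
    fix v assume v: "v \<in> W i"
    then have vV: "v \<in> V i" and vN: "card (Nin i v) \<le> \<mu> * n" by (auto simp: W_def Bad_def)
    have "card {w \<in> W i. \<not> adj c a v w} \<le> card (Nin i v)"
      using finV[OF i] by (intro card_mono) (auto simp: Nin_def W_def)
    then have "card {w \<in> W i. \<not> adj c a v w} \<le> \<mu> * n" using vN by linarith
    then show "card {w \<in> W i. \<not> adj c a v w} \<le> 1 / L ^ 2 * n"
      by (rule mul) (use small terms in linarith)
    \<comment> \<open>The \<open>a\<close>-degree of \<open>v\<close> is nearly exhausted by its own
      part, so little of it is left outside.\<close>
    define O1 where "O1 = {w \<in> {..<n} - V i. \<not> adj c b v w}"
    have "O1 \<union> (V i - Nin i v) \<subseteq> nb c n a v"
    proof -
      have "adj c a v x" if "x \<notin> V i" "\<not> adj c b v x" for x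
      proof -
        have "v \<noteq> x" using that vV by auto
        then show ?thesis using adj_other[OF ab, of v x c] that by simp
      qed
      then show ?thesis using Vn[OF i] by (auto simp: O1_def Nin_def nb_def)
    qed
    then have "card (O1 \<union> (V i - Nin i v)) \<le> card (nb c n a v)" by (intro card_mono) auto
    moreover have "card (O1 \<union> (V i - Nin i v)) = card O1 + card (V i - Nin i v)"
      using finV[OF i] by (intro card_Un_disjoint) (auto simp: O1_def)
    moreover have "card (V i) - card (Nin i v) \<le> card (V i - Nin i v)"
      using finV[OF i] by (intro diff_card_le_card_Diff) (auto simp: Nin_def)
    ultimately have "card O1 + real (card (V i)) - card (Nin i v) \<le> card (nb c n a v)" by linarith
    moreover have "card (nb c n a v) \<le> (1 / p + e) * n" using low vV V(1)[OF i] by blast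
    ultimately have O1: "card O1 \<le> ((L + 1) * e + \<mu>) * n" using vN VL[OF i] by (simp add: algebra_simps)
    \<comment> \<open>Vertices removed from \<open>V i\<close> have become outside vertices and must
      be added.\<close>
    have "{w \<in> {..<n} - W i. \<not> adj c b v w} \<subseteq> O1 \<union> Bad i" by (auto simp: O1_def W_def)
    then have "card {w \<in> {..<n} - W i. \<not> adj c b v w} \<le> card (O1 \<union> Bad i)"
      using finite_subset[OF BadV finV[OF i]] by (intro card_mono) (auto simp: O1_def)
    also have "\<dots> \<le> card O1 + card (Bad i)" by (rule card_Un_le)
    finally have "card {w \<in> {..<n} - W i. \<not> adj c b v w} \<le> ((L + 1) * e + \<mu> + 2 * e / \<mu>) * n"
      using O1 bad[OF i] by (simp add: algebra_simps)
    then show "card {w \<in> {..<n} - W i. \<not> adj c b v w} \<le> 1 / L ^ 2 * n" using small by (rule mul)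
  next
    fix i j assume "i < p" "j < p" "i \<noteq> j"
    then show "W i \<inter> W j = {}" using V(2)[of i j] by (auto simp: W_def)
  qed
  then show thesis using that ab by blast
qed

section \<open>Embeddings of a graph with pendant edges\<close>

lemma card_PiE_equal_values:
  assumes "finite U" "x \<in> U" "y \<in> U" "x \<noteq> y" "finite V"
  shows "card {f \<in> U \<rightarrow>\<^sub>E V. f x = f y} \<le> card V ^ (card U - 1)"
proof -
  have "card {f \<in> U \<rightarrow>\<^sub>E V. f x = f y} \<le> card ((U - {y}) \<rightarrow>\<^sub>E V)"
  proof (rule card_inj_on_le)
    show "inj_on (\<lambda>f. restrict f (U - {y})) {f \<in> U \<rightarrow>\<^sub>E V. f x = f y}"
    proof (rule inj_onI)
      fix f g assume *: "f \<in> {f \<in> U \<rightarrow>\<^sub>E V. f x = f y}" "g \<in> {f \<in> U \<rightarrow>\<^sub>E V. f x = f y}"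
        "restrict f (U - {y}) = restrict g (U - {y})"
      have eq: "f z = g z" if "z \<in> U - {y}" for z using fun_cong[OF *(3), of z] that by simp
      show "f = g"
      proof (rule ext)
        fix z
        consider "z = y" | "z \<in> U - {y}" | "z \<notin> U" by auto
        then show "f z = g z"
        proof cases
          case 1
          then show ?thesis using eq[of x] assms * by auto
        next
          case 2
          then show ?thesis by (rule eq)
        next
          case 3
          then show ?thesis using * by (auto simp: PiE_def extensional_def)
        qed
      qed
    qed
    show "finite ((U - {y}) \<rightarrow>\<^sub>E V)" using assms by (simp add: finite_PiE)
  qed (auto simp: PiE_def Pi_def)
  also have "\<dots> = card V ^ (card U - 1)" using assms by (simp add: card_PiE)
  finally show ?thesis .
qed

lemma card_PiE_not_inj:
  assumes "finite U" "finite V"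
  shows "card {f \<in> U \<rightarrow>\<^sub>E V. \<not> inj_on f U} \<le> card U ^ 2 * card V ^ (card U - 1)"
proof -
  define P where "P = {(x, y) \<in> U \<times> U. x \<noteq> y}"
  have finP: "finite P" by (rule finite_subset[of _ "U \<times> U"]) (use assms in \<open>auto simp: P_def\<close>)
  have "{f \<in> U \<rightarrow>\<^sub>E V. \<not> inj_on f U} \<subseteq> (\<Union>(x, y)\<in>P. {f \<in> U \<rightarrow>\<^sub>E V. f x = f y})"
    by (fastforce simp: inj_on_def P_def)
  moreover have "finite {f \<in> U \<rightarrow>\<^sub>E V. Q f}" for Q
    by (rule finite_subset[of _ "U \<rightarrow>\<^sub>E V"]) (use assms in \<open>auto simp: finite_PiE\<close>)
  ultimately have "card {f \<in> U \<rightarrow>\<^sub>E V. \<not> inj_on f U} \<le> card (\<Union>(x, y)\<in>P. {f \<in> U \<rightarrow>\<^sub>E V. f x = f y})"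
    using finP by (intro card_mono) auto
  also have "\<dots> \<le> (\<Sum>z\<in>P. card (case z of (x, y) \<Rightarrow> {f \<in> U \<rightarrow>\<^sub>E V. f x = f y}))"
    using finP by (rule card_UN_le)
  also have "\<dots> \<le> (\<Sum>z\<in>P. card V ^ (card U - 1))"
    using assms by (intro sum_mono) (auto simp: P_def simp del: One_nat_def intro!: card_PiE_equal_values)
  also have "\<dots> = card P * card V ^ (card U - 1)" by simp
  also have "card P \<le> card (U \<times> U)" using assms by (intro card_mono) (auto simp: P_def)
  also have "card (U \<times> U) = card U ^ 2" by (simp add: card_cartesian_product power2_eq_square)
  finally show ?thesis by simp
qed

text \<open>Criticality is unpacked into witnesses: \<open>\<phi>\<close> uses all
  \<open>p + 1\<close> colours on the core, no \<open>p\<close>-colouring of it is proper, and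
  \<open>\<psi>\<close> is a \<open>p\<close>-colouring that is proper away from the edge
  \<open>x0 y0\<close>.\<close>

locale pendant_pattern =
  fixes U W :: "'a set" and F :: "'a \<Rightarrow> 'a \<Rightarrow> bool" and att :: "'a \<Rightarrow> 'a" and p h t :: nat
    and \<phi> \<psi> :: "'a \<Rightarrow> nat" and x0 y0 :: 'a
  assumes fin: "finite U" "finite W" and UW: "U \<inter> W = {}" and att: "w \<in> W \<Longrightarrow> att w \<in> U"
    and F: "F x y \<Longrightarrow> x \<in> U" "F x y \<Longrightarrow> y \<in> U" "F x y \<Longrightarrow> x \<noteq> y" "F x y \<Longrightarrow> F y x"
    and h: "card U = h" and t: "card (U \<union> W) = t"
    and phi: "\<phi> ` U = {..<p + 1}" "F x y \<Longrightarrow> \<phi> x \<noteq> \<phi> y"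
    and crit: "F x0 y0" "\<psi> \<in> U \<rightarrow> {..<p}" "F x y \<Longrightarrow> {x, y} \<noteq> {x0, y0} \<Longrightarrow> \<psi> x \<noteq> \<psi> y"
    and not_colourable: "f \<in> U \<rightarrow> {..<p} \<Longrightarrow> \<exists>x y. F x y \<and> f x = f y"
    and connected: "x \<in> U \<Longrightarrow> y \<in> U \<Longrightarrow> (x, y) \<in> {(x, y). F x y}\<^sup>*"
begin

lemma card_W: "card W = t - h" "h \<le> t"
  using h t fin UW by (auto simp: card_Un_disjoint)

definition core :: "(nat \<Rightarrow> nat \<Rightarrow> bool) \<Rightarrow> nat \<Rightarrow> ('a \<Rightarrow> nat) set" where
  "core E n = {f \<in> U \<rightarrow>\<^sub>E {..<n}. inj_on f U \<and> (\<forall>x y. F x y \<longrightarrow> E (f x) (f y))}"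

definition emb :: "(nat \<Rightarrow> nat \<Rightarrow> bool) \<Rightarrow> nat \<Rightarrow> ('a \<Rightarrow> nat) set" where
  "emb E n = {f \<in> (U \<union> W) \<rightarrow>\<^sub>E {..<n}. inj_on f (U \<union> W) \<and> (\<forall>x y. F x y \<longrightarrow> E (f x) (f y)) \<and>
     (\<forall>w\<in>W. E (f (att w)) (f w))}"

lemma finite_emb: "finite (emb E n)"
  by (rule finite_subset[of _ "(U \<union> W) \<rightarrow>\<^sub>E {..<n}"]) (use fin in \<open>auto simp: emb_def finite_PiE\<close>)

text \<open>At most \<open>t\<close> images are taken when a pendant vertex is placed, whence
  \<open>d w - t\<close> choices. The candidate sets \<open>T\<close> let the degree bound depend on
  the core vertex that carries the pendant edge.\<close>

lemma pendant_extensions: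
  fixes d :: "'a \<Rightarrow> real"
  assumes d: "\<And>w. w \<in> W \<Longrightarrow> t \<le> d w"
    and deg: "\<And>w u. w \<in> W \<Longrightarrow> u \<in> T (att w) \<Longrightarrow> d w \<le> real (card {v \<in> {..<n}. E u v})"
  shows "card {f \<in> core E n. \<forall>x\<in>U. f x \<in> T x} * (\<Prod>w\<in>W. d w - t) \<le> card {f \<in> emb E n. \<forall>x\<in>U. f x \<in> T x}"
proof -
  define good where "good Y g \<longleftrightarrow> inj_on g Y \<and> (\<forall>x y. F x y \<longrightarrow> E (g x) (g y)) \<and>
      (\<forall>w\<in>W \<inter> Y. E (g (att w)) (g w)) \<and> (\<forall>x\<in>U. g x \<in> T x)" for Y and g :: "'a \<Rightarrow> nat"
  have "card {g \<in> U \<rightarrow>\<^sub>E {..<n}. good U g} * (\<Prod>w\<in>W. d w - t) \<le> card {g \<in> U \<union> W \<rightarrow>\<^sub>E {..<n}. good (U \<union> W) g}"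
  proof (rule greedy_count)
    show "0 \<le> d w - t" if "w \<in> W" for w using d[OF that] by simp
    fix Y g w assume Y: "U \<subseteq> Y" "Y \<subseteq> U \<union> W" and w: "w \<in> W - Y" and g: "g \<in> Y \<rightarrow>\<^sub>E {..<n}" "good Y g"
    define N where "N = {v \<in> {..<n}. E (g (att w)) v}"
    have finY: "finite Y" using Y fin finite_subset by (metis finite_UnI)
    have wU: "w \<notin> U" using w UW by auto
    have aw: "att w \<in> U" "att w \<in> Y" "att w \<noteq> w" using att[of w] w Y by auto
    have "N - g ` Y \<subseteq> {v \<in> {..<n}. good (insert w Y) (g(w := v))}"
    proof
      fix v assume v: "v \<in> N - g ` Y"
      have "inj_on (g(w := v)) (insert w Y)"
        using g v w by (auto simp: good_def inj_on_def)
      moreover have "\<forall>x y. F x y \<longrightarrow> E ((g(w := v)) x) ((g(w := v)) y)"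
        using g wU F by (auto simp: good_def)
      moreover have "\<forall>w'\<in>W \<inter> insert w Y. E ((g(w := v)) (att w')) ((g(w := v)) w')"
        using g v aw att wU by (auto simp: good_def N_def)
      ultimately show "v \<in> {v \<in> {..<n}. good (insert w Y) (g(w := v))}"
        using g v wU by (auto simp: good_def N_def)
    qed
    then have "card (N - g ` Y) \<le> card {v \<in> {..<n}. good (insert w Y) (g(w := v))}"
      by (intro card_mono) auto
    moreover have "card N - card (g ` Y) \<le> card (N - g ` Y)" using finY by (intro diff_card_le_card_Diff) auto
    moreover have "card (g ` Y) \<le> t"
      using card_image_le[OF finY, of g] card_mono[OF _ Y(2)] fin t by auto
    moreover have "d w \<le> card N" unfolding N_def using deg[of w "g (att w)"] w aw g by (auto simp: good_def)
    ultimately show "d w - t \<le> card {v \<in> {..<n}. good (insert w Y) (g(w := v))}" by linarith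
  qed (use fin UW in auto)
  moreover have "{g \<in> U \<rightarrow>\<^sub>E {..<n}. good U g} = {f \<in> core E n. \<forall>x\<in>U. f x \<in> T x}"
    using UW by (auto simp: core_def good_def)
  moreover have "{g \<in> U \<union> W \<rightarrow>\<^sub>E {..<n}. good (U \<union> W) g} = {f \<in> emb E n. \<forall>x\<in>U. f x \<in> T x}"
    by (auto simp: emb_def good_def)
  ultimately show ?thesis by simp
qed

text \<open>Greedy embedding into candidate sets around a prescribed partial embedding
  \<open>g0\<close>, which is applied to a single vertex or to the critical edge. An earlier
  neighbour spoils at most \<open>\<delta>\<close> candidates, and at most \<open>h\<close> are
  occupied.\<close>

lemma core_lower:
  fixes \<tau> \<delta> :: real
  assumes E: "symp E" and X: "X \<subseteq> U" and T: "\<And>x. x \<in> U \<Longrightarrow> T x \<subseteq> {..<n}"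
    and g0: "g0 \<in> X \<rightarrow>\<^sub>E {..<n}" "inj_on g0 X" "\<And>x. x \<in> X \<Longrightarrow> g0 x \<in> T x"
      "\<And>x y. x \<in> X \<Longrightarrow> y \<in> X \<Longrightarrow> F x y \<Longrightarrow> E (g0 x) (g0 y)"
    and big: "\<And>x. x \<in> U - X \<Longrightarrow> \<tau> \<le> real (card (T x))"
    and miss: "\<And>x y u. x \<in> U - X \<Longrightarrow> F x y \<Longrightarrow> u \<in> T y \<Longrightarrow> real (card {v \<in> T x. \<not> E u v}) \<le> \<delta>"
    and pos: "0 \<le> \<tau> - h * \<delta> - h" "0 \<le> \<delta>"
  shows "(\<tau> - h * \<delta> - h) ^ (h - card X) \<le> card {f \<in> core E n. \<forall>x\<in>U. f x \<in> T x}"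
proof -
  define good where "good Y g \<longleftrightarrow> inj_on g Y \<and> (\<forall>x\<in>Y. \<forall>y\<in>Y. F x y \<longrightarrow> E (g x) (g y)) \<and>
      (\<forall>x\<in>Y. g x \<in> T x)" for Y and g :: "'a \<Rightarrow> nat"
  have finX: "finite X" using X fin finite_subset by auto
  have "card {g \<in> X \<rightarrow>\<^sub>E {..<n}. good X g} * (\<Prod>x\<in>U - X. \<tau> - h * \<delta> - h) \<le> card {g \<in> X \<union> (U - X) \<rightarrow>\<^sub>E {..<n}. good (X \<union> (U - X)) g}"
  proof (rule greedy_count)
    fix Y g x assume Y: "X \<subseteq> Y" "Y \<subseteq> X \<union> (U - X)" and x: "x \<in> U - X - Y" and g: "g \<in> Y \<rightarrow>\<^sub>E {..<n}" "good Y g"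
    have YU: "Y \<subseteq> U" using Y X by auto
    have finY: "finite Y" using YU fin finite_subset by auto
    have cY: "card Y \<le> h" using card_mono[OF _ YU] fin h by auto
    define B where "B = (\<Union>y\<in>{y \<in> Y. F x y}. {v \<in> T x. \<not> E (g y) v})"
    have finT: "finite (T x)" using T[of x] x finite_subset by auto
    have "T x - (g ` Y \<union> B) \<subseteq> {v \<in> {..<n}. good (insert x Y) (g(x := v))}"
    proof
      fix v assume v: "v \<in> T x - (g ` Y \<union> B)"
      have "inj_on (g(x := v)) (insert x Y)"
        using g v x by (auto simp: good_def inj_on_def)
      moreover have Ev: "E (g y) v" "E v (g y)" if "y \<in> Y" "F x y" for y
        using v that E by (auto simp: B_def dest: sympD)
      have "\<forall>y\<in>insert x Y. \<forall>z\<in>insert x Y. F y z \<longrightarrow> E ((g(x := v)) y) ((g(x := v)) z)"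
        using g x Ev F(4) F(3)[of x x] by (auto simp: good_def)
      moreover have "\<forall>y\<in>insert x Y. (g(x := v)) y \<in> T y" using g v by (auto simp: good_def)
      ultimately show "v \<in> {v \<in> {..<n}. good (insert x Y) (g(x := v))}"
        using v T[of x] x by (auto simp: good_def)
    qed
    then have "card (T x - (g ` Y \<union> B)) \<le> card {v \<in> {..<n}. good (insert x Y) (g(x := v))}"
      by (intro card_mono) auto
    moreover have "card (T x) - card (g ` Y \<union> B) \<le> card (T x - (g ` Y \<union> B))"
      using finY finT by (intro diff_card_le_card_Diff) (auto simp: B_def)
    moreover have "card (g ` Y \<union> B) \<le> card (g ` Y) + card B" by (rule card_Un_le)
    moreover have "card (g ` Y) \<le> h" using card_image_le[OF finY, of g] cY by simp
    moreover have "real (card B) \<le> h * \<delta>"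
    proof -
      have "card B \<le> (\<Sum>y\<in>{y \<in> Y. F x y}. card {v \<in> T x. \<not> E (g y) v})"
        unfolding B_def using finY by (intro card_UN_le) auto
      also have "real \<dots> \<le> (\<Sum>y\<in>{y \<in> Y. F x y}. \<delta>)"
        unfolding of_nat_sum using g x by (intro sum_mono miss) (auto simp: good_def)
      also have "\<dots> = card {y \<in> Y. F x y} * \<delta>" by simp
      also have "card {y \<in> Y. F x y} \<le> card Y" using finY by (intro card_mono) auto
      also have "card Y * \<delta> \<le> h * \<delta>" using cY pos by (intro mult_right_mono) auto
      finally show ?thesis using pos by (simp add: mult_right_mono)
    qed
    moreover have "\<tau> \<le> card (T x)" using big x by auto
    ultimately show "\<tau> - h * \<delta> - h \<le> card {v \<in> {..<n}. good (insert x Y) (g(x := v))}" by linarith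
  qed (use fin finX pos in auto)
  moreover have "X \<union> (U - X) = U" using X by auto
  moreover have "{g \<in> U \<rightarrow>\<^sub>E {..<n}. good U g} = {f \<in> core E n. \<forall>x\<in>U. f x \<in> T x}"
    using F(1,2) by (auto simp: core_def good_def)
  moreover have "card (U - X) = h - card X" using X finX h by (simp add: card_Diff_subset)
  moreover have "1 \<le> card {g \<in> X \<rightarrow>\<^sub>E {..<n}. good X g}"
  proof -
    have "g0 \<in> {g \<in> X \<rightarrow>\<^sub>E {..<n}. good X g}" using g0 by (auto simp: good_def)
    moreover have "finite {g \<in> X \<rightarrow>\<^sub>E {..<n}. good X g}"
      by (rule finite_subset[of _ "X \<rightarrow>\<^sub>E {..<n}"]) (use finX in \<open>auto simp: finite_PiE\<close>)
    ultimately show ?thesis by (metis Suc_le_eq One_nat_def card_gt_0_iff empty_iff)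
  qed
  ultimately have 1: "card {g \<in> X \<rightarrow>\<^sub>E {..<n}. good X g} * (\<tau> - h * \<delta> - h) ^ (h - card X)
      \<le> card {f \<in> core E n. \<forall>x\<in>U. f x \<in> T x}" "1 \<le> card {g \<in> X \<rightarrow>\<^sub>E {..<n}. good X g}" by auto
  have "1 * (\<tau> - h * \<delta> - h) ^ (h - card X) \<le> card {g \<in> X \<rightarrow>\<^sub>E {..<n}. good X g} * (\<tau> - h * \<delta> - h) ^ (h - card X)"
    using 1(2) pos by (intro mult_right_mono) auto
  then show ?thesis using 1(1) by linarith
qed

text \<open>Injectivity is simply dropped. The sets \<open>R w\<close> make it possible to prescribe
  the image of a pendant vertex.\<close>

lemma emb_upper:
  assumes S: "\<And>x. x \<in> U \<Longrightarrow> finite (S x)"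
    and D: "\<And>w u. w \<in> W \<Longrightarrow> u \<in> S (att w) \<Longrightarrow> card ({v \<in> {..<n}. E u v} \<inter> R w) \<le> D w"
  shows "card {f \<in> emb E n. (\<forall>x\<in>U. f x \<in> S x) \<and> (\<forall>w\<in>W. f w \<in> R w)} \<le> (\<Prod>x\<in>U. card (S x)) * (\<Prod>w\<in>W. D w)"
proof -
  define Q where "Q g = Pi\<^sub>E W (\<lambda>w. {v \<in> {..<n}. E (g (att w)) v} \<inter> R w)" for g
  have finS: "finite (Pi\<^sub>E U S)" using fin S by (simp add: finite_PiE)
  have finQ: "finite (Q g)" for g using fin by (auto simp: Q_def intro!: finite_PiE)
  let ?A = "{f \<in> emb E n. (\<forall>x\<in>U. f x \<in> S x) \<and> (\<forall>w\<in>W. f w \<in> R w)}"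
  have "card ?A \<le> card (SIGMA g:Pi\<^sub>E U S. Q g)"
  proof (rule card_inj_on_le)
    show "inj_on (\<lambda>f. (restrict f U, restrict f W)) ?A"
    proof (rule inj_onI, clarify)
      fix f g assume *: "f \<in> emb E n" "g \<in> emb E n" "restrict f U = restrict g U" "restrict f W = restrict g W"
      show "f = g"
      proof (rule ext)
        fix x
        consider "x \<in> U" | "x \<in> W" | "x \<notin> U \<union> W" by auto
        then show "f x = g x"
        proof cases
          case 1
          then show ?thesis using fun_cong[OF *(3), of x] by simp
        next
          case 2
          then show ?thesis using fun_cong[OF *(4), of x] by simp
        next
          case 3
          then show ?thesis using * by (auto simp: emb_def PiE_def extensional_def)
        qed
      qed
    qed
    show "(\<lambda>f. (restrict f U, restrict f W)) ` ?A \<subseteq> (SIGMA g:Pi\<^sub>E U S. Q g)"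
      using att by (auto simp: Q_def emb_def)
    show "finite (SIGMA g:Pi\<^sub>E U S. Q g)" using finS finQ by simp
  qed
  also have "\<dots> = (\<Sum>g\<in>Pi\<^sub>E U S. card (Q g))" using finS finQ by (simp add: card_SigmaI)
  also have "\<dots> \<le> (\<Sum>g\<in>Pi\<^sub>E U S. \<Prod>w\<in>W. D w)"
    using fin D att by (intro sum_mono) (auto simp: Q_def card_PiE intro!: prod_mono)
  also have "\<dots> = (\<Prod>x\<in>U. card (S x)) * (\<Prod>w\<in>W. D w)" using fin by (simp add: card_PiE)
  finally show ?thesis .
qed

definition uses_edge :: "('a \<Rightarrow> nat) \<Rightarrow> nat \<Rightarrow> nat \<Rightarrow> bool" where
  "uses_edge f u v \<longleftrightarrow> (\<exists>x y. F x y \<and> f x = u \<and> f y = v) \<or>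
     (\<exists>w\<in>W. f (att w) = u \<and> f w = v \<or> f (att w) = v \<and> f w = u)"

text \<open>The edge is the image of one of at most \<open>h ^ 2\<close> ordered core pairs, or of
  one of at most \<open>t\<close> pendant edges in two orientations. A core pair fixes two core
  vertices, a pendant edge one core vertex and one pendant vertex; the latter bound is the larger
  since \<open>D\<close> is at most \<open>n\<close>.\<close>

lemma edge_copies_upper:
  assumes D: "\<And>u. u < n \<Longrightarrow> card {v \<in> {..<n}. E u v} \<le> D" and Dn: "1 \<le> D" "D \<le> n"
    and uv: "u < n" "v < n"
  shows "card {f \<in> emb E n. uses_edge f u v} \<le> (h ^ 2 + 2 * t) * (n ^ (h - 1) * D ^ (t - h - 1))"
proof -
  have h2: "h \<ge> 2"
  proof -
    have "{x0, y0} \<subseteq> U" "x0 \<noteq> y0" using F crit by auto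
    then have "card {x0, y0} \<le> card U" using fin by (intro card_mono) auto
    then show ?thesis using \<open>x0 \<noteq> y0\<close> h by simp
  qed
  have fe: "finite {f \<in> emb E n. Q f}" for Q by (rule finite_subset[OF _ finite_emb[of E n]]) auto
  define A where "A z = {f \<in> emb E n. f (fst z) = u \<and> f (snd z) = v}" for z
  define B where "B w = {f \<in> emb E n. f (att w) = u \<and> f w = v}" for w
  define C where "C w = {f \<in> emb E n. f (att w) = v \<and> f w = u}" for w
  define P where "P = {(x, y) \<in> U \<times> U. x \<noteq> y}"
  have finP: "finite P" by (rule finite_subset[of _ "U \<times> U"]) (use fin in \<open>auto simp: P_def\<close>)
  have "{f \<in> emb E n. uses_edge f u v} \<subseteq> (\<Union>z\<in>P. A z) \<union> ((\<Union>w\<in>W. B w) \<union> (\<Union>w\<in>W. C w))"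
    using F by (fastforce simp: uses_edge_def A_def B_def C_def P_def)
  then have "card {f \<in> emb E n. uses_edge f u v} \<le> card ((\<Union>z\<in>P. A z) \<union> ((\<Union>w\<in>W. B w) \<union> (\<Union>w\<in>W. C w)))"
    using finP fin fe by (intro card_mono) (auto simp: A_def B_def C_def)
  also have "\<dots> \<le> card (\<Union>z\<in>P. A z) + card ((\<Union>w\<in>W. B w) \<union> (\<Union>w\<in>W. C w))" by (rule card_Un_le)
  also have "card ((\<Union>w\<in>W. B w) \<union> (\<Union>w\<in>W. C w)) \<le> card (\<Union>w\<in>W. B w) + card (\<Union>w\<in>W. C w)" by (rule card_Un_le)
  also have "card (\<Union>z\<in>P. A z) \<le> (\<Sum>z\<in>P. card (A z))" using finP by (rule card_UN_le)
  also have "card (\<Union>w\<in>W. B w) \<le> (\<Sum>w\<in>W. card (B w))" using fin by (intro card_UN_le)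
  also have "card (\<Union>w\<in>W. C w) \<le> (\<Sum>w\<in>W. card (C w))" using fin by (intro card_UN_le)
  finally have main: "card {f \<in> emb E n. uses_edge f u v} \<le> (\<Sum>z\<in>P. card (A z)) + ((\<Sum>w\<in>W. card (B w)) + (\<Sum>w\<in>W. card (C w)))"
    by simp
  define M where "M = n ^ (h - 1) * D ^ (t - h - 1)"
  have cA: "card (A z) \<le> M" if zP: "z \<in> P" for z
  proof -
    obtain x y where z: "z = (x, y)" "x \<in> U" "y \<in> U" "x \<noteq> y" using zP by (cases z) (auto simp: P_def)
    define S where "S q = (if q = x then {u} else if q = y then {v} else {..<n})" for q
    have "A z \<subseteq> {f \<in> emb E n. (\<forall>q\<in>U. f q \<in> S q) \<and> (\<forall>w\<in>W. f w \<in> UNIV)}"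
      by (auto simp: A_def z S_def emb_def)
    then have "card (A z) \<le> card {f \<in> emb E n. (\<forall>q\<in>U. f q \<in> S q) \<and> (\<forall>w\<in>W. f w \<in> UNIV)}"
      using fe by (intro card_mono) auto
    also have "\<dots> \<le> (\<Prod>q\<in>U. card (S q)) * (\<Prod>w\<in>W. D)"
      by (rule emb_upper) (use D uv in \<open>auto simp: S_def split: if_splits\<close>)
    also have "(\<Prod>q\<in>U. card (S q)) = (\<Prod>q\<in>U - {x} - {y}. card (S q))"
      using z fin by (simp add: prod.remove[of U x] prod.remove[of "U - {x}" y] S_def)
    also have "\<dots> = n ^ (h - 2)" using z fin h by (simp add: S_def numeral_2_eq_2)
    also have "(\<Prod>w\<in>W. D) = D ^ (t - h)" by (simp add: card_W)
    \<comment> \<open>Truncated subtraction makes \<open>t = h\<close> a separate case, settled by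
      \<open>D\<close> being at least 1.\<close>
    also have "n ^ (h - 2) * D ^ (t - h) \<le> n ^ (h - 2) * (n * D ^ (t - h - 1))"
    proof (intro mult_left_mono)
      show "D ^ (t - h) \<le> n * D ^ (t - h - 1)"
      proof (cases "t - h")
        case 0
        then show ?thesis using Dn by simp
      next
        case (Suc s)
        then show ?thesis using Dn by simp
      qed
    qed simp
    also have "\<dots> = M" using h2 by (simp add: M_def Suc_diff_Suc numeral_2_eq_2 flip: power_Suc mult.assoc power_Suc2)
    finally show ?thesis .
  qed
  have cBC: "card {f \<in> emb E n. f (att w) = a \<and> f w = b} \<le> M" if w: "w \<in> W" and a: "a < n" for w a b
  proof -
    have aw: "att w \<in> U" using att w by auto
    define S where "S q = (if q = att w then {a} else {..<n})" for q
    define R where "R q = (if q = w then {b} else UNIV)" for q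
    define D' where "D' q = (if q = w then 1 else D)" for q
    have "{f \<in> emb E n. f (att w) = a \<and> f w = b} \<subseteq> {f \<in> emb E n. (\<forall>q\<in>U. f q \<in> S q) \<and> (\<forall>w\<in>W. f w \<in> R w)}"
      by (auto simp: S_def R_def emb_def)
    then have "card {f \<in> emb E n. f (att w) = a \<and> f w = b} \<le> card {f \<in> emb E n. (\<forall>q\<in>U. f q \<in> S q) \<and> (\<forall>w\<in>W. f w \<in> R w)}"
      using fe by (intro card_mono) auto
    also have "\<dots> \<le> (\<Prod>q\<in>U. card (S q)) * (\<Prod>w\<in>W. D' w)"
    proof (rule emb_upper)
      fix q u assume "q \<in> W" "u \<in> S (att q)"
      then have un: "u < n" using a by (auto simp: S_def split: if_splits)
      show "card ({v \<in> {..<n}. E u v} \<inter> R q) \<le> D' q"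
      proof (cases "q = w")
        case True
        have "card ({v \<in> {..<n}. E u v} \<inter> {b}) \<le> card {b}" by (intro card_mono) auto
        then show ?thesis using True by (simp add: R_def D'_def)
      next
        case False
        then show ?thesis using D[OF un] by (simp add: R_def D'_def)
      qed
    qed (auto simp: S_def)
    also have "(\<Prod>q\<in>U. card (S q)) = n ^ (h - 1)"
      using aw fin h by (simp add: prod.remove[of U "att w"] S_def)
    also have "(\<Prod>w\<in>W. D' w) = D ^ (t - h - 1)"
      using w fin by (simp add: prod.remove[of W w] D'_def card_W)
    finally show ?thesis by (simp add: M_def)
  qed
  have "(\<Sum>z\<in>P. card (A z)) \<le> (\<Sum>z\<in>P. M)" by (intro sum_mono cA)
  also have "\<dots> = card P * M" by simp
  also have "card P \<le> card (U \<times> U)" using fin by (intro card_mono) (auto simp: P_def)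
  also have "card (U \<times> U) = h ^ 2" by (simp add: card_cartesian_product power2_eq_square h)
  finally have 1: "(\<Sum>z\<in>P. card (A z)) \<le> h ^ 2 * M" by simp
  have "(\<Sum>w\<in>W. card (B w)) \<le> (\<Sum>w\<in>W. M)" unfolding B_def using uv by (intro sum_mono cBC)
  also have "\<dots> \<le> t * M" using card_W by simp
  finally have 2: "(\<Sum>w\<in>W. card (B w)) \<le> t * M" .
  have "(\<Sum>w\<in>W. card (C w)) \<le> (\<Sum>w\<in>W. M)" unfolding C_def using uv by (intro sum_mono cBC)
  also have "\<dots> \<le> t * M" using card_W by simp
  finally have 3: "(\<Sum>w\<in>W. card (C w)) \<le> t * M" .
  show ?thesis using main 1 2 3 unfolding M_def[symmetric] by (simp add: algebra_simps)
qed

text \<open>The multipartite homomorphisms coloured by \<open>\<phi>\<close> are homomorphisms of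
  the core; those that are not injective are of lower order in \<open>n\<close>.\<close>

lemma core_supersaturation:
  fixes \<gamma> :: real
  assumes A: "A \<subseteq> {..<n}" and E: "symp E" and n: "n > 0" and g: "0 < \<gamma>" "\<gamma> \<le> 1"
    and many: "\<gamma> * real n ^ (p + 1) \<le> card (cliq E (p + 1) A)"
  shows "\<gamma> ^ (h ^ (p + 1)) * real n ^ h - h ^ 2 * real n ^ (h - 1) \<le> card {f \<in> core E n. \<forall>x\<in>U. f x \<in> A}"
proof -
  have finA: "finite A" using A finite_subset by auto
  have "\<gamma> ^ (h ^ (p + 1)) * real n ^ h \<le> card (cmult E A \<phi> U)"
    using cmult_supersaturation[OF fin(1) finA phi(1) _ _ g E many] card_mono[OF _ A] n h by simp
  also have "card (cmult E A \<phi> U) \<le> card ({f \<in> core E n. \<forall>x\<in>U. f x \<in> A} \<union> {f \<in> U \<rightarrow>\<^sub>E {..<n}. \<not> inj_on f U})"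
  proof (rule card_mono)
    show "finite ({f \<in> core E n. \<forall>x\<in>U. f x \<in> A} \<union> {f \<in> U \<rightarrow>\<^sub>E {..<n}. \<not> inj_on f U})"
      by (rule finite_subset[of _ "U \<rightarrow>\<^sub>E {..<n}"]) (use fin in \<open>auto simp: core_def finite_PiE\<close>)
    show "cmult E A \<phi> U \<subseteq> {f \<in> core E n. \<forall>x\<in>U. f x \<in> A} \<union> {f \<in> U \<rightarrow>\<^sub>E {..<n}. \<not> inj_on f U}"
      using A F phi(2) by (auto simp: cmult_def core_def PiE_def Pi_def)
  qed
  also have "\<dots> \<le> card {f \<in> core E n. \<forall>x\<in>U. f x \<in> A} + card {f \<in> U \<rightarrow>\<^sub>E {..<n}. \<not> inj_on f U}"
    by (rule card_Un_le)
  also have "card {f \<in> U \<rightarrow>\<^sub>E {..<n}. \<not> inj_on f U} \<le> h ^ 2 * n ^ (h - 1)"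
    using card_PiE_not_inj[OF fin(1), of "{..<n}"] h by simp
  finally show ?thesis by simp
qed

end

section \<open>Copies through a vertex and in multipartite colourings\<close>

definition mono_copy_set :: "'a sgraph \<Rightarrow> nat \<Rightarrow> (nat set \<Rightarrow> colour) \<Rightarrow> ('a \<Rightarrow> nat) set" where
  "mono_copy_set H n c = {f \<in> verts H \<rightarrow>\<^sub>E {..<n}.
     inj_on f (verts H) \<and> (\<exists>col. \<forall>e\<in>edges H. c (f ` e) = col)}"

lemma mono_copies_card: "mono_copies H n c = card (mono_copy_set H n c)"
  by (simp add: mono_copies_def mono_copy_set_def)

lemma finite_mono_copy_set: "finite (verts H) \<Longrightarrow> finite (mono_copy_set H n c)"
  by (rule finite_subset[of _ "verts H \<rightarrow>\<^sub>E {..<n}"]) (auto simp: mono_copy_set_def finite_PiE)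

lemma UNIV_colour: "(UNIV :: colour set) = {Red, Blue}"
  using colour.exhaust by auto

lemma finite_edge_colourings: "finite (edge_colourings n)"
  unfolding edge_colourings_def
  by (intro finite_PiE finite_imp_finite_nsets) (auto simp: UNIV_colour)

lemma min_mono_copies_le: "c \<in> edge_colourings n \<Longrightarrow> min_mono_copies H n \<le> mono_copies H n c"
  unfolding min_mono_copies_def by (rule Min_le) (use finite_edge_colourings in auto)

lemma edge_colourings_nonempty: "edge_colourings n \<noteq> {}"
  by (simp add: edge_colourings_def PiE_eq_empty_iff)

lemma ex_min_mono_copies: "\<exists>c\<in>edge_colourings n. mono_copies H n c = min_mono_copies H n"
proof -
  have "min_mono_copies H n \<in> mono_copies H n ` edge_colourings n"
    unfolding min_mono_copies_def by (rule Min_in) (use finite_edge_colourings edge_colourings_nonempty in auto)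
  then show ?thesis by auto
qed

lemma image_edge:
  assumes "simple_graph H" "f \<in> verts H \<rightarrow>\<^sub>E {..<n}" "inj_on f (verts H)" "e \<in> edges H"
  shows "f ` e \<in> nsets {..<n} 2"
proof -
  have e: "e \<subseteq> verts H" "finite e" "card e = 2" using assms by (auto simp: simple_graph_def nsets_def)
  then have "card (f ` e) = 2" using card_image[OF inj_on_subset[OF assms(3) e(1)]] by simp
  then show ?thesis using e assms(2) by (auto simp: nsets_def PiE_def Pi_def)
qed

text \<open>Deleting \<open>v\<close> and duplicating \<open>u\<close> cannot decrease the number of copies; the error term counts
  the copies that use both \<open>u\<close> and its duplicate.\<close>

lemma copies_through_clone:
  assumes H: "simple_graph H" and c: "c \<in> edge_colourings n" and cmin: "mono_copies H n c = min_mono_copies H n"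
    and uv: "u < n" "v < n" "u \<noteq> v"
  shows "card {f \<in> mono_copy_set H n c. v \<in> f ` verts H}
    \<le> card {f \<in> mono_copy_set H n c. u \<in> f ` verts H} + card (verts H) ^ 2 * n ^ (card (verts H) - 2)"
proof -
  define X where "X = verts H"
  \<comment> \<open>The colour between \<open>u\<close> and its clone \<open>v\<close> is chosen
    arbitrarily, as copies through both are only estimated by their total number of
    placements.\<close>
  define c' where "c' = restrict (\<lambda>e. if v \<in> e then (if u \<in> e then Red else c (insert u (e - {v}))) else c e) (nsets {..<n} 2)"
  have finX: "finite X" using H by (simp add: X_def simple_graph_def)
  have c': "c' \<in> edge_colourings n" by (simp add: c'_def edge_colourings_def)
  define M where "M = mono_copy_set H n c"
  define M' where "M' = mono_copy_set H n c'"
  have finM: "finite M" "finite M'" using finX by (auto simp: M_def M'_def X_def finite_mono_copy_set)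
  have Mf: "f \<in> X \<rightarrow>\<^sub>E {..<n}" "inj_on f X" if "f \<in> M \<or> f \<in> M'" for f
    using that by (auto simp: M_def M'_def mono_copy_set_def X_def)
  have im: "f ` e \<in> nsets {..<n} 2" if "f \<in> M \<or> f \<in> M'" "e \<in> edges H" for f e
    using image_edge[OF H _ _ that(2)] Mf[OF that(1)] by (simp add: X_def)
  have eX: "e \<subseteq> X" if "e \<in> edges H" for e using that H by (auto simp: simple_graph_def nsets_def X_def)
  have 0: "{f \<in> M'. v \<notin> f ` X} = {f \<in> M. v \<notin> f ` X}"
  proof -
    have "f \<in> M' \<longleftrightarrow> f \<in> M" if "v \<notin> f ` X" for f
    proof -
      have "c' (f ` e) = c (f ` e)" if "f \<in> X \<rightarrow>\<^sub>E {..<n}" "inj_on f X" "e \<in> edges H" for e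
        using image_edge[OF H _ _ that(3), of f n] that eX[OF that(3)] \<open>v \<notin> f ` X\<close>
        by (auto simp: X_def c'_def)
      then show ?thesis by (auto simp: M_def M'_def mono_copy_set_def X_def)
    qed
    then show ?thesis by blast
  qed
  have 1: "card {f \<in> M'. v \<in> f ` X \<and> u \<notin> f ` X} \<le> card {f \<in> M. u \<in> f ` X}"
  proof (rule card_inj_on_le)
    let ?s = "\<lambda>f. restrict (transpose u v \<circ> f) X"
    show "inj_on ?s {f \<in> M'. v \<in> f ` X \<and> u \<notin> f ` X}"
    proof (rule inj_onI)
      fix f g assume *: "f \<in> {f \<in> M'. v \<in> f ` X \<and> u \<notin> f ` X}" "g \<in> {f \<in> M'. v \<in> f ` X \<and> u \<notin> f ` X}"
        "?s f = ?s g"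
      show "f = g"
      proof (rule ext)
        fix x
        show "f x = g x"
        proof (cases "x \<in> X")
          case True
          then have "transpose u v (f x) = transpose u v (g x)" using fun_cong[OF *(3), of x] by simp
          then show ?thesis by (metis transpose_involutory)
        next
          case False
          have "f \<in> extensional X" "g \<in> extensional X" using * Mf by (auto simp: PiE_def)
          then show ?thesis using False by (simp add: extensional_def)
        qed
      qed
    qed
    show "?s ` {f \<in> M'. v \<in> f ` X \<and> u \<notin> f ` X} \<subseteq> {f \<in> M. u \<in> f ` X}"
    proof (rule image_subsetI)
      fix f assume "f \<in> {f \<in> M'. v \<in> f ` X \<and> u \<notin> f ` X}"
      then obtain x where f: "f \<in> M'" "u \<notin> f ` X" and x: "x \<in> X" "v = f x" by auto
      have fP: "f \<in> X \<rightarrow>\<^sub>E {..<n}" "inj_on f X" using Mf f by auto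
      have "?s f \<in> X \<rightarrow>\<^sub>E {..<n}" using fP uv by (auto simp: PiE_def Pi_def transpose_def)
      moreover have "inj_on (?s f) X" using fP by (auto simp: inj_on_def transpose_eq_iff)
      moreover have "c (?s f ` e) = c' (f ` e)" if e: "e \<in> edges H" for e
      proof -
        have ue: "u \<notin> f ` e" using f eX[OF e] by auto
        have se: "?s f ` e = transpose u v ` (f ` e)" using eX[OF e] by (auto simp: image_iff)
        have "transpose u v ` (f ` e) = (if v \<in> f ` e then insert u (f ` e - {v}) else f ` e)"
          using ue by (auto simp: transpose_def image_iff)
        moreover have "c' (f ` e) = c (if v \<in> f ` e then insert u (f ` e - {v}) else f ` e)"
          using ue im[OF _ e] f(1) by (simp add: c'_def)
        ultimately show ?thesis unfolding se by simp
      qed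
      ultimately have "?s f \<in> M" using f by (auto simp: M_def M'_def mono_copy_set_def X_def)
      moreover have "?s f x = u" using x by simp
      ultimately show "?s f \<in> {f \<in> M. u \<in> f ` X}" using x by (metis (mono_tags, lifting) image_eqI mem_Collect_eq)
    qed
    show "finite {f \<in> M. u \<in> f ` X}" using finM by simp
  qed
  have 2: "card {f \<in> M'. v \<in> f ` X \<and> u \<in> f ` X} \<le> card X ^ 2 * n ^ (card X - 2)"
  proof -
    define P where "P = {(x, y) \<in> X \<times> X. x \<noteq> y}"
    have finP: "finite P" by (rule finite_subset[of _ "X \<times> X"]) (use finX in \<open>auto simp: P_def\<close>)
    define S where "S z q = (if q = fst z then {v} else if q = snd z then {u} else {..<n})" for z and q :: 'a
    have finS: "finite (Pi\<^sub>E X (S z))" for z using finX by (intro finite_PiE) (auto simp: S_def)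
    have "{f \<in> M'. v \<in> f ` X \<and> u \<in> f ` X} \<subseteq> (\<Union>z\<in>P. Pi\<^sub>E X (S z))"
    proof clarify
      fix f x y assume f: "f \<in> M'" "x \<in> X" "y \<in> X" "v = f x" "u = f y"
      have "x \<noteq> y" using f uv by auto
      then have "(x, y) \<in> P" using f by (simp add: P_def)
      moreover have "f \<in> Pi\<^sub>E X (S (x, y))" using f Mf[of f] by (auto simp: S_def PiE_def Pi_def)
      ultimately show "f \<in> (\<Union>z\<in>P. Pi\<^sub>E X (S z))" by blast
    qed
    then have "card {f \<in> M'. v \<in> f ` X \<and> u \<in> f ` X} \<le> card (\<Union>z\<in>P. Pi\<^sub>E X (S z))"
      using finP finS by (intro card_mono) auto
    also have "\<dots> \<le> (\<Sum>z\<in>P. card (Pi\<^sub>E X (S z)))" using finP by (rule card_UN_le)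
    also have "\<dots> \<le> (\<Sum>z\<in>P. n ^ (card X - 2))"
    proof (rule sum_mono)
      fix z assume "z \<in> P"
      then obtain x y where z: "z = (x, y)" "x \<in> X" "y \<in> X" "x \<noteq> y" by (cases z) (auto simp: P_def)
      have "card (Pi\<^sub>E X (S z)) = (\<Prod>q\<in>X. card (S z q))" using finX by (simp add: card_PiE)
      also have "\<dots> = (\<Prod>q\<in>X - {x} - {y}. card (S z q))"
        using z finX by (simp add: prod.remove[of X x] prod.remove[of "X - {x}" y] S_def)
      also have "\<dots> = n ^ (card X - 2)" using z finX by (simp add: S_def numeral_2_eq_2)
      finally show "card (Pi\<^sub>E X (S z)) \<le> n ^ (card X - 2)" by simp
    qed
    also have "\<dots> = card P * n ^ (card X - 2)" by simp
    also have "card P \<le> card (X \<times> X)" using finX by (intro card_mono) (auto simp: P_def)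
    also have "card (X \<times> X) = card X ^ 2" by (simp add: card_cartesian_product power2_eq_square)
    finally show ?thesis by simp
  qed
  have "card M \<le> card M'" using cmin min_mono_copies_le[OF c', of H] by (simp add: mono_copies_card M_def M'_def)
  moreover have "card M = card {f \<in> M. v \<notin> f ` X} + card {f \<in> M. v \<in> f ` X}"
    using finM by (subst card_Un_disjoint[symmetric]) (auto intro: arg_cong[of _ _ card])
  moreover have "M' = {f \<in> M'. v \<notin> f ` X} \<union> ({f \<in> M'. v \<in> f ` X \<and> u \<notin> f ` X} \<union> {f \<in> M'. v \<in> f ` X \<and> u \<in> f ` X})"
    by blast
  then have "card M' \<le> card {f \<in> M'. v \<notin> f ` X} + (card {f \<in> M'. v \<in> f ` X \<and> u \<notin> f ` X} + card {f \<in> M'. v \<in> f ` X \<and> u \<in> f ` X})"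
    by (metis (no_types, lifting) card_Un_le add_left_mono le_trans)
  ultimately have "card {f \<in> M. v \<in> f ` X} \<le> card {f \<in> M'. v \<in> f ` X \<and> u \<notin> f ` X} + card {f \<in> M'. v \<in> f ` X \<and> u \<in> f ` X}"
    unfolding 0 by linarith
  then show ?thesis using 1 2 unfolding M_def X_def by linarith
qed

lemma sum_card_through:
  assumes "finite (verts H)"
  shows "(\<Sum>u<n. card {f \<in> mono_copy_set H n c. u \<in> f ` verts H}) = card (verts H) * mono_copies H n c"
proof -
  have "(\<Sum>u<n. card {f \<in> mono_copy_set H n c. u \<in> f ` verts H})
      = (\<Sum>f\<in>mono_copy_set H n c. card {u \<in> {..<n}. u \<in> f ` verts H})"
    by (rule sum_card_swap) (use assms finite_mono_copy_set in auto)
  also have "\<dots> = (\<Sum>f\<in>mono_copy_set H n c. card (verts H))"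
  proof (rule sum.cong[OF refl])
    fix f assume "f \<in> mono_copy_set H n c"
    then have "{u \<in> {..<n}. u \<in> f ` verts H} = f ` verts H" "inj_on f (verts H)"
      by (auto simp: mono_copy_set_def)
    then show "card {u \<in> {..<n}. u \<in> f ` verts H} = card (verts H)" by (simp add: card_image)
  qed
  finally show ?thesis by (simp add: mono_copies_card mult.commute)
qed

text \<open>The cloning inequality is summed over all \<open>u\<close>: an average vertex lies in
  exactly the fraction \<open>card (verts H) / n\<close> of the copies.\<close>

lemma copies_through_vertex:
  assumes H: "simple_graph H" and c: "c \<in> edge_colourings n" and cmin: "mono_copies H n c = min_mono_copies H n"
    and v: "v < n" and t: "card (verts H) \<ge> 2"
  shows "n * card {f \<in> mono_copy_set H n c. v \<in> f ` verts H}
    \<le> card (verts H) * mono_copies H n c + card (verts H) ^ 2 * n ^ (card (verts H) - 1)"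
proof -
  define N where "N u = card {f \<in> mono_copy_set H n c. u \<in> f ` verts H}" for u
  define K where "K = card (verts H) ^ 2 * n ^ (card (verts H) - 2)"
  have "N v \<le> N u + K" if "u < n" for u
    using copies_through_clone[OF H c cmin that v] unfolding N_def K_def by (cases "u = v") auto
  then have "(\<Sum>u<n. N v) \<le> (\<Sum>u<n. N u + K)" by (intro sum_mono) auto
  also have "\<dots> = card (verts H) * mono_copies H n c + n * K"
    using sum_card_through[of H n c] H by (simp add: sum.distrib N_def simple_graph_def)
  also have "n * K = card (verts H) ^ 2 * n ^ (card (verts H) - 1)"
    using t by (simp add: K_def Suc_diff_Suc numeral_2_eq_2 flip: power_Suc)
  finally show ?thesis by (simp add: N_def)
qed

text \<open>The number of injections from a \<open>t\<close>-set into an \<open>s\<close>-set; for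
  \<open>s < t\<close> truncated subtraction supplies a zero factor.\<close>

definition ffact :: "nat \<Rightarrow> nat \<Rightarrow> nat" where
  "ffact s t = (\<Prod>i<t. s - i)"

definition part_size :: "nat \<Rightarrow> (nat \<Rightarrow> nat) \<Rightarrow> nat \<Rightarrow> nat" where
  "part_size n part i = card {v \<in> {..<n}. part v = i}"

lemma sum_part_size:
  assumes "part \<in> {..<n} \<rightarrow> {..<p}"
  shows "(\<Sum>i<p. part_size n part i) = n"
proof -
  have "(\<Sum>i<p. part_size n part i) = (\<Sum>i<p. card {v \<in> {..<n}. part v = i})" by (simp add: part_size_def)
  also have "\<dots> = (\<Sum>v<n. card {i \<in> {..<p}. part v = i})" by (rule sum_card_swap) auto
  also have "\<dots> = (\<Sum>v<n. 1)"
  proof (rule sum.cong[OF refl])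
    fix v assume "v \<in> {..<n}"
    then have "{i \<in> {..<p}. part v = i} = {part v}" using assms by auto
    then show "card {i \<in> {..<p}. part v = i} = 1" by simp
  qed
  finally show ?thesis by simp
qed

lemma part_size_mod:
  assumes "i < p"
  shows "part_size n (\<lambda>v. v mod p) i = n div p + (if i < n mod p then 1 else 0)"
proof (induction n)
  case 0
  then show ?case by (simp add: part_size_def)
next
  case (Suc n)
  have "{v \<in> {..<Suc n}. v mod p = i} = (if n mod p = i then insert n {v \<in> {..<n}. v mod p = i} else {v \<in> {..<n}. v mod p = i})"
    by (auto simp: less_Suc_eq)
  then have "part_size (Suc n) (\<lambda>v. v mod p) i = part_size n (\<lambda>v. v mod p) i + (if n mod p = i then 1 else 0)"
    by (simp add: part_size_def)
  then show ?case using Suc assms by (auto simp: div_Suc mod_Suc)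
qed

locale pendant_graph = pendant_pattern U W F att p h t \<phi> \<psi> x0 y0
  for U W :: "'a set" and F :: "'a \<Rightarrow> 'a \<Rightarrow> bool" and att :: "'a \<Rightarrow> 'a" and p h t :: nat
    and \<phi> \<psi> :: "'a \<Rightarrow> nat" and x0 y0 :: 'a +
  fixes H :: "'a sgraph"
  assumes simple: "simple_graph H" and verts: "verts H = U \<union> W"
    and edges: "edges H = {{x, y} |x y. F x y} \<union> {{att w, w} |w. w \<in> W}"
begin

lemma mono_copy_set_emb: "mono_copy_set H n c = emb (adj c Red) n \<union> emb (adj c Blue) n"
proof -
  have "(\<forall>e\<in>edges H. c (f ` e) = col) \<longleftrightarrow> (\<forall>x y. F x y \<longrightarrow> adj c col (f x) (f y)) \<and> (\<forall>w\<in>W. adj c col (f (att w)) (f w))"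
    if f: "inj_on f (U \<union> W)" for f col
  proof -
    have 1: "f x \<noteq> f y" if "F x y" for x y using F[OF that] f by (auto simp: inj_on_def)
    have 2: "f (att w) \<noteq> f w" if "w \<in> W" for w
    proof
      assume "f (att w) = f w"
      then have "att w = w" using inj_onD[OF f, of "att w" w] att[OF that] that by auto
      then show False using att[OF that] that UW by auto
    qed
    have "(\<forall>e\<in>edges H. c (f ` e) = col) \<longleftrightarrow>
        (\<forall>x y. F x y \<longrightarrow> c {f x, f y} = col) \<and> (\<forall>w\<in>W. c {f (att w), f w} = col)"
    proof
      assume *: "\<forall>e\<in>edges H. c (f ` e) = col"
      have "c (f ` {x, y}) = col" if "F x y" for x y
        by (rule bspec[OF *]) (use that in \<open>auto simp: edges\<close>)
      moreover have "c (f ` {att w, w}) = col" if "w \<in> W" for w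
        by (rule bspec[OF *]) (use that in \<open>auto simp: edges\<close>)
      ultimately show "(\<forall>x y. F x y \<longrightarrow> c {f x, f y} = col) \<and> (\<forall>w\<in>W. c {f (att w), f w} = col)" by simp
    qed (auto simp: edges)
    then show ?thesis using 1 2 by (auto simp: adj_def)
  qed
  note * = this
  have "f \<in> mono_copy_set H n c \<longleftrightarrow> (\<exists>col. f \<in> emb (adj c col) n)" for f
    unfolding mono_copy_set_def emb_def verts using * by blast
  then show ?thesis using colour.exhaust by auto (metis colour.exhaust)
qed

lemma emb_disjoint: "emb (adj c Red) n \<inter> emb (adj c Blue) n = {}"
proof -
  have "f \<notin> emb (adj c Blue) n" if "f \<in> emb (adj c Red) n" for f
    using that crit(1) adj_excl[of Red Blue] unfolding emb_def by blast
  then show ?thesis by blast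
qed

lemma mono_copies_emb: "mono_copies H n c = card (emb (adj c Red) n) + card (emb (adj c Blue) n)"
  unfolding mono_copies_card mono_copy_set_emb by (intro card_Un_disjoint finite_emb emb_disjoint)

lemma mono_copies_emb': "a \<noteq> b \<Longrightarrow> mono_copies H n c = card (emb (adj c a) n) + card (emb (adj c b) n)"
  by (cases a; cases b) (auto simp: mono_copies_emb)

lemma emb_sub_mono_copy_set: "emb (adj c col) n \<subseteq> mono_copy_set H n c"
  unfolding mono_copy_set_emb by (cases col) auto

text \<open>Connectedness: if no \<open>E\<close>-edge crosses between parts, the image of the core
  stays in one part, and a pendant vertex follows the core vertex it is attached to.\<close>

lemma emb_const:
  assumes f: "f \<in> emb E n" and E: "\<And>u v. u < n \<Longrightarrow> v < n \<Longrightarrow> E u v \<Longrightarrow> part u = part v"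
    and xy: "x \<in> U \<union> W" "y \<in> U \<union> W"
  shows "part (f x) = part (f y)"
proof -
  have fn: "f z < n" if "z \<in> U \<union> W" for z using f that by (auto simp: emb_def)
  have U1: "part (f x) = part (f y)" if "x \<in> U" "(x, y) \<in> {(x, y). F x y}\<^sup>*" for x y
    using that(2)
  proof (induction rule: rtrancl_induct)
    case (step y z)
    then have "F y z" by simp
    then have "E (f y) (f z)" "y \<in> U" "z \<in> U" using f F by (auto simp: emb_def)
    then have "part (f y) = part (f z)" using E fn by blast
    then show ?case using step by simp
  qed simp
  define r where "r z = (if z \<in> U then z else att z)" for z
  have r: "r z \<in> U" "part (f (r z)) = part (f z)" if "z \<in> U \<union> W" for z
  proof -
    show rz: "r z \<in> U" using that att by (auto simp: r_def)
    show "part (f (r z)) = part (f z)"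
    proof (cases "z \<in> U")
      case False
      then have "z \<in> W" using that by auto
      then have "E (f (att z)) (f z)" using f by (auto simp: emb_def)
      then show ?thesis using E fn rz that False by (auto simp: r_def)
    qed (simp add: r_def)
  qed
  show ?thesis using U1[OF r(1)[OF xy(1)] connected[OF r(1)[OF xy(1)] r(1)[OF xy(2)]]] r(2) xy by simp
qed

text \<open>Composing a copy with \<open>part\<close> would colour the core properly with
  \<open>p\<close> colours.\<close>

lemma emb_multipartite_empty:
  assumes part: "part \<in> {..<n} \<rightarrow> {..<p}" and E: "\<And>u v. u < n \<Longrightarrow> v < n \<Longrightarrow> E u v \<Longrightarrow> part u \<noteq> part v"
  shows "emb E n = {}"
proof (rule ccontr)
  assume "emb E n \<noteq> {}"
  then obtain f where f: "f \<in> emb E n" by auto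
  then have "part \<circ> f \<in> U \<rightarrow> {..<p}" using part by (auto simp: emb_def PiE_def Pi_def)
  then obtain x y where "F x y" "part (f x) = part (f y)" using not_colourable by fastforce
  moreover from this have "f x < n" "f y < n" "E (f x) (f y)" using f F(1,2) by (auto simp: emb_def)
  ultimately show False using E by blast
qed

lemma emb_cliques:
  assumes part: "part \<in> {..<n} \<rightarrow> {..<p}" and E: "\<And>u v. u < n \<Longrightarrow> v < n \<Longrightarrow> E u v \<longleftrightarrow> u \<noteq> v \<and> part u = part v"
  shows "card (emb E n) = (\<Sum>i<p. ffact (part_size n part i) t)"
proof -
  define P where "P i = {v \<in> {..<n}. part v = i}" for i
  define I where "I i = {f \<in> (U \<union> W) \<rightarrow>\<^sub>E P i. inj_on f (U \<union> W)}" for i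
  have finI: "finite (I i)" for i
    by (rule finite_subset[of _ "(U \<union> W) \<rightarrow>\<^sub>E P i"]) (use fin in \<open>auto simp: I_def P_def finite_PiE\<close>)
  have x0: "x0 \<in> U" using F crit by auto
  have "emb E n = (\<Union>i<p. I i)"
  proof
    show "emb E n \<subseteq> (\<Union>i<p. I i)"
    proof
      fix f assume f: "f \<in> emb E n"
      have fn: "f z < n" if "z \<in> U \<union> W" for z using f that by (auto simp: emb_def)
      have "part (f x) = part (f x0)" if "x \<in> U \<union> W" for x
        by (rule emb_const[OF f]) (use E that x0 in auto)
      then have "f \<in> I (part (f x0))" using f fn by (auto simp: I_def emb_def P_def)
      moreover have "part (f x0) < p" using fn[of x0] x0 part by auto
      ultimately show "f \<in> (\<Union>i<p. I i)" by blast
    qed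
    show "(\<Union>i<p. I i) \<subseteq> emb E n"
    proof clarify
      fix f i assume f: "f \<in> I i"
      have fP: "f x < n" "part (f x) = i" if "x \<in> U \<union> W" for x using f that by (auto simp: I_def P_def)
      have inj: "inj_on f (U \<union> W)" using f by (simp add: I_def)
      have "E (f x) (f y)" if "x \<in> U \<union> W" "y \<in> U \<union> W" "x \<noteq> y" for x y
        using E[OF fP(1)[OF that(1)] fP(1)[OF that(2)]] fP that inj by (auto simp: inj_on_def)
      moreover have "att w \<noteq> w" if "w \<in> W" for w using att[OF that] that UW by auto
      ultimately show "f \<in> emb E n" using f inj att F by (auto simp: emb_def I_def P_def)
    qed
  qed
  moreover have "I i \<inter> I j = {}" if "i \<noteq> j" for i j
  proof -
    have "f \<notin> I j" if "f \<in> I i" for f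
    proof
      assume "f \<in> I j"
      then have "f x0 \<in> P i" "f x0 \<in> P j" using \<open>f \<in> I i\<close> x0 by (auto simp: I_def)
      then show False using \<open>i \<noteq> j\<close> by (auto simp: P_def)
    qed
    then show ?thesis by blast
  qed
  ultimately have "card (emb E n) = (\<Sum>i<p. card (I i))"
    using finI by (simp add: card_UN_disjoint)
  also have "\<dots> = (\<Sum>i<p. ffact (part_size n part i) t)"
  proof (rule sum.cong[OF refl])
    fix i
    have "card (I i) = (\<Prod>j = 0..<card (U \<union> W). card (P i) - j)"
      unfolding I_def using card_inj_on_subset_funcset[of "U \<union> W" "P i" "U \<union> W"] fin by (simp add: P_def)
    then show "card (I i) = ffact (part_size n part i) t"
      by (simp add: t ffact_def part_size_def P_def atLeast0LessThan)
  qed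
  finally show ?thesis .
qed

lemma mono_copies_multipartite:
  assumes ab: "a \<noteq> b" and part: "part \<in> {..<n} \<rightarrow> {..<p}"
    and c: "\<And>u v. u < n \<Longrightarrow> v < n \<Longrightarrow> u \<noteq> v \<Longrightarrow> c {u, v} = (if part u = part v then a else b)"
  shows "mono_copies H n c = (\<Sum>i<p. ffact (part_size n part i) t)"
proof -
  have "card (emb (adj c a) n) = (\<Sum>i<p. ffact (part_size n part i) t)"
  proof (rule emb_cliques[OF part])
    fix u v assume "u < n" "v < n"
    then show "adj c a u v \<longleftrightarrow> u \<noteq> v \<and> part u = part v"
      using c[of u v] ab by (cases "part u = part v") (auto simp: adj_def)
  qed
  moreover have "emb (adj c b) n = {}"
    by (rule emb_multipartite_empty[OF part]) (use c ab in \<open>auto simp: adj_def split: if_splits\<close>)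
  ultimately show ?thesis by (simp add: mono_copies_emb'[OF ab])
qed

text \<open>A concrete Turan colouring whose parts are the residue classes modulo \<open>p\<close>;
  an edge lies inside a class when its image has one element.\<close>

definition mod_colouring :: "nat \<Rightarrow> nat set \<Rightarrow> colour" where
  "mod_colouring n = restrict (\<lambda>e. if card ((\<lambda>v. v mod p) ` e) = 1 then Red else Blue) (nsets {..<n} 2)"

lemma p_pos: "p > 0"
  using crit F by (metis PiE_iff Pi_iff empty_iff lessThan_0 lessThan_iff not_gr_zero)

lemma mod_colouring: 
  assumes "u < n" "v < n" "u \<noteq> v"
  shows "mod_colouring n {u, v} = (if u mod p = v mod p then Red else Blue)"
proof -
  have "{u, v} \<in> nsets {..<n} 2" using assms by (simp add: nsets_def)
  then show ?thesis by (simp add: mod_colouring_def card_insert_if)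
qed

lemma mod_colouring_in: "mod_colouring n \<in> edge_colourings n"
  by (simp add: mod_colouring_def edge_colourings_def)

lemma mono_copies_mod_colouring:
  "mono_copies H n (mod_colouring n) = (\<Sum>i<p. ffact (n div p + (if i < n mod p then 1 else 0)) t)"
proof -
  have "mono_copies H n (mod_colouring n) = (\<Sum>i<p. ffact (part_size n (\<lambda>v. v mod p) i) t)"
    by (rule mono_copies_multipartite[of Red Blue]) (use mod_colouring p_pos in auto)
  then show ?thesis using part_size_mod by simp
qed

lemma min_mono_copies_upper: "min_mono_copies H n \<le> p * (n / p + 1) ^ t"
proof -
  have "ffact s t \<le> s ^ t" for s
    unfolding ffact_def using prod_mono[of "{..<t}" "\<lambda>i. s - i" "\<lambda>_. s"] by simp
  moreover have "real (n div p) \<le> n / p" using p_pos by (simp add: pos_le_divide_eq flip: of_nat_mult)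
  then have "real (n div p + (if i < n mod p then 1 else 0)) ^ t \<le> (n / p + 1) ^ t" for i
    by (intro power_mono) auto
  ultimately have "real (ffact (n div p + (if i < n mod p then 1 else 0)) t) \<le> (n / p + 1) ^ t" for i
    by (metis (no_types, lifting) of_nat_mono of_nat_power order_trans)
  then have "real (mono_copies H n (mod_colouring n)) \<le> (\<Sum>i<p. (n / p + 1) ^ t)"
    unfolding mono_copies_mod_colouring of_nat_sum by (intro sum_mono) auto
  then show ?thesis using min_mono_copies_le[OF mod_colouring_in, of H n] by simp
qed

end

section \<open>Colourings minimising the number of copies\<close>

context pendant_graph
begin

lemma h_ge_2: "h \<ge> 2"
proof -
  have "{x0, y0} \<subseteq> U" "x0 \<noteq> y0" using F crit by auto
  then have "card {x0, y0} \<le> card U" using fin by (intro card_mono) auto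
  then show ?thesis using \<open>x0 \<noteq> y0\<close> h by simp
qed

text \<open>The Turan value p (n/p)^t is rewritten as n (n/p)^(t - 1), the scale of all later
  comparisons; the factor 2 absorbs the rounding of the part sizes.\<close>

lemma min_copies_le:
  assumes n: "n > 0" "(1 + p / n) ^ t \<le> 2" and cmin: "mono_copies H n c = min_mono_copies H n"
  shows "real (mono_copies H n c) \<le> 2 * real n * (n / p) ^ (t - 1)"
proof -
  have p: "real p > 0" using p_pos by simp
  have t: "t \<ge> 1" using h_ge_2 card_W by linarith
  have "real (mono_copies H n c) \<le> p * (n / p + 1) ^ t" using min_mono_copies_upper cmin by simp
  also have "n / p + 1 = n / p * (1 + p / n)" using p n by (simp add: field_simps)
  also have "p * (n / p * (1 + p / n)) ^ t = p * (n / p) ^ t * (1 + p / n) ^ t" by (simp only: power_mult_distrib mult.assoc)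
  also have "\<dots> \<le> p * (n / p) ^ t * 2" using n p by (intro mult_left_mono) auto
  also have "\<dots> = 2 * real n * (n / p) ^ (t - 1)" using p t by (cases t) auto
  finally show ?thesis .
qed

text \<open>The cloning error is of order n^(t - 1) without the small factor p^(1 - t), which is why
  \<open>n\<close> is required to exceed \<open>t * p ^ t\<close>.\<close>

lemma copies_through_le:
  assumes n: "n > 0" "(1 + p / n) ^ t \<le> 2" "t * real p ^ t \<le> n" and cmin: "mono_copies H n c = min_mono_copies H n"
    and c: "c \<in> edge_colourings n" and v: "v < n"
  shows "real (card {f \<in> mono_copy_set H n c. v \<in> f ` (U \<union> W)}) \<le> 4 * real t * (n / p) ^ (t - 1)"
proof -
  have p: "real p \<ge> 1" using p_pos by simp
  have t2: "t \<ge> 2" using h_ge_2 card_W by linarith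
  define N where "N = real (card {f \<in> mono_copy_set H n c. v \<in> f ` (U \<union> W)})"
  have "n * card {f \<in> mono_copy_set H n c. v \<in> f ` (U \<union> W)} \<le> t * mono_copies H n c + t ^ 2 * n ^ (t - 1)"
    using copies_through_vertex[OF simple c cmin v] t2 by (simp add: verts t)
  then have "real (n * card {f \<in> mono_copy_set H n c. v \<in> f ` (U \<union> W)}) \<le> real (t * mono_copies H n c + t ^ 2 * n ^ (t - 1))"
    by (rule of_nat_mono)
  then have "n * N \<le> t * real (mono_copies H n c) + real t ^ 2 * real n ^ (t - 1)" by (simp add: N_def)
  also have "\<dots> \<le> t * (2 * real n * (n / p) ^ (t - 1)) + real t ^ 2 * real n ^ (t - 1)"
    using min_copies_le[OF n(1,2) cmin] by (intro add_mono mult_left_mono) auto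
  also have "real t ^ 2 * real n ^ (t - 1) \<le> 2 * real t * n * (n / p) ^ (t - 1)"
  proof -
    have "t * real p ^ (t - 1) \<le> t * real p ^ t" using p by (intro mult_left_mono power_increasing) auto
    also have "\<dots> \<le> n" by (rule n(3))
    finally have "(t * real p ^ (t - 1)) * (t * (n / p) ^ (t - 1)) \<le> n * (t * (n / p) ^ (t - 1))"
      by (intro mult_right_mono) auto
    moreover have "real t ^ 2 * real n ^ (t - 1) = (t * real p ^ (t - 1)) * (t * (n / p) ^ (t - 1))"
      using p by (simp add: power_divide power2_eq_square)
    moreover have "0 \<le> n * (t * (n / p) ^ (t - 1))" by simp
    ultimately show ?thesis by (simp only: mult.assoc mult.left_commute[of _ "real n"])
  qed
  finally have "n * N \<le> n * (4 * real t * (n / p) ^ (t - 1))" by (simp add: algebra_simps)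
  then show ?thesis using n(1) unfolding N_def[symmetric] by (simp add: mult_le_cancel_left)
qed

lemma emb_le_mono: "card (emb (adj c col) n) \<le> mono_copies H n c"
  by (cases col) (auto simp: mono_copies_emb)

text \<open>Too many cliques would give at least (G/2) n^h core copies, each extended by pendant
  edges at degrees larger than n/p by a constant factor. That factor to the power
  \<open>t - h\<close> beats \<open>G\<close>, contradicting the Turan upper bound; the 4 is the
  product of the two factors 2 lost on the way.\<close>

lemma few_cliques_in_high_degree:
  fixes e \<gamma> :: real
  assumes n: "n > 0" "(1 + p / n) ^ t \<le> 2" "2 * h ^ 2 \<le> \<gamma> ^ (h ^ (p + 1)) * n" "2 * t \<le> e * n"
    and g: "0 < \<gamma>" "\<gamma> \<le> 1" "\<gamma> ^ (h ^ (p + 1)) * (1 + p * e / 2) ^ (t - h) > 4" and e: "e > 0"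
    and cmin: "mono_copies H n c = min_mono_copies H n"
    and A: "A \<subseteq> {..<n}" "\<And>v. v \<in> A \<Longrightarrow> (1 / p + e) * n \<le> card (nb c n col v)"
  shows "card (cliq (adj c col) (p + 1) A) < \<gamma> * real n ^ (p + 1)"
proof (rule ccontr)
  assume neg: "\<not> ?thesis"
  define G where "G = \<gamma> ^ (h ^ (p + 1))"
  have G0: "G > 0" using g by (simp add: G_def)
  have p: "real p \<ge> 1" using p_pos by simp
  obtain h' where h': "h = Suc h'" using h_ge_2 by (cases h) auto
  have th: "t - 1 = (t - h) + h'" using card_W h' by simp
  have "G * real n ^ h - h ^ 2 * real n ^ (h - 1) \<le> card {f \<in> core (adj c col) n. \<forall>x\<in>U. f x \<in> A}"
    unfolding G_def using neg by (intro core_supersaturation A(1) symp_adj n(1) g) auto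
  moreover have "h ^ 2 * real n ^ (h - 1) \<le> G / 2 * real n ^ h"
  proof -
    have "(2 * real h ^ 2) * real n ^ h' \<le> (G * n) * real n ^ h'"
      using n(3) by (intro mult_right_mono) (auto simp: G_def)
    then show ?thesis by (simp add: h' mult_ac)
  qed
  ultimately have core: "G / 2 * real n ^ h \<le> card {f \<in> core (adj c col) n. \<forall>x\<in>U. f x \<in> A}" by simp
  define d where "d = (1 / p + e) * n"
  have ne: "0 \<le> n / p" by simp
  have dt: "n / p * (1 + p * e / 2) \<le> d - t" using n(4) p by (simp add: d_def field_simps)
  have "real (card {f \<in> core (adj c col) n. \<forall>x\<in>U. f x \<in> A}) * (\<Prod>w\<in>W. d - t)
      \<le> card {f \<in> emb (adj c col) n. \<forall>x\<in>U. f x \<in> A}"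
  proof (rule pendant_extensions)
    show "t \<le> d" using dt e ne p by (smt (verit) mult_nonneg_nonneg divide_nonneg_nonneg)
    show "d \<le> real (card {v \<in> {..<n}. adj c col u v})" if "u \<in> A" for u
      using A(2)[OF that] by (simp add: d_def nb_def)
  qed
  also have "\<dots> \<le> card (emb (adj c col) n)" by (intro of_nat_mono card_mono finite_emb) auto
  also have "\<dots> \<le> mono_copies H n c" using emb_le_mono by simp
  also have "\<dots> \<le> 2 * real n * (n / p) ^ (t - 1)" by (rule min_copies_le[OF n(1,2) cmin])
  finally have up: "real (card {f \<in> core (adj c col) n. \<forall>x\<in>U. f x \<in> A}) * (d - t) ^ (t - h) \<le> 2 * real n * (n / p) ^ (t - 1)"
    by (simp add: card_W)
  have "(G / 2 * real n ^ h) * (n / p * (1 + p * e / 2)) ^ (t - h)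
      \<le> real (card {f \<in> core (adj c col) n. \<forall>x\<in>U. f x \<in> A}) * (d - t) ^ (t - h)"
    using core dt e ne G0 by (intro mult_mono power_mono) auto
  then have "(G / 2 * real n ^ h) * (n / p * (1 + p * e / 2)) ^ (t - h) \<le> 2 * real n * (n / p) ^ (t - 1)" using up by linarith
  also have "\<dots> = 2 * real n * (n / p) ^ h' * (n / p) ^ (t - h)" unfolding th by (simp only: power_add mult_ac)
  also have "\<dots> \<le> 2 * real n * real n ^ h' * (n / p) ^ (t - h)"
  proof -
    have "n / p \<le> n" using p mult_left_mono[of 1 "real p" "real n"] by (simp add: divide_le_eq)
    then show ?thesis by (intro mult_right_mono mult_left_mono power_mono) auto
  qed
  finally have "(real n ^ h * (n / p) ^ (t - h)) * (G / 2 * (1 + p * e / 2) ^ (t - h)) \<le> (real n ^ h * (n / p) ^ (t - h)) * 2"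
    by (simp only: power_mult_distrib h' power_Suc) (simp add: mult_ac)
  moreover have "real n ^ h * (n / p) ^ (t - h) > 0" using n p by simp
  ultimately have "G / 2 * (1 + p * e / 2) ^ (t - h) \<le> 2" by (simp only: mult_le_cancel_left_pos)
  then show False using g(3) by (simp add: G_def)
qed

text \<open>Since the attachment map is arbitrary, pigeonhole is the only source of a core vertex at
  which a larger degree pays off.\<close>

lemma ex_heavy_vertex: "\<exists>x\<in>U. t - h \<le> h * card {w \<in> W. att w = x}"
proof (rule ccontr)
  assume neg: "\<not> ?thesis"
  have "(\<Sum>x\<in>U. card {w \<in> W. att w = x}) = (\<Sum>w\<in>W. card {x \<in> U. att w = x})"
    using fin by (intro sum_card_swap)
  also have "\<dots> = (\<Sum>w\<in>W. 1)"
  proof (rule sum.cong[OF refl])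
    fix w assume "w \<in> W"
    then have "{x \<in> U. att w = x} = {att w}" using att by auto
    then show "card {x \<in> U. att w = x} = 1" by simp
  qed
  finally have s: "(\<Sum>x\<in>U. card {w \<in> W. att w = x}) = t - h" by (simp add: card_W)
  have "(\<Sum>x\<in>U. h * card {w \<in> W. att w = x}) < (\<Sum>x\<in>U. t - h)"
    using neg h_ge_2 h fin by (intro sum_strict_mono) (auto simp: not_le)
  then show False using s by (simp add: h flip: sum_distrib_left)
qed

text \<open>A part cannot be large because the other \<open>p - 1\<close> parts are not small; the
  rest are numerical consequences of the bound on \<open>\<omega>\<close>.\<close>

lemma structure_facts:
  fixes \<omega> :: real
  assumes st: "parts_structure c n a b p \<omega> V" and w: "1000 * p * h * \<omega> \<le> 1" "0 < \<omega>" and p3: "p \<ge> 3"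
  shows "\<And>i. i < p \<Longrightarrow> card (V i) \<le> (1 / p + p * \<omega>) * n"
    "real n - card (\<Union>i<p. V i) \<le> p * \<omega> * n" "p * \<omega> \<le> 1 / 1000" "h * \<omega> \<le> 1 / 1000" "p * (h * \<omega>) \<le> 1 / 1000"
    "p * \<omega> \<le> p * (h * \<omega>)" "\<omega> \<le> h * \<omega>"
proof -
  have pp: "real p \<ge> 3" using p3 by simp
  have hh: "real h \<ge> 2" using h_ge_2 by simp
  show ph: "p * (h * \<omega>) \<le> 1 / 1000" using w by (simp add: mult_ac)
  show wh: "\<omega> \<le> h * \<omega>" using mult_right_mono[of 1 "real h" \<omega>] w hh by simp
  then show pw: "p * \<omega> \<le> p * (h * \<omega>)" using pp by (intro mult_left_mono) auto
  then show "p * \<omega> \<le> 1 / 1000" using ph by simp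
  have "1 * (h * \<omega>) \<le> p * (h * \<omega>)" using pp w by (intro mult_right_mono) auto
  then show "h * \<omega> \<le> 1 / 1000" using ph by simp
  have Vn: "V i \<subseteq> {..<n}" and Vc: "(1 / p - \<omega>) * n \<le> card (V i)" if "i < p" for i
    using st that by (auto simp: parts_structure_def)
  have disj: "V i \<inter> V j = {}" if "i < p" "j < p" "i \<noteq> j" for i j
    using st that by (auto simp: parts_structure_def)
  have finV: "finite (V i)" if "i < p" for i using finite_subset[OF Vn[OF that]] by auto
  have cU: "card (\<Union>i<p. V i) = (\<Sum>i<p. card (V i))"
    using finV disj by (intro card_UN_disjoint) auto
  have "(\<Sum>i<p. (1 / p - \<omega>) * n) \<le> (\<Sum>i<p. real (card (V i)))" using Vc by (intro sum_mono) auto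
  then have "(1 - p * \<omega>) * n \<le> (\<Sum>i<p. real (card (V i)))" using pp by (simp add: algebra_simps)
  then show "real n - card (\<Union>i<p. V i) \<le> p * \<omega> * n" by (simp add: cU algebra_simps)
  fix i assume i: "i < p"
  have "card (\<Union>i<p. V i) \<le> card {..<n}" using Vn by (intro card_mono) auto
  then have "(\<Sum>i<p. real (card (V i))) \<le> n" by (simp add: cU flip: of_nat_sum)
  moreover have "(\<Sum>i<p. real (card (V i))) = card (V i) + (\<Sum>j\<in>{..<p} - {i}. real (card (V j)))"
    using i by (subst sum.remove[of _ i]) auto
  moreover have "(\<Sum>j\<in>{..<p} - {i}. (1 / p - \<omega>) * n) \<le> (\<Sum>j\<in>{..<p} - {i}. real (card (V j)))"
    using Vc by (intro sum_mono) auto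
  moreover have "(\<Sum>j\<in>{..<p} - {i}. (1 / p - \<omega>) * n) = (real p - 1) * ((1 / p - \<omega>) * n)"
    using i by (simp add: of_nat_diff)
  moreover have "(real p - 1) * ((1 / p - \<omega>) * n) = (1 - 1 / p - (real p - 1) * \<omega>) * n"
    using pp by (simp add: field_simps)
  ultimately have "card (V i) \<le> n - (1 - 1 / p - (real p - 1) * \<omega>) * n" by linarith
  also have "\<dots> = (1 / p + p * \<omega>) * n - \<omega> * n" by (simp add: algebra_simps)
  also have "\<dots> \<le> (1 / p + p * \<omega>) * n" using w by simp
  finally show "card (V i) \<le> (1 / p + p * \<omega>) * n" .
qed

text \<open>Only the image of \<open>x\<close> is prescribed. The bound \<open>d\<close> varies with
  the pendant vertex, so that those attached to \<open>x\<close> can use the degree of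
  \<open>v\<close> and the others the typical degree.\<close>

lemma through_lower_bound:
  fixes \<tau> \<delta> :: real and d :: "'a \<Rightarrow> real"
  assumes xs: "x \<in> U" and v: "v < n" and T: "\<And>y. y \<in> U \<Longrightarrow> T y \<subseteq> {..<n}" "T x = {v}"
    and big: "\<And>y. y \<in> U - {x} \<Longrightarrow> \<tau> \<le> real (card (T y))"
    and miss: "\<And>z y u. z \<in> U - {x} \<Longrightarrow> F z y \<Longrightarrow> u \<in> T y \<Longrightarrow> real (card {w \<in> T z. \<not> adj c col u w}) \<le> \<delta>"
    and pos: "0 \<le> \<tau> - h * \<delta> - h" "0 \<le> \<delta>"
    and d: "\<And>w. w \<in> W \<Longrightarrow> t \<le> d w"
    and deg: "\<And>w u. w \<in> W \<Longrightarrow> u \<in> T (att w) \<Longrightarrow> d w \<le> real (card (nb c n col u))"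
  shows "(\<tau> - h * \<delta> - h) ^ (h - 1) * (\<Prod>w\<in>W. d w - t) \<le> card {f \<in> mono_copy_set H n c. v \<in> f ` (U \<union> W)}"
proof -
  have "(\<tau> - h * \<delta> - h) ^ (h - card {x}) \<le> card {f \<in> core (adj c col) n. \<forall>x\<in>U. f x \<in> T x}"
    by (rule core_lower[where ?g0.0 = "restrict (\<lambda>_. v) {x}" and X = "{x}"])
      (use xs v T big miss pos symp_adj F(3)[of x x] in auto)
  then have "(\<tau> - h * \<delta> - h) ^ (h - 1) * (\<Prod>w\<in>W. d w - t)
      \<le> card {f \<in> core (adj c col) n. \<forall>x\<in>U. f x \<in> T x} * (\<Prod>w\<in>W. d w - t)"
    using d by (intro mult_right_mono prod_nonneg) auto
  also have "\<dots> \<le> card {f \<in> emb (adj c col) n. \<forall>x\<in>U. f x \<in> T x}"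
    by (rule pendant_extensions) (use d deg in \<open>auto simp: nb_def\<close>)
  also have "\<dots> \<le> card {f \<in> mono_copy_set H n c. v \<in> f ` (U \<union> W)}"
  proof (intro of_nat_mono card_mono)
    show "finite {f \<in> mono_copy_set H n c. v \<in> f ` (U \<union> W)}"
      using finite_mono_copy_set[of H n c] fin by (simp add: verts)
    show "{f \<in> emb (adj c col) n. \<forall>x\<in>U. f x \<in> T x} \<subseteq> {f \<in> mono_copy_set H n c. v \<in> f ` (U \<union> W)}"
      using emb_sub_mono_copy_set[of c col n] T(2) xs by (force simp: image_iff)
  qed
  finally show ?thesis .
qed

text \<open>As \<open>p\<close> is at least 3, the typical \<open>b\<close>-degree (1 - 1/p) n
  clears the threshold \<open>(1 / p + 8 * (h * \<omega>)) * n\<close>, the same one against which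
  an exceptional vertex is tested.\<close>

lemma structure_b_degree:
  fixes \<omega> :: real
  assumes st: "parts_structure c n a b p \<omega> V" and w: "1000 * p * h * \<omega> \<le> 1" "0 < \<omega>" and p3: "p \<ge> 3"
    and ab: "a \<noteq> b" and i: "i < p" and u: "u \<in> V i"
  shows "(1 / p + 8 * (h * \<omega>)) * n \<le> card (nb c n b u)" "(1 / p - 2 * \<omega>) * n \<le> card (nb c n a u)"
proof -
  note sf = structure_facts[OF st w p3]
  have Vn: "V i \<subseteq> {..<n}" and Vc: "(1 / p - \<omega>) * n \<le> card (V i)"
    and na: "real (card {w \<in> V i. \<not> adj c a u w}) \<le> \<omega> * n"
    and nb: "real (card {w \<in> {..<n} - V i. \<not> adj c b u w}) \<le> \<omega> * n"
    using st i u by (auto simp: parts_structure_def)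
  have finV: "finite (V i)" using finite_subset[OF Vn] by auto
  have "card (({..<n} - V i) - {w \<in> {..<n} - V i. \<not> adj c b u w}) \<le> card (nb c n b u)"
    by (intro card_mono) (auto simp: nb_def)
  moreover have "card ({..<n} - V i) - card {w \<in> {..<n} - V i. \<not> adj c b u w}
      \<le> card (({..<n} - V i) - {w \<in> {..<n} - V i. \<not> adj c b u w})" by (intro diff_card_le_card_Diff) auto
  moreover have "card ({..<n} - V i) = n - card (V i)" using Vn finV by (simp add: card_Diff_subset)
  ultimately have "real n - card (V i) - \<omega> * n \<le> card (nb c n b u)" using nb by linarith
  then have 1: "(1 - 1 / p - p * \<omega> - \<omega>) * n \<le> card (nb c n b u)" using sf(1)[OF i] by (simp add: algebra_simps)
  have "1 / real p \<le> 1 / 3" using p3 by (intro divide_left_mono) auto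
  then have "1 / p + 8 * (h * \<omega>) \<le> 1 - 1 / p - p * \<omega> - \<omega>" using sf(3,4,7) by linarith
  then have "(1 / p + 8 * (h * \<omega>)) * n \<le> (1 - 1 / p - p * \<omega> - \<omega>) * n" by (intro mult_right_mono) auto
  then show "(1 / p + 8 * (h * \<omega>)) * n \<le> card (nb c n b u)" using 1 by linarith
  have "card (V i - {w \<in> V i. \<not> adj c a u w}) \<le> card (nb c n a u)"
    using Vn by (intro card_mono) (auto simp: nb_def)
  moreover have "card (V i) - card {w \<in> V i. \<not> adj c a u w} \<le> card (V i - {w \<in> V i. \<not> adj c a u w})"
    using finV by (intro diff_card_le_card_Diff) auto
  ultimately have "real (card (V i)) - \<omega> * n \<le> card (nb c n a u)" using na by linarith
  then show "(1 / p - 2 * \<omega>) * n \<le> card (nb c n a u)" using Vc by (simp add: algebra_simps)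
qed

text \<open>If \<open>v\<close> had many \<open>b\<close>-neighbours in all parts, it could play the end \<open>x0\<close> of the critical edge in
  too many \<open>b\<close>-coloured copies.\<close>

lemma not_b_spread:
  fixes \<omega> :: real
  assumes st: "parts_structure c n a b p \<omega> V" and w: "1000 * p * h * \<omega> \<le> 1" "0 < \<omega>" and p3: "p \<ge> 3"
    and ab: "a \<noteq> b" and v: "v < n"
    and n: "n > 0" "(1 + p / n) ^ t \<le> 2" "t * real p ^ t \<le> n" "2 * t \<le> \<omega> * n"
    and cmin: "mono_copies H n c = min_mono_copies H n" and c: "c \<in> edge_colourings n"
    and G: "(p * (h * \<omega>) / 2) ^ (h - 1) * (1 + 7 * (p * (h * \<omega>))) ^ (t - h) > 4 * real t"
    and deg: "(1 / p + 8 * (h * \<omega>)) * n \<le> card (nb c n b v)"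
  shows "\<exists>i<p. card (nb c n b v \<inter> V i) < 2 * (h * \<omega>) * n"
proof (rule ccontr)
  assume "\<not> ?thesis"
  then have neg: "\<And>i. i < p \<Longrightarrow> 2 * (h * \<omega>) * n \<le> card (nb c n b v \<inter> V i)" by (meson not_less)
  note sf = structure_facts[OF st w p3]
  have pp: "real p \<ge> 3" using p3 by simp
  have Vn: "V i \<subseteq> {..<n}" if "i < p" for i using st that by (auto simp: parts_structure_def)
  have psi: "\<psi> x < p" if "x \<in> U" for x using crit(2) that by auto
  \<comment> \<open>Core edges at \<open>x0\<close> have colour \<open>b\<close> because all
    candidates are \<open>b\<close>-neighbours of \<open>v\<close>; on the remaining core edges
    \<open>\<psi>\<close> is proper, so they run between different parts.\<close>
  define T where "T y = (if y = x0 then {v} else nb c n b v \<inter> V (\<psi> y))" for y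
  define d where "d = (1 / p + 8 * (h * \<omega>)) * n"
  have x0: "x0 \<in> U" using F crit by auto
  have hw: "\<omega> * n \<le> h * \<omega> * n" using sf(7) by (intro mult_right_mono) auto
  have ht: "h \<le> t" by (rule card_W)
  have hn: "real h \<le> h * \<omega> * n / 2" "t \<le> h * \<omega> * n" using hw n(4) ht by auto
  have dt: "n / p * (1 + 7 * (p * (h * \<omega>))) \<le> d - t" using hn pp by (simp add: d_def field_simps)
  have dt0: "0 \<le> n / p * (1 + 7 * (p * (h * \<omega>)))" using w by simp
  have tau: "n / p * (p * (h * \<omega>) / 2) \<le> 2 * (h * \<omega>) * n - h * (\<omega> * n) - h" using hn pp by (simp add: field_simps)
  have tau0: "0 \<le> n / p * (p * (h * \<omega>) / 2)" using w by simp
  have "(2 * (h * \<omega>) * n - h * (\<omega> * n) - h) ^ (h - 1) * (\<Prod>w\<in>W. d - t) \<le> card {f \<in> mono_copy_set H n c. v \<in> f ` (U \<union> W)}"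
  proof (rule through_lower_bound[OF x0 v, where T = T and col = b])
    show "T y \<subseteq> {..<n}" for y using v by (auto simp: T_def nb_def)
    show "T x0 = {v}" by (simp add: T_def)
    show "2 * (h * \<omega>) * n \<le> real (card (T y))" if "y \<in> U - {x0}" for y
      using neg[of "\<psi> y"] psi that by (simp add: T_def)
    show "real (card {q \<in> T z. \<not> adj c b u q}) \<le> \<omega> * n" if z: "z \<in> U - {x0}" "F z y" "u \<in> T y" for z y u
    proof (cases "y = x0")
      case True
      then have "{q \<in> T z. \<not> adj c b u q} = {}" using z by (auto simp: T_def nb_def)
      then show ?thesis using w by (simp only: card.empty) simp
    next
      case False
      have y: "y \<in> U" using F z by auto
      have "{z, y} \<noteq> {x0, y0}" using z False by (auto simp: doubleton_eq_iff)
      then have ne: "\<psi> z \<noteq> \<psi> y" using crit(3)[OF z(2)] by simp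
      have u: "u \<in> V (\<psi> y)" using z False by (auto simp: T_def)
      have "V (\<psi> z) \<inter> V (\<psi> y) = {}" using st ne psi y z by (auto simp: parts_structure_def)
      then have "{q \<in> T z. \<not> adj c b u q} \<subseteq> {q \<in> {..<n} - V (\<psi> y). \<not> adj c b u q}"
        using z Vn[OF psi] by (auto simp: T_def nb_def)
      then have "card {q \<in> T z. \<not> adj c b u q} \<le> card {q \<in> {..<n} - V (\<psi> y). \<not> adj c b u q}" by (intro card_mono) auto
      moreover have "real (card {q \<in> {..<n} - V (\<psi> y). \<not> adj c b u q}) \<le> \<omega> * n"
        using st psi[OF y] u by (auto simp: parts_structure_def)
      ultimately show ?thesis by linarith
    qed
    show "0 \<le> 2 * (h * \<omega>) * n - h * (\<omega> * n) - h" using tau tau0 by linarith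
    show "t \<le> d" using dt dt0 by linarith
    show "d \<le> real (card (nb c n b u))" if "q \<in> W" "u \<in> T (att q)" for q u
    proof (cases "att q = x0")
      case True
      then show ?thesis using that deg by (simp add: T_def d_def)
    next
      case False
      then show ?thesis using that structure_b_degree(1)[OF st w p3 ab psi[OF att[OF that(1)]], of u] by (simp add: T_def d_def)
    qed
  qed (use w in simp)
  also have "\<dots> \<le> 4 * real t * (n / p) ^ (t - 1)" by (rule copies_through_le[OF n(1-3) cmin c v])
  finally have "(2 * (h * \<omega>) * n - h * (\<omega> * n) - h) ^ (h - 1) * (d - t) ^ (t - h) \<le> 4 * real t * (n / p) ^ (t - 1)"
    by (simp add: card_W)
  moreover have "(n / p * (p * (h * \<omega>) / 2)) ^ (h - 1) * (n / p * (1 + 7 * (p * (h * \<omega>)))) ^ (t - h)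
      \<le> (2 * (h * \<omega>) * n - h * (\<omega> * n) - h) ^ (h - 1) * (d - t) ^ (t - h)"
    using tau tau0 dt dt0 by (intro mult_mono power_mono) auto
  ultimately have "(n / p * (p * (h * \<omega>) / 2)) ^ (h - 1) * (n / p * (1 + 7 * (p * (h * \<omega>)))) ^ (t - h) \<le> 4 * real t * (n / p) ^ (t - 1)"
    by linarith
  moreover have "t - 1 = (h - 1) + (t - h)" using h_ge_2 ht by simp
  ultimately have "(n / p) ^ (t - 1) * ((p * (h * \<omega>) / 2) ^ (h - 1) * (1 + 7 * (p * (h * \<omega>))) ^ (t - h)) \<le> (n / p) ^ (t - 1) * (4 * real t)"
    by (simp only: power_mult_distrib power_add) (simp add: mult_ac)
  moreover have "(n / p) ^ (t - 1) > 0" using n(1) pp by simp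
  ultimately show False using G by (simp only: mult_le_cancel_left_pos)
qed

text \<open>Here \<open>v\<close> plays the vertex that carries the most pendant edges, so that its larger degree
  outweighs the small loss at all other vertices.\<close>

lemma low_a_degree:
  fixes \<omega> :: real
  assumes st: "parts_structure c n a b p \<omega> V" and w: "1000 * p * h * \<omega> \<le> 1" "0 < \<omega>" and p3: "p \<ge> 3"
    and ab: "a \<noteq> b" and v: "v < n" and i: "i < p"
    and n: "n > 0" "(1 + p / n) ^ t \<le> 2" "t * real p ^ t \<le> n" "2 * t \<le> \<omega> * n"
    and cmin: "mono_copies H n c = min_mono_copies H n" and c: "c \<in> edge_colourings n"
    and G: "\<And>m. t - h \<le> h * m \<Longrightarrow> (1 + p * (h * \<omega>)) ^ m > real t * 4 ^ h"
    and Vi: "n / (2 * real p) \<le> card (nb c n a v \<inter> V i)"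
  shows "card (nb c n a v) < (1 / p + 8 * (h * \<omega>)) * n"
proof (rule ccontr)
  assume "\<not> ?thesis"
  then have deg: "(1 / p + 8 * (h * \<omega>)) * n \<le> card (nb c n a v)" by simp
  note sf = structure_facts[OF st w p3]
  have pp: "real p \<ge> 3" using p3 by simp
  have Vn: "V i \<subseteq> {..<n}" using st i by (auto simp: parts_structure_def)
  obtain x where x: "x \<in> U" "t - h \<le> h * card {w \<in> W. att w = x}" using ex_heavy_vertex by auto
  define m where "m = card {w \<in> W. att w = x}"
  have mt: "m \<le> t - h" unfolding m_def card_W(1)[symmetric] using fin by (intro card_mono) auto
  define T where "T y = (if y = x then {v} else nb c n a v \<inter> V i)" for y
  \<comment> \<open>After subtracting \<open>t\<close>, which is at most
    \<open>\<omega> * n\<close>, the excess 8 drops to 7 and the deficit 2 grows to 3 in the two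
    relative bounds below.\<close>
  define d where "d q = (if att q = x then (1 / p + 8 * (h * \<omega>)) * n else (1 / p - 2 * \<omega>) * n)" for q
  define y where "y = p * (h * \<omega>)"
  have y0: "0 \<le> y" "y \<le> 1 / 1000" using w sf(5) by (auto simp: y_def)
  have hw: "\<omega> * n \<le> h * \<omega> * n" using sf(7) by (intro mult_right_mono) auto
  have ht: "h \<le> t" by (rule card_W)
  have tn: "t \<le> \<omega> * n" using n(4) by simp
  have dt1: "n / p * (1 + 7 * y) \<le> d q - t" if "att q = x" for q
    using tn hw pp that by (simp add: d_def y_def field_simps)
  have dt2: "n / p * (1 - 3 * (p * \<omega>)) \<le> d q - t" if "att q \<noteq> x" for q
    using tn pp that by (simp add: d_def field_simps)
  have dt10: "0 \<le> n / p * (1 + 7 * y)" using y0 by simp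
  have dt20: "0 \<le> n / p * (1 - 3 * (p * \<omega>))" using sf(3) by simp
  have tau: "n / p * (1 / 4) \<le> n / (2 * real p) - h * (\<omega> * n) - h"
  proof -
    have "real h \<le> t" using ht by simp
    then have "real h \<le> h * \<omega> * n" using tn hw by linarith
    then have "h * (\<omega> * n) + h \<le> 2 * (h * \<omega> * n)" by (simp add: mult_ac)
    also have "\<dots> = n / p * (2 * y)" using pp by (simp add: y_def)
    also have "\<dots> \<le> n / p * (1 / 4)" using y0 by (intro mult_left_mono) auto
    finally show ?thesis by (simp add: field_simps)
  qed
  have tau0: "0 \<le> n / p * (1 / 4)" by simp
  have "(n / (2 * real p) - h * (\<omega> * n) - h) ^ (h - 1) * (\<Prod>q\<in>W. d q - t) \<le> card {f \<in> mono_copy_set H n c. v \<in> f ` (U \<union> W)}"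
  proof (rule through_lower_bound[OF x(1) v, where T = T and col = a])
    show "T y \<subseteq> {..<n}" for y using v by (auto simp: T_def nb_def)
    show "T x = {v}" by (simp add: T_def)
    show "n / (2 * real p) \<le> real (card (T y))" if "y \<in> U - {x}" for y using Vi that by (simp add: T_def)
    show "real (card {q \<in> T z. \<not> adj c a u q}) \<le> \<omega> * n" if z: "z \<in> U - {x}" "F z y" "u \<in> T y" for z y u
    proof (cases "y = x")
      case True
      then have "{q \<in> T z. \<not> adj c a u q} = {}" using z by (auto simp: T_def nb_def)
      then show ?thesis using w by (simp only: card.empty) simp
    next
      case False
      have u: "u \<in> V i" using z False by (auto simp: T_def)
      have "{q \<in> T z. \<not> adj c a u q} \<subseteq> {q \<in> V i. \<not> adj c a u q}" using z by (auto simp: T_def)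
      then have "card {q \<in> T z. \<not> adj c a u q} \<le> card {q \<in> V i. \<not> adj c a u q}"
        using finite_subset[OF Vn] by (intro card_mono) auto
      moreover have "real (card {q \<in> V i. \<not> adj c a u q}) \<le> \<omega> * n"
        using st i u by (auto simp: parts_structure_def)
      ultimately show ?thesis by linarith
    qed
    show "0 \<le> n / (2 * real p) - h * (\<omega> * n) - h" using tau tau0 by linarith
    show "t \<le> d q" for q using dt1 dt2 dt10 dt20 by (cases "att q = x") fastforce+
    show "d q \<le> real (card (nb c n a u))" if "q \<in> W" "u \<in> T (att q)" for q u
    proof (cases "att q = x")
      case True
      then show ?thesis using that deg by (simp add: T_def d_def)
    next
      case False
      then show ?thesis using that structure_b_degree(2)[OF st w p3 ab i, of u] by (simp add: T_def d_def)
    qed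
  qed (use w in simp)
  also have "\<dots> \<le> 4 * real t * (n / p) ^ (t - 1)" by (rule copies_through_le[OF n(1-3) cmin c v])
  finally have up: "(n / (2 * real p) - h * (\<omega> * n) - h) ^ (h - 1) * (\<Prod>q\<in>W. d q - t) \<le> 4 * real t * (n / p) ^ (t - 1)" .
  have "(n / p) ^ (t - h) * (1 + y) ^ m \<le> (\<Prod>q\<in>W. d q - t)"
  proof -
    \<comment> \<open>Each of the \<open>m\<close> heavy pendant edges has to pay for at most
      \<open>h\<close> others. By Bernoulli those \<open>h\<close> losses amount to a factor of at
      least 1 - 3 y, and the gain 1 + 7 y still leaves 1 + y.\<close>
    have "(1 + y) ^ m \<le> ((1 + 7 * y) * (1 - 3 * y)) ^ m"
    proof (rule power_mono)
      have "21 * (y * y) \<le> 21 * (y * (1 / 1000))" using y0 by (intro mult_left_mono) auto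
      then show "1 + y \<le> (1 + 7 * y) * (1 - 3 * y)" using y0 by (simp add: algebra_simps)
    qed (use y0 in auto)
    also have "\<dots> = (1 + 7 * y) ^ m * (1 - 3 * y) ^ m" by (rule power_mult_distrib)
    also have "(1 - 3 * y) ^ m \<le> ((1 - 3 * (p * \<omega>)) ^ h) ^ m"
    proof (rule power_mono)
      have "1 + real h * (- (3 * (p * \<omega>))) \<le> (1 + - (3 * (p * \<omega>))) ^ h"
        using sf(3) by (intro Bernoulli_inequality) auto
      then show "1 - 3 * y \<le> (1 - 3 * (p * \<omega>)) ^ h" by (simp add: y_def mult_ac)
    qed (use y0 in auto)
    also have "((1 - 3 * (p * \<omega>)) ^ h) ^ m = (1 - 3 * (p * \<omega>)) ^ (h * m)" by (simp add: power_mult)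
    also have "\<dots> \<le> (1 - 3 * (p * \<omega>)) ^ (t - h - m)"
      using sf(3) w x(2) by (intro power_decreasing) (auto simp: m_def)
    finally have "(1 + y) ^ m \<le> (1 + 7 * y) ^ m * (1 - 3 * (p * \<omega>)) ^ (t - h - m)"
      using y0 by (simp add: mult_left_mono)
    then have "(n / p) ^ (t - h) * (1 + y) ^ m \<le> (n / p) ^ (t - h) * ((1 + 7 * y) ^ m * (1 - 3 * (p * \<omega>)) ^ (t - h - m))"
      by (intro mult_left_mono) auto
    also have "\<dots> = (n / p * (1 + 7 * y)) ^ m * (n / p * (1 - 3 * (p * \<omega>))) ^ (t - h - m)"
    proof -
      have "(n / p) ^ (t - h) = (n / p) ^ m * (n / p) ^ (t - h - m)" using mt by (metis le_add_diff_inverse power_add)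
      then show ?thesis by (simp only: power_mult_distrib) (simp add: mult_ac)
    qed
    also have "\<dots> = (\<Prod>q\<in>{w \<in> W. att w = x}. n / p * (1 + 7 * y)) * (\<Prod>q\<in>W - {w \<in> W. att w = x}. n / p * (1 - 3 * (p * \<omega>)))"
      using fin card_W by (simp add: m_def card_Diff_subset)
    also have "\<dots> \<le> (\<Prod>q\<in>{w \<in> W. att w = x}. d q - t) * (\<Prod>q\<in>W - {w \<in> W. att w = x}. d q - t)"
    proof -
      have "0 \<le> d q - t" for q
        using order_trans[OF dt10 dt1[of q]] order_trans[OF dt20 dt2[of q]] by blast
      then show ?thesis
        using dt1 dt2 dt10 dt20 by (intro mult_mono prod_mono prod_nonneg) (auto simp del: times_divide_eq_left)
    qed
    also have "\<dots> = (\<Prod>q\<in>W. d q - t)"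
      using fin prod.subset_diff[of "{w \<in> W. att w = x}" W "\<lambda>q. d q - t"] by (auto simp: mult.commute)
    finally show ?thesis .
  qed
  moreover have "(n / p * (1 / 4)) ^ (h - 1) \<le> (n / (2 * real p) - h * (\<omega> * n) - h) ^ (h - 1)"
    using tau tau0 by (intro power_mono) auto
  ultimately have "(n / p * (1 / 4)) ^ (h - 1) * ((n / p) ^ (t - h) * (1 + y) ^ m) \<le> 4 * real t * (n / p) ^ (t - 1)"
    using up tau tau0 y0 by (smt (verit) mult_mono mult_nonneg_nonneg zero_le_power zero_le_divide_iff of_nat_0_le_iff)
  moreover have "t - 1 = (h - 1) + (t - h)" using h_ge_2 ht by simp
  ultimately have "(n / p) ^ (t - 1) * ((1 / 4) ^ (h - 1) * (1 + y) ^ m) \<le> (n / p) ^ (t - 1) * (4 * real t)"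
    by (simp only: power_mult_distrib power_add) (simp add: mult_ac)
  moreover have "(n / p) ^ (t - 1) > 0" using n(1) pp by simp
  ultimately have "(1 / 4) ^ (h - 1) * (1 + y) ^ m \<le> 4 * real t" by (simp only: mult_le_cancel_left_pos)
  then have "(1 + y) ^ m \<le> 4 * real t * 4 ^ (h - 1)" by (simp add: field_simps)
  also have "\<dots> = real t * 4 ^ h" using h_ge_2 by (cases h) auto
  finally show False using G[of m] x(2) by (simp add: m_def y_def)
qed

end

section \<open>Assigning every vertex to a part and excluding wrong edges inside parts\<close>

context pendant_graph
begin

lemma p_less_h: "p + 1 \<le> h"
  using card_image_le[OF fin(1), of \<phi>] phi h by simp

text \<open>Unlike \<open>parts_structure\<close>, every vertex now belongs to a part and satisfies
  the degree conditions, at the price of errors larger by a factor of order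
  \<open>h\<close>.\<close>

definition full_structure :: "(nat set \<Rightarrow> colour) \<Rightarrow> nat \<Rightarrow> colour \<Rightarrow> colour \<Rightarrow> real \<Rightarrow> (nat \<Rightarrow> nat) \<Rightarrow> bool" where
  "full_structure c n a b \<omega> part \<longleftrightarrow> part \<in> {..<n} \<rightarrow> {..<p} \<and>
     (\<forall>i<p. (1 / p - \<omega>) * n \<le> part_size n part i \<and> part_size n part i \<le> (1 / p + real p * \<omega>) * n) \<and>
     (\<forall>v<n. real (card {w \<in> {..<n}. part w = part v \<and> \<not> adj c a v w}) \<le> 12 * (real h * \<omega>) * n \<and>
             real (card {w \<in> {..<n}. part w \<noteq> part v \<and> \<not> adj c b v w}) \<le> 12 * (real h * \<omega>) * n)"

text \<open>Some part contains few \<open>b\<close>-neighbours of \<open>v\<close>, so nearly all of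
  it is joined to \<open>v\<close> in colour \<open>a\<close>. The upper bound on the
  \<open>a\<close>-degree then leaves at most 8 + 4 = 12 units of h \<omega> n for wrong edges to
  the outside.\<close>

lemma vertex_part:
  fixes \<omega> :: real
  assumes st: "parts_structure c n a b p \<omega> V" and w: "1000 * p * h * \<omega> \<le> 1" "0 < \<omega>" and p3: "p \<ge> 3"
    and ab: "a \<noteq> b" and v: "v < n"
    and n: "n > 0" "(1 + p / n) ^ t \<le> 2" "t * real p ^ t \<le> n" "2 * t \<le> \<omega> * n"
    and cmin: "mono_copies H n c = min_mono_copies H n" and c: "c \<in> edge_colourings n"
    and G1: "(p * (h * \<omega>) / 2) ^ (h - 1) * (1 + 7 * (p * (h * \<omega>))) ^ (t - h) > 4 * real t"
    and G2: "\<And>m. t - h \<le> h * m \<Longrightarrow> (1 + p * (h * \<omega>)) ^ m > real t * 4 ^ h"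
  shows "\<exists>i<p. real (card {w \<in> V i. \<not> adj c a v w}) \<le> 3 * (h * \<omega>) * n \<and>
       real (card {w \<in> {..<n} - V i. w \<noteq> v \<and> \<not> adj c b v w}) \<le> 12 * (h * \<omega>) * n"
proof -
  note sf = structure_facts[OF st w p3]
  have lowa: "card (nb c n a v) < (1 / p + 8 * (h * \<omega>)) * n"
    if "i < p" "n / (2 * real p) \<le> card (nb c n a v \<inter> V i)" for i
    by (rule low_a_degree[OF st w p3 ab v that(1) n cmin c _ that(2)]) (rule G2)
  note nbs = not_b_spread[OF st w p3 ab v n cmin c G1]
  have pp: "real p \<ge> 3" using p3 by simp
  have t2: "real t \<ge> 2" using h_ge_2 card_W by linarith
  have hwn: "2 \<le> h * \<omega> * n"
  proof -
    have "\<omega> * n \<le> h * \<omega> * n" using sf(7) by (intro mult_right_mono) auto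
    then show ?thesis using n(4) t2 by linarith
  qed
  have p13: "1 / real p \<le> 1 / 3" using p3 by (intro divide_left_mono) auto
  have Vn: "V i \<subseteq> {..<n}" and Vc: "(1 / p - \<omega>) * n \<le> card (V i)" if "i < p" for i
    using st that by (auto simp: parts_structure_def)
  have finV: "finite (V i)" if "i < p" for i using finite_subset[OF Vn[OF that]] by auto
  have degs: "card (nb c n a v) + card (nb c n b v) = n - 1"
    using card_two_colours[OF ab, of "{..<n}" c v] v by (simp add: nb_def)
  have hwn1: "h * \<omega> * n \<le> n / 1000" using mult_right_mono[OF sf(4), of n] by simp
  have pwn1: "p * \<omega> * n \<le> n / 1000" using mult_right_mono[OF sf(3), of n] by simp
  \<comment> \<open>Otherwise more than half of all vertices would be \<open>a\<close>-neighbours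
    inside parts; then one part contains n/(2p) of them and \<open>low_a_degree\<close> bounds the
    \<open>a\<close>-degree, a contradiction.\<close>
  have degb: "(1 / p + 8 * (h * \<omega>)) * n \<le> card (nb c n b v)"
  proof (rule ccontr)
    assume "\<not> ?thesis"
    then have da: "real n - 1 - (1 / p + 8 * (h * \<omega>)) * n < card (nb c n a v)" using degs v by linarith
    have 3: "(1 / p) * n \<le> n / 3" using mult_right_mono[OF p13, of n] by simp
    have "nb c n a v \<subseteq> (\<Union>i<p. nb c n a v \<inter> V i) \<union> ({..<n} - (\<Union>i<p. V i))" by (auto simp: nb_def)
    then have "card (nb c n a v) \<le> card ((\<Union>i<p. nb c n a v \<inter> V i) \<union> ({..<n} - (\<Union>i<p. V i)))"
      by (intro card_mono) auto
    also have "\<dots> \<le> card (\<Union>i<p. nb c n a v \<inter> V i) + card ({..<n} - (\<Union>i<p. V i))" by (rule card_Un_le)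
    also have "card (\<Union>i<p. nb c n a v \<inter> V i) \<le> (\<Sum>i<p. card (nb c n a v \<inter> V i))" by (rule card_UN_le) auto
    finally have 1: "real (card (nb c n a v)) \<le> (\<Sum>i<p. real (card (nb c n a v \<inter> V i))) + card ({..<n} - (\<Union>i<p. V i))"
      by (simp flip: of_nat_sum of_nat_add)
    have "(\<Union>i<p. V i) \<subseteq> {..<n}" using Vn by auto
    then have "card ({..<n} - (\<Union>i<p. V i)) = n - card (\<Union>i<p. V i)" "card (\<Union>i<p. V i) \<le> n"
      using card_mono[of "{..<n}" "\<Union>i<p. V i"] by (auto simp: card_Diff_subset finite_subset)
    then have 2: "real (card ({..<n} - (\<Union>i<p. V i))) \<le> p * \<omega> * n" using sf(2) by linarith
    have big: "n / 2 \<le> (\<Sum>i<p. real (card (nb c n a v \<inter> V i)))"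
    proof -
      have "(1 / p + 8 * (h * \<omega>)) * n = 1 / p * n + 8 * (h * \<omega> * n)" by (simp add: algebra_simps)
      then show ?thesis using da 1 2 3 hwn1 pwn1 hwn by linarith
    qed
    have "\<exists>i<p. n / (2 * real p) \<le> card (nb c n a v \<inter> V i)"
    proof (rule ccontr)
      assume neg: "\<not> ?thesis"
      have "(\<Sum>i<p. real (card (nb c n a v \<inter> V i))) < (\<Sum>i<p. n / (2 * real p))"
        using neg p3 by (intro sum_strict_mono) (auto simp: not_le lessThan_empty_iff)
      also have "\<dots> = n / 2" using pp by simp
      finally show False using big by simp
    qed
    then obtain i where "i < p" "n / (2 * real p) \<le> card (nb c n a v \<inter> V i)" by auto
    from lowa[OF this] have "real (card (nb c n a v)) < (1 / p + 8 * (h * \<omega>)) * n" .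
    then show False using da 3 hwn1 hwn by (simp add: algebra_simps)
  qed
  obtain i where i: "i < p" "card (nb c n b v \<inter> V i) < 2 * (h * \<omega>) * n" using nbs[OF degb] by auto
  define A where "A = {w \<in> V i. \<not> adj c a v w}"
  have "A \<subseteq> insert v (nb c n b v \<inter> V i)" using Vn[OF i(1)] adj_other[OF ab, of v _ c] by (auto simp: A_def nb_def)
  then have "card A \<le> card (insert v (nb c n b v \<inter> V i))" by (intro card_mono) auto
  also have "\<dots> \<le> card (nb c n b v \<inter> V i) + 1" by (simp add: card_insert_if)
  finally have A: "card A \<le> 2 * (h * \<omega>) * n + 1" using i(2) by linarith
  have "card (V i - A) \<le> card (nb c n a v \<inter> V i)" using Vn[OF i(1)] by (intro card_mono) (auto simp: A_def nb_def)
  moreover have "card (V i) - card A \<le> card (V i - A)" using finV[OF i(1)] by (intro diff_card_le_card_Diff) (auto simp: A_def)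
  ultimately have naV: "(1 / p - \<omega>) * n - 2 * (h * \<omega>) * n - 1 \<le> card (nb c n a v \<inter> V i)" using A Vc[OF i(1)] by linarith
  have "\<omega> * n \<le> h * \<omega> * n" using sf(7) by (intro mult_right_mono) auto
  then have naV': "n / p - 4 * (h * \<omega> * n) \<le> card (nb c n a v \<inter> V i)" using naV hwn by (simp add: algebra_simps)
  have "n / (2 * real p) \<le> card (nb c n a v \<inter> V i)"
  proof -
    have "p * (4 * (h * \<omega> * n)) \<le> n / 2" using mult_right_mono[OF sf(5), of n] by simp
    then have "4 * (h * \<omega> * n) \<le> n / 2 / p" using pp by (simp add: pos_le_divide_eq mult.commute)
    then show ?thesis using naV' by simp
  qed
  from lowa[OF i(1) this] have da: "card (nb c n a v) < (1 / p + 8 * (h * \<omega>)) * n" .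
  have "{w \<in> {..<n} - V i. w \<noteq> v \<and> \<not> adj c b v w} \<subseteq> nb c n a v - V i"
    using adj_other[OF ab, of v _ c] by (auto simp: nb_def)
  then have "card {w \<in> {..<n} - V i. w \<noteq> v \<and> \<not> adj c b v w} \<le> card (nb c n a v - V i)" by (intro card_mono) auto
  moreover have "card (nb c n a v - V i) + card (nb c n a v \<inter> V i) = card (nb c n a v)"
    using card_Int_Diff[of "nb c n a v" "V i"] by simp
  ultimately have "card {w \<in> {..<n} - V i. w \<noteq> v \<and> \<not> adj c b v w} \<le> (1 / p + 8 * (h * \<omega>)) * n - (n / p - 4 * (h * \<omega> * n))"
    using da naV' by linarith
  then have "card {w \<in> {..<n} - V i. w \<noteq> v \<and> \<not> adj c b v w} \<le> 12 * (h * \<omega>) * n" by (simp add: algebra_simps)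
  moreover have "card A \<le> 3 * (h * \<omega>) * n" using A hwn by (simp add: algebra_simps)
  ultimately show ?thesis using i(1) unfolding A_def by blast
qed

text \<open>At most p \<omega> n vertices lie outside the cores, and \<open>p\<close> is at most
  \<open>h\<close>; adding them to the parts raises the inner error from 3 to 4 units of h \<omega>
  n.\<close>

lemma full_structure_exists:
  fixes \<omega> :: real
  assumes st: "parts_structure c n a b p \<omega> V" and w: "1000 * p * h * \<omega> \<le> 1" "0 < \<omega>" and p3: "p \<ge> 3"
    and ab: "a \<noteq> b"
    and n: "n > 0" "(1 + p / n) ^ t \<le> 2" "t * real p ^ t \<le> n" "2 * t \<le> \<omega> * n"
    and cmin: "mono_copies H n c = min_mono_copies H n" and c: "c \<in> edge_colourings n"
    and G1: "(p * (h * \<omega>) / 2) ^ (h - 1) * (1 + 7 * (p * (h * \<omega>))) ^ (t - h) > 4 * real t"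
    and G2: "\<And>m. t - h \<le> h * m \<Longrightarrow> (1 + p * (h * \<omega>)) ^ m > real t * 4 ^ h"
  obtains part where "full_structure c n a b \<omega> part"
proof -
  note sf = structure_facts[OF st w p3]
  have pp: "real p \<ge> 3" using p3 by simp
  have Vn: "V i \<subseteq> {..<n}" and Vc: "(1 / p - \<omega>) * n \<le> card (V i)" if "i < p" for i
    using st that by (auto simp: parts_structure_def)
  have disj: "V i \<inter> V j = {}" if "i < p" "j < p" "i \<noteq> j" for i j
    using st that by (auto simp: parts_structure_def)
  define good where "good v i \<longleftrightarrow> i < p \<and> real (card {w \<in> V i. \<not> adj c a v w}) \<le> 3 * (h * \<omega>) * n \<and>
       real (card {w \<in> {..<n} - V i. w \<noteq> v \<and> \<not> adj c b v w}) \<le> 12 * (h * \<omega>) * n" for v i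
  have ex: "\<exists>i. good v i" if "v < n" for v
    using vertex_part[OF st w p3 ab that n cmin c G1 G2] unfolding good_def by blast
  have wh: "\<omega> * n \<le> h * \<omega> * n" using sf(7) by (intro mult_right_mono) auto
  have hw0: "0 \<le> h * \<omega> * n" using w by simp
  have goodV: "good v i" if "i < p" "v \<in> V i" for v i
  proof -
    have 1: "real (card {w \<in> V i. \<not> adj c a v w}) \<le> \<omega> * n" "real (card {w \<in> {..<n} - V i. \<not> adj c b v w}) \<le> \<omega> * n"
      using st that by (auto simp: parts_structure_def)
    have "card {w \<in> {..<n} - V i. w \<noteq> v \<and> \<not> adj c b v w} \<le> card {w \<in> {..<n} - V i. \<not> adj c b v w}"
      by (intro card_mono) auto
    then show ?thesis using 1 wh hw0 that unfolding good_def by auto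
  qed
  \<comment> \<open>Vertices of a core keep their index, which is unique by disjointness; only
    leftovers choose an arbitrary good one.\<close>
  define part where "part v = (if \<exists>i<p. v \<in> V i then THE i. i < p \<and> v \<in> V i else SOME i. good v i)" for v
  have partV: "part v = i" if "i < p" "v \<in> V i" for v i
  proof -
    have "(THE i. i < p \<and> v \<in> V i) = i" using that disj by (intro the_equality) blast+
    then show ?thesis using that by (auto simp: part_def)
  qed
  have gp: "good v (part v)" if "v < n" for v
  proof (cases "\<exists>i<p. v \<in> V i")
    case True
    then show ?thesis using goodV partV by blast
  next
    case False
    then have "part v = (SOME i. good v i)" unfolding part_def by (rule if_not_P)
    then show ?thesis using someI_ex[OF ex[OF that]] by simp
  qed
  have partp: "part \<in> {..<n} \<rightarrow> {..<p}" using gp by (auto simp: good_def)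
  define R where "R = {..<n} - (\<Union>i<p. V i)"
  have "(\<Union>i<p. V i) \<subseteq> {..<n}" using Vn by auto
  then have "card R = n - card (\<Union>i<p. V i)" "card (\<Union>i<p. V i) \<le> n"
    using card_mono[of "{..<n}" "\<Union>i<p. V i"] by (auto simp: R_def card_Diff_subset finite_subset)
  then have "real (card R) \<le> p * \<omega> * n" using sf(2) by linarith
  also have "\<dots> \<le> h * \<omega> * n" using p_less_h w by (intro mult_right_mono) auto
  finally have R: "real (card R) \<le> h * \<omega> * n" .
  have lowsize: "(1 / p - \<omega>) * n \<le> part_size n part i" if "i < p" for i
  proof -
    have "card (V i) \<le> part_size n part i" unfolding part_size_def
      using Vn[OF that] partV[OF that] by (intro card_mono) auto
    then show ?thesis using Vc[OF that] by linarith
  qed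
  have "full_structure c n a b \<omega> part"
    unfolding full_structure_def
  proof (intro conjI allI impI partp lowsize)
    fix i assume i: "i < p"
    have "real n = part_size n part i + (\<Sum>j\<in>{..<p} - {i}. real (part_size n part j))"
      using sum_part_size[OF partp] i by (subst sum.remove[of "{..<p}" i, symmetric]) (auto simp flip: of_nat_sum)
    moreover have "(\<Sum>j\<in>{..<p} - {i}. (1 / p - \<omega>) * n) \<le> (\<Sum>j\<in>{..<p} - {i}. real (part_size n part j))"
      using lowsize by (intro sum_mono) auto
    moreover have "(\<Sum>j\<in>{..<p} - {i}. (1 / p - \<omega>) * n) = (real p - 1) * ((1 / p - \<omega>) * n)"
      using i by (simp add: of_nat_diff)
    moreover have "(real p - 1) * ((1 / p - \<omega>) * n) = (1 - 1 / p - (real p - 1) * \<omega>) * n"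
      using pp by (simp add: field_simps)
    ultimately have "part_size n part i \<le> n - (1 - 1 / p - (real p - 1) * \<omega>) * n" by linarith
    also have "\<dots> = (1 / p + p * \<omega>) * n - \<omega> * n" by (simp add: algebra_simps)
    also have "\<dots> \<le> (1 / p + p * \<omega>) * n" using w by simp
    finally show "part_size n part i \<le> (1 / p + p * \<omega>) * n" .
  next
    fix v assume v: "v < n"
    have g: "part v < p" "real (card {w \<in> V (part v). \<not> adj c a v w}) \<le> 3 * (h * \<omega>) * n"
       "real (card {w \<in> {..<n} - V (part v). w \<noteq> v \<and> \<not> adj c b v w}) \<le> 12 * (h * \<omega>) * n"
      using gp[OF v] by (auto simp: good_def)
    have "{w \<in> {..<n}. part w = part v \<and> \<not> adj c a v w} \<subseteq> {w \<in> V (part v). \<not> adj c a v w} \<union> R"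
      using partV by (auto simp: R_def)
    then have "card {w \<in> {..<n}. part w = part v \<and> \<not> adj c a v w} \<le> card ({w \<in> V (part v). \<not> adj c a v w} \<union> R)"
      using finite_subset[OF Vn[OF g(1)]] by (intro card_mono) (auto simp: R_def)
    also have "\<dots> \<le> card {w \<in> V (part v). \<not> adj c a v w} + card R" by (rule card_Un_le)
    finally show "real (card {w \<in> {..<n}. part w = part v \<and> \<not> adj c a v w}) \<le> 12 * (h * \<omega>) * n"
      using g(2) R hw0 by (simp add: algebra_simps)
    have "{w \<in> {..<n}. part w \<noteq> part v \<and> \<not> adj c b v w} \<subseteq> {w \<in> {..<n} - V (part v). w \<noteq> v \<and> \<not> adj c b v w}"
      using partV[OF g(1)] by auto
    then have "card {w \<in> {..<n}. part w \<noteq> part v \<and> \<not> adj c b v w} \<le> card {w \<in> {..<n} - V (part v). w \<noteq> v \<and> \<not> adj c b v w}"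
      by (intro card_mono) auto
    then show "real (card {w \<in> {..<n}. part w \<noteq> part v \<and> \<not> adj c b v w}) \<le> 12 * (h * \<omega>) * n"
      using g(3) by linarith
  qed
  then show thesis by (rule that)
qed

text \<open>Otherwise \<open>\<psi>\<close> would be a proper \<open>p\<close>-colouring of the
  whole core. The equality allows both ends of the critical edge to be placed in one part.\<close>

lemma psi_crit: "\<psi> x0 = \<psi> y0"
proof -
  obtain x y where xy: "F x y" "\<psi> x = \<psi> y" using not_colourable[OF crit(2)] by blast
  then have "{x, y} = {x0, y0}" using crit(3) by blast
  then show ?thesis using xy by (auto simp: doubleton_eq_iff)
qed

text \<open>Recolouring such an edge would destroy all the copies in which it is the critical edge, where
  the other degrees are about \<open>(1 - 1 / p) n\<close>, and create only copies with degrees about \<open>n / p\<close>.\<close>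

lemma no_b_edge_inside:
  fixes \<omega> :: real
  assumes fs: "full_structure c n a b \<omega> part" and w: "1000 * p * h ^ 2 * \<omega> \<le> 1" "0 < \<omega>" and p3: "p \<ge> 3"
    and ab: "a \<noteq> b" and n: "n > 0" "100 * real t * p \<le> n"
    and cmin: "mono_copies H n c = min_mono_copies H n" and c: "c \<in> edge_colourings n"
    and G3: "(11 / 8) ^ (t - h - 1) > 2 * (real h ^ 2 + 2 * t) * (2 * real p) ^ h" and th: "h < t"
    and uv: "u < n" "v < n" "u \<noteq> v" "part u = part v"
  shows "c {u, v} = a"
proof (rule ccontr)
  assume "c {u, v} \<noteq> a"
  then have cb: "c {u, v} = b" using colour_cases[OF ab] by auto
  have pp: "real p \<ge> 3" using p3 by simp
  have p13: "1 / real p \<le> 1 / 3" using p3 by (intro divide_left_mono) auto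
  have hh: "real h \<ge> 2" using h_ge_2 by simp
  have n0: "real n > 0" using n by simp
  have part: "part \<in> {..<n} \<rightarrow> {..<p}" and size: "\<And>i. i < p \<Longrightarrow> (1 / p - \<omega>) * n \<le> part_size n part i"
      "\<And>i. i < p \<Longrightarrow> part_size n part i \<le> (1 / p + p * \<omega>) * n"
    and na: "\<And>v. v < n \<Longrightarrow> real (card {w \<in> {..<n}. part w = part v \<and> \<not> adj c a v w}) \<le> 12 * (h * \<omega>) * n"
    and nb: "\<And>v. v < n \<Longrightarrow> real (card {w \<in> {..<n}. part w \<noteq> part v \<and> \<not> adj c b v w}) \<le> 12 * (h * \<omega>) * n"
    using fs by (auto simp: full_structure_def)
  have pt: "part q < p" if "q < n" for q using part that by auto
  have hhw: "p * (h * (h * \<omega>)) \<le> 1 / 1000" using w by (simp add: power2_eq_square mult_ac)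
  have "p * (1 * (h * \<omega>)) \<le> p * (h * (h * \<omega>))" using hh w pp by (intro mult_left_mono mult_right_mono) auto
  then have phw: "p * (h * \<omega>) \<le> 1 / 1000" using hhw by simp
  have "p * (1 * \<omega>) \<le> p * (h * \<omega>)" using hh w pp by (intro mult_left_mono mult_right_mono) auto
  then have pw: "p * \<omega> \<le> 1 / 1000" using phw by simp
  have "3 * (h * \<omega>) \<le> p * (h * \<omega>)" using pp w by (intro mult_right_mono) auto
  then have hw: "h * \<omega> \<le> 1 / 3000" using phw by simp
  have hwn: "h * \<omega> * n \<le> n / 3000" and pwn: "p * \<omega> * n \<le> n / 1000" and p13n: "1 / p * n \<le> n / 3"
    using mult_right_mono[OF hw, of n] mult_right_mono[OF pw, of n] mult_right_mono[OF p13, of n] by auto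
  have tn: "300 * real t \<le> n" using n(2) pp mult_left_mono[of 3 "real p" "100 * real t"] by linarith
  have t2: "real t \<ge> 2" using hh th by simp
  have szn: "part_size n part i \<le> 11 / 30 * n" if "i < p" for i
    using size(2)[OF that] pwn p13n by (simp add: algebra_simps)
  define c' where "c' = c({u, v} := a)"
  have uvn: "{u, v} \<in> nsets {..<n} 2" using uv by (simp add: nsets_def)
  have c': "c' \<in> edge_colourings n"
    using c uvn by (auto simp: c'_def edge_colourings_def PiE_def extensional_def)
  have adj': "adj c' col x y \<longleftrightarrow> (if {x, y} = {u, v} then x \<noteq> y \<and> col = a else adj c col x y)" for col x y
    by (auto simp: adj_def c'_def)
  have bset: "emb (adj c' b) n \<union> {f \<in> emb (adj c b) n. uses_edge f u v} \<subseteq> emb (adj c b) n"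
    using ab by (auto simp: emb_def adj' split: if_splits)
  have dis: "emb (adj c' b) n \<inter> {f \<in> emb (adj c b) n. uses_edge f u v} = {}"
    using ab by (auto simp: emb_def adj' uses_edge_def insert_commute)
  have "card (emb (adj c' b) n) + card {f \<in> emb (adj c b) n. uses_edge f u v} \<le> card (emb (adj c b) n)"
    using card_mono[OF finite_emb bset] dis finite_emb by (subst card_Un_disjoint[symmetric]) auto
  moreover have "emb (adj c' a) n \<subseteq> emb (adj c a) n \<union> {f \<in> emb (adj c' a) n. uses_edge f u v}"
  proof
    fix f assume f: "f \<in> emb (adj c' a) n"
    show "f \<in> emb (adj c a) n \<union> {f \<in> emb (adj c' a) n. uses_edge f u v}"
    proof (cases "uses_edge f u v")
      case True
      then show ?thesis using f by simp
    next
      case False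
      have "adj c a (f x) (f y)" if "F x y" for x y
      proof -
        have "adj c' a (f x) (f y)" using f that by (auto simp: emb_def)
        moreover have "{f x, f y} \<noteq> {u, v}" using False that F(4) by (auto simp: uses_edge_def doubleton_eq_iff)
        ultimately show ?thesis by (simp add: adj')
      qed
      moreover have "adj c a (f (att q)) (f q)" if "q \<in> W" for q
      proof -
        have "adj c' a (f (att q)) (f q)" using f that by (auto simp: emb_def)
        moreover have "{f (att q), f q} \<noteq> {u, v}" using False that by (auto simp: uses_edge_def doubleton_eq_iff)
        ultimately show ?thesis by (simp add: adj')
      qed
      ultimately show ?thesis using f by (simp add: emb_def)
    qed
  qed
  then have "card (emb (adj c' a) n) \<le> card (emb (adj c a) n \<union> {f \<in> emb (adj c' a) n. uses_edge f u v})"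
    by (intro card_mono) (auto simp: finite_emb)
  then have "card (emb (adj c' a) n) \<le> card (emb (adj c a) n) + card {f \<in> emb (adj c' a) n. uses_edge f u v}"
    using card_Un_le le_trans by blast
  moreover have "mono_copies H n c \<le> mono_copies H n c'" using cmin min_mono_copies_le[OF c', of H] by simp
  ultimately have cmp: "card {f \<in> emb (adj c b) n. uses_edge f u v} \<le> card {f \<in> emb (adj c' a) n. uses_edge f u v}"
    unfolding mono_copies_emb'[OF ab] by linarith

  \<comment> \<open>A part holds at most 11/30 of the vertices, and the wrong edges and the
    recoloured edge add little, so 2/5 bounds every \<open>a\<close>-degree after
    recolouring.\<close>
  define D where "D = 2 * n div 5"
  have Dn: "1 \<le> D" "D \<le> n" using tn t2 by (auto simp: D_def)
  have "card {q \<in> {..<n}. adj c' a z q} \<le> D" if "z < n" for z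
  proof -
    have "{q \<in> {..<n}. adj c' a z q} \<subseteq> {q \<in> {..<n}. part q = part z} \<union> {w \<in> {..<n}. part w \<noteq> part z \<and> \<not> adj c b z w} \<union> {u, v}"
      using ab adj_excl[OF ab] by (auto simp: adj' doubleton_eq_iff split: if_splits)
    then have "card {q \<in> {..<n}. adj c' a z q} \<le> card ({q \<in> {..<n}. part q = part z} \<union> {w \<in> {..<n}. part w \<noteq> part z \<and> \<not> adj c b z w} \<union> {u, v})"
      by (intro card_mono) auto
    also have "\<dots> \<le> card {q \<in> {..<n}. part q = part z} + card {w \<in> {..<n}. part w \<noteq> part z \<and> \<not> adj c b z w} + card {u, v}"
      by (meson add_le_mono card_Un_le le_refl le_trans)
    finally have "real (card {q \<in> {..<n}. adj c' a z q}) \<le> part_size n part (part z) + 12 * (h * \<omega>) * n + 2"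
      using nb[OF that] uv(3) by (simp add: part_size_def)
    also have "\<dots> \<le> 2 * real n / 5 - 1"
    proof -
      have "12 * (h * \<omega>) * n = 12 * (h * \<omega> * n)" by simp
      then show ?thesis using szn[OF pt[OF that]] hwn tn t2 by linarith
    qed
    finally show ?thesis unfolding D_def by linarith
  qed
  note Dd = this
  have "card {f \<in> emb (adj c' a) n. uses_edge f u v} \<le> (h ^ 2 + 2 * t) * (n ^ (h - 1) * D ^ (t - h - 1))"
    by (rule edge_copies_upper[OF Dd Dn uv(1,2)])
  then have "real (card {f \<in> emb (adj c' a) n. uses_edge f u v}) \<le> real ((h ^ 2 + 2 * t) * (n ^ (h - 1) * D ^ (t - h - 1)))"
    by (rule of_nat_mono)
  also have "\<dots> = (real h ^ 2 + 2 * t) * (real n ^ (h - 1) * real D ^ (t - h - 1))" by simp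
  also have "\<dots> \<le> (real h ^ 2 + 2 * t) * (real n ^ (h - 1) * (2 * real n / 5) ^ (t - h - 1))"
  proof -
    have "real D \<le> 2 * real n / 5" unfolding D_def using of_nat_div_le_of_nat[of "2 * n" 5] by (simp add: divide_simps)
    then show ?thesis by (intro mult_left_mono power_mono) auto
  qed
  finally have up: "real (card {f \<in> emb (adj c' a) n. uses_edge f u v}) \<le> (real h ^ 2 + 2 * t) * (real n ^ (h - 1) * (2 * real n / 5) ^ (t - h - 1))" .

  \<comment> \<open>Permutes the colours so that the class of \<open>x0\<close> and
    \<open>y0\<close> is sent to the part containing \<open>u\<close> and \<open>v\<close>.\<close>
  define \<theta> where "\<theta> = transpose (\<psi> x0) (part u)"
  define T where "T z = (if z = x0 then {u} else if z = y0 then {v} else {q \<in> {..<n}. part q = \<theta> (\<psi> z)})" for z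
  have xy: "x0 \<in> U" "y0 \<in> U" "x0 \<noteq> y0" using F crit by auto
  have psi: "\<psi> z < p" if "z \<in> U" for z using crit(2) that by auto
  have th_p: "\<theta> (\<psi> z) < p" if "z \<in> U" for z
    using psi[OF that] psi[OF xy(1)] pt[OF uv(1)] by (auto simp: \<theta>_def transpose_def)
  have inj_th: "\<theta> i = \<theta> j \<longleftrightarrow> i = j" for i j by (metis \<theta>_def transpose_involutory)
  have partT: "part q = \<theta> (\<psi> z)" "q < n" if "z \<in> U" "q \<in> T z" for z q
    using that uv psi_crit by (auto simp: T_def \<theta>_def split: if_splits)
  have degb: "3 / 5 * n \<le> real (card (nb c n b q))" if "q < n" for q
  proof -
    have "{..<n} \<subseteq> nb c n b q \<union> {w \<in> {..<n}. part w = part q} \<union> {w \<in> {..<n}. part w \<noteq> part q \<and> \<not> adj c b q w}"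
      by (auto simp: nb_def)
    then have "card {..<n} \<le> card (nb c n b q \<union> {w \<in> {..<n}. part w = part q} \<union> {w \<in> {..<n}. part w \<noteq> part q \<and> \<not> adj c b q w})"
      by (intro card_mono) auto
    also have "\<dots> \<le> card (nb c n b q) + card {w \<in> {..<n}. part w = part q} + card {w \<in> {..<n}. part w \<noteq> part q \<and> \<not> adj c b q w}"
      by (meson add_le_mono card_Un_le le_refl le_trans)
    finally have "real n \<le> real (card (nb c n b q)) + part_size n part (part q) + 12 * (h * \<omega>) * n"
      using nb[OF that] by (simp add: part_size_def)
    then show ?thesis using szn[OF pt[OF that]] hwn by (simp add: algebra_simps)
  qed
  \<comment> \<open>Up to \<open>h\<close> earlier neighbours each exclude 12 h \<omega> n
    candidates; this total is the reason for \<open>h ^ 2\<close> in the bound on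
    \<open>\<omega>\<close>.\<close>
  have tau: "n * (1 / (2 * real p)) \<le> (1 / p - \<omega>) * n - h * (12 * (h * \<omega>) * n) - h"
  proof -
    have "p * (h * (h * \<omega>)) * n \<le> n / 1000" "p * \<omega> * n \<le> n / 1000"
      using mult_right_mono[OF hhw, of n] pwn by auto
    moreover have "real p * h \<le> n / 100"
    proof -
      have "real h * p \<le> real t * p" using th by (intro mult_right_mono) auto
      then show ?thesis using n(2) by (simp add: mult.commute)
    qed
    ultimately have "n * (1 / 2) \<le> n - p * \<omega> * n - 12 * (p * (h * (h * \<omega>)) * n) - real p * real h" by linarith
    from divide_right_mono[OF this, of p] show ?thesis using pp by (simp add: field_simps)
  qed
  have tau0: "0 \<le> n * (1 / (2 * real p))" by simp
  have cX: "card {x0, y0} = 2" using xy by simp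
  have "((1 / p - \<omega>) * n - h * (12 * (h * \<omega>) * n) - h) ^ (h - card {x0, y0}) \<le> card {f \<in> core (adj c b) n. \<forall>x\<in>U. f x \<in> T x}"
  proof (rule core_lower[OF symp_adj, where ?g0.0 = "restrict (\<lambda>z. if z = x0 then u else v) {x0, y0}"])
    show "T z \<subseteq> {..<n}" if "z \<in> U" for z using partT[OF that] by auto
    show "restrict (\<lambda>z. if z = x0 then u else v) {x0, y0} \<in> {x0, y0} \<rightarrow>\<^sub>E {..<n}" using uv by auto
    show "inj_on (restrict (\<lambda>z. if z = x0 then u else v) {x0, y0}) {x0, y0}" using uv xy by (auto simp: inj_on_def)
    show "(1 / p - \<omega>) * n \<le> real (card (T z))" if "z \<in> U - {x0, y0}" for z
      using that size(1)[OF th_p] by (auto simp: T_def part_size_def)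
    fix z y q assume z: "z \<in> U - {x0, y0}" "F z y" "q \<in> T y"
    have y: "y \<in> U" using F z by auto
    have "{z, y} \<noteq> {x0, y0}" using z by (auto simp: doubleton_eq_iff)
    then have "\<theta> (\<psi> z) \<noteq> \<theta> (\<psi> y)" using crit(3)[OF z(2)] inj_th by simp
    then have "{w \<in> T z. \<not> adj c b q w} \<subseteq> {w \<in> {..<n}. part w \<noteq> part q \<and> \<not> adj c b q w}"
      using partT[OF y z(3)] z(1) by (auto simp: T_def)
    then have "card {w \<in> T z. \<not> adj c b q w} \<le> card {w \<in> {..<n}. part w \<noteq> part q \<and> \<not> adj c b q w}"
      by (intro card_mono) auto
    then show "real (card {w \<in> T z. \<not> adj c b q w}) \<le> 12 * (h * \<omega>) * n" using nb[OF partT(2)[OF y z(3)]] by linarith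
  next
    show "0 \<le> (1 / p - \<omega>) * n - h * (12 * (h * \<omega>) * n) - h" using tau tau0 by linarith
  next
    fix x y assume "x \<in> {x0, y0}" "y \<in> {x0, y0}" "F x y"
    then show "adj c b (restrict (\<lambda>z. if z = x0 then u else v) {x0, y0} x) (restrict (\<lambda>z. if z = x0 then u else v) {x0, y0} y)"
      using uv cb F(3) by (auto simp: adj_def insert_commute)
  qed (use xy w in \<open>auto simp: T_def\<close>)
  moreover have "(n * (1 / (2 * real p))) ^ (h - 2) \<le> ((1 / p - \<omega>) * n - h * (12 * (h * \<omega>) * n) - h) ^ (h - 2)"
    using tau tau0 by (intro power_mono) auto
  ultimately have core: "(n * (1 / (2 * real p))) ^ (h - 2) \<le> card {f \<in> core (adj c b) n. \<forall>x\<in>U. f x \<in> T x}"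
    unfolding cX by linarith
  have "real (card {f \<in> core (adj c b) n. \<forall>x\<in>U. f x \<in> T x}) * (\<Prod>q\<in>W. 3 / 5 * n - t) \<le> card {f \<in> emb (adj c b) n. \<forall>x\<in>U. f x \<in> T x}"
    by (rule pendant_extensions) (use tn degb partT(2) att in \<open>auto simp: nb_def\<close>)
  also have "\<dots> \<le> card {f \<in> emb (adj c b) n. uses_edge f u v}"
  proof (intro of_nat_mono card_mono)
    show "finite {f \<in> emb (adj c b) n. uses_edge f u v}" using finite_emb by simp
    show "{f \<in> emb (adj c b) n. \<forall>x\<in>U. f x \<in> T x} \<subseteq> {f \<in> emb (adj c b) n. uses_edge f u v}"
      using xy crit(1) by (fastforce simp: uses_edge_def T_def)
  qed
  finally have low: "real (card {f \<in> core (adj c b) n. \<forall>x\<in>U. f x \<in> T x}) * (3 / 5 * n - t) ^ (t - h) \<le> card {f \<in> emb (adj c b) n. uses_edge f u v}"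
    by (simp add: card_W)
  have "(n * (1 / (2 * real p))) ^ (h - 2) * (n * (11 / 20)) ^ (t - h)
      \<le> real (card {f \<in> core (adj c b) n. \<forall>x\<in>U. f x \<in> T x}) * (3 / 5 * n - t) ^ (t - h)"
    using core tn by (intro mult_mono power_mono) auto
  then have main: "(n * (1 / (2 * real p))) ^ (h - 2) * (n * (11 / 20)) ^ (t - h)
      \<le> (real h ^ 2 + 2 * t) * (real n ^ (h - 1) * (n * (2 / 5)) ^ (t - h - 1))"
    using low up cmp by (simp add: mult.commute)
  obtain s where s: "t - h = Suc s" using th by (metis Suc_diff_Suc)
  obtain r where r: "h = Suc (Suc r)" using h_ge_2 by (metis add_2_eq_Suc le_Suc_ex)
  have ex: "h - 2 = r" "h - 1 = Suc r" "t - h - 1 = s" using r s by auto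
  have "(real n ^ Suc r * real n ^ s) * ((1 / (2 * real p)) ^ r * (11 / 20) * (11 / 20) ^ s)
      \<le> (real n ^ Suc r * real n ^ s) * ((real h ^ 2 + 2 * t) * (2 / 5) ^ s)"
    using main unfolding ex unfolding s power_mult_distrib by (simp add: mult_ac)
  moreover have "real n ^ Suc r * real n ^ s > 0" using n0 by simp
  ultimately have 1: "(1 / (2 * real p)) ^ r * (11 / 20) * (11 / 20) ^ s \<le> (real h ^ 2 + 2 * t) * (2 / 5) ^ s"
    by (simp only: mult_le_cancel_left_pos)
  \<comment> \<open>The ratio of the two degree bounds: 11/20, which is below 3/5 minus the share of
    used vertices, against 2/5.\<close>
  have "(11 / 20 :: real) ^ s = (11 / 8) ^ s * (2 / 5) ^ s" by (simp flip: power_mult_distrib)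
  then have "(2 / 5) ^ s * ((1 / (2 * real p)) ^ r * (11 / 20) * (11 / 8) ^ s) \<le> (2 / 5) ^ s * (real h ^ 2 + 2 * t)"
    using 1 by (simp add: mult_ac)
  then have "(1 / (2 * real p)) ^ r * (11 / 20) * (11 / 8) ^ s \<le> real h ^ 2 + 2 * t"
    by (subst (asm) mult_le_cancel_left_pos) simp_all
  then have "(11 / 8) ^ s \<le> (real h ^ 2 + 2 * t) * (20 / 11) * (2 * real p) ^ r"
    using pp by (simp add: field_simps)
  also have "\<dots> \<le> (real h ^ 2 + 2 * t) * 2 * (2 * real p) ^ h"
    using pp r by (intro mult_mono mult_left_mono power_increasing) auto
  finally show False using G3 s by (simp add: mult_ac)
qed

end

section \<open>Complete multipartite minimisers\<close>

lemma ffact_Suc_Suc: "ffact (Suc s) (Suc r) = Suc s * ffact s r"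
  unfolding ffact_def by (subst prod.lessThan_Suc_shift) simp

lemma ffact_Suc: "ffact s (Suc r) = ffact s r * (s - r)"
  by (simp add: ffact_def)

lemma ffact_eq_0: "s < r \<Longrightarrow> ffact s r = 0"
  unfolding ffact_def by (rule prod_zero) (auto intro: bexI[of _ s])

lemma ffact_pos: "r \<le> s \<Longrightarrow> ffact s r > 0"
  unfolding ffact_def by (rule prod_pos) auto

lemma ffact_step: "ffact (Suc s) (Suc r) = ffact s (Suc r) + Suc r * ffact s r"
proof (cases "r \<le> s")
  case True
  then obtain d where "s = r + d" by (metis le_iff_add)
  then have "Suc s * ffact s r = ffact s r * (s - r) + Suc r * ffact s r" by (simp add: algebra_simps)
  then show ?thesis by (simp only: ffact_Suc_Suc[of s r] ffact_Suc[of s r])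
next
  case False
  then show ?thesis by (simp add: ffact_Suc_Suc ffact_eq_0)
qed

lemma ffact_mono: "s \<le> s' \<Longrightarrow> ffact s r \<le> ffact s' r"
  unfolding ffact_def by (intro prod_mono) auto

lemma ffact_strict_mono:
  assumes "1 \<le> r" "r \<le> s'" "s < s'"
  shows "ffact s r < ffact s' r"
proof -
  obtain r' where r: "r = Suc r'" using assms by (cases r) auto
  obtain u where u: "s' = Suc u" using assms by (cases s') auto
  have "ffact s r \<le> ffact u r" using assms u by (intro ffact_mono) auto
  moreover have "ffact s' r = ffact u r + r * ffact u r'" by (simp add: r u ffact_step)
  moreover have "ffact u r' > 0" using assms r u by (intro ffact_pos) auto
  ultimately show ?thesis using r by simp
qed

text \<open>The line is the secant through \<open>q\<close> and \<open>q + 1\<close>, its slope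
  being the forward difference at \<open>q\<close>. Forward differences increase, so the graph lies
  above the line, strictly away from these two points because \<open>q\<close> is at least
  \<open>t\<close>. Integers are used since \<open>s\<close> may be smaller than
  \<open>q\<close>.\<close>

lemma ffact_secant:
  assumes "t \<ge> 2" "q \<ge> t"
  shows "int (ffact q t) + (int s - int q) * (int t * int (ffact q (t - 1))) \<le> int (ffact s t)" (is "?A s")
    and "s \<noteq> q \<Longrightarrow> s \<noteq> q + 1 \<Longrightarrow>
      int (ffact q t) + (int s - int q) * (int t * int (ffact q (t - 1))) < int (ffact s t)"
proof -
  obtain r where r: "t = Suc r" "r \<ge> 1" using assms by (cases t) auto
  define D where "D = int t * int (ffact q (t - 1))"
  have step: "int (ffact (Suc s) t) = int (ffact s t) + int t * int (ffact s (t - 1))" for s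
    using ffact_step[of s r] by (simp add: r algebra_simps)
  have up: "int (ffact q t) + (int s - int q) * D \<le> int (ffact s t)" if "q \<le> s" for s
    using that
  proof (induction s rule: dec_induct)
    case (step s)
    have "D \<le> int t * int (ffact s (t - 1))" unfolding D_def using step by (intro mult_left_mono) (auto intro: ffact_mono)
    then show ?case using step.IH \<open>\<And>s. int (ffact (Suc s) t) = int (ffact s t) + int t * int (ffact s (t - 1))\<close>[of s]
      by (simp add: algebra_simps)
  qed simp
  have down: "int (ffact q t) + (int s - int q) * D \<le> int (ffact s t)" if "s \<le> q" for s
    using that
  proof (induction s rule: inc_induct)
    case (step s)
    have "int t * int (ffact s (t - 1)) \<le> D" unfolding D_def using step by (intro mult_left_mono) (auto intro: ffact_mono)
    then show ?case using step.IH \<open>\<And>s. int (ffact (Suc s) t) = int (ffact s t) + int t * int (ffact s (t - 1))\<close>[of s]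
      by (simp add: algebra_simps)
  qed simp
  show "?A s" using up[of s] down[of s] unfolding D_def by linarith
  assume ne: "s \<noteq> q" "s \<noteq> q + 1"
  show "int (ffact q t) + (int s - int q) * (int t * int (ffact q (t - 1))) < int (ffact s t)"
  proof (cases "s < q")
    case True
    have "ffact s (t - 1) < ffact q (t - 1)" using True assms r by (intro ffact_strict_mono) auto
    then have "int t * int (ffact s (t - 1)) < D" unfolding D_def using assms by simp
    then show ?thesis using down[of "Suc s"] True step[of s] unfolding D_def[symmetric] by (simp add: algebra_simps)
  next
    case False
    then obtain s' where s': "s = Suc s'" "q < s'" using ne by (cases s) auto
    have "ffact q (t - 1) < ffact s' (t - 1)" using s' assms r by (intro ffact_strict_mono) auto
    then have "D < int t * int (ffact s' (t - 1))" unfolding D_def using assms by simp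
    then show ?thesis using up[of s'] s' step[of s'] unfolding D_def[symmetric] by (simp add: algebra_simps)
  qed
qed

text \<open>The sum of a linear function over the parts depends only on \<open>n\<close>. The
  balanced sizes attain the secant value everywhere, so one size off the secant makes the sum
  strictly larger.\<close>

lemma balanced_sizes:
  assumes t: "t \<ge> 2" "n div p \<ge> t" and p: "p > 0" and s: "(\<Sum>i<p. s i) = n"
    and le: "(\<Sum>i<p. ffact (s i) t) \<le> (\<Sum>i<p. ffact (n div p + (if i < n mod p then 1 else 0)) t)"
    and i: "i < p"
  shows "s i = n div p \<or> s i = n div p + 1"
proof (rule ccontr)
  assume neg: "\<not> ?thesis"
  define q where "q = n div p"
  define D where "D = int t * int (ffact q (t - 1))"
  define L where "L x = int (ffact q t) + (int x - int q) * D" for x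
  have q: "q \<ge> t" using t by (simp add: q_def)
  have above: "L x \<le> int (ffact x t)" for x using ffact_secant(1)[OF t(1) q] by (simp add: L_def D_def)
  have strict: "L (s i) < int (ffact (s i) t)"
    using ffact_secant(2)[OF t(1) q, of "s i"] neg by (simp add: L_def D_def q_def)
  have onL: "int (ffact (q + 1) t) = L (q + 1)"
  proof -
    obtain r where "t = Suc r" using t by (cases t) auto
    then show ?thesis using ffact_step[of q r] by (simp add: L_def D_def algebra_simps)
  qed
  have sumL: "(\<Sum>j<p. L (x j)) = int p * int (ffact q t) + (int n - int p * int q) * D" if "(\<Sum>j<p. x j) = n" for x
  proof -
    have "(\<Sum>j<p. L (x j)) = int p * int (ffact q t) + ((\<Sum>j<p. int (x j)) - int p * int q) * D"
      unfolding L_def by (simp add: sum.distrib sum_subtractf flip: sum_distrib_right)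
    also have "(\<Sum>j<p. int (x j)) = int n" using that by (simp flip: of_nat_sum)
    finally show ?thesis .
  qed
  define m where "m j = q + (if j < n mod p then 1 else 0)" for j
  have "(\<Sum>j<p. m j) = n"
  proof -
    have "(\<Sum>j<p. m j) = p * q + (\<Sum>j<p. if j < n mod p then 1 else 0)" by (simp add: m_def sum.distrib)
    also have "(\<Sum>j<p. if j < n mod p then 1 else 0) = card {j \<in> {..<p}. j < n mod p}" by (simp add: sum.If_cases Int_def)
    also have "{j \<in> {..<p}. j < n mod p} = {..<n mod p}" using p by auto (meson less_trans mod_less_divisor)
    finally show ?thesis by (simp add: q_def)
  qed
  then have "(\<Sum>j<p. L (m j)) = (\<Sum>j<p. L (s j))" using sumL[of m] sumL[of s] s by simp
  also have "\<dots> < (\<Sum>j<p. int (ffact (s j) t))"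
    using above strict i by (intro sum_strict_mono_ex1) auto
  also have "\<dots> \<le> (\<Sum>j<p. int (ffact (m j) t))" using le unfolding m_def q_def
    by (simp flip: of_nat_sum)
  also have "\<dots> = (\<Sum>j<p. L (m j))"
    using onL by (intro sum.cong) (auto simp: m_def L_def)
  finally show False by simp
qed

text \<open>Equal totals force equally many indices of the larger size, and then of the smaller
  one.\<close>

lemma match_sizes:
  fixes p q :: nat
  assumes s: "\<And>i. i < p \<Longrightarrow> s i = q \<or> s i = q + (1::nat)" and s': "\<And>i. i < p \<Longrightarrow> s' i = q \<or> s' i = q + 1"
    and eq: "(\<Sum>i<p. s i) = (\<Sum>i<p. s' i)"
  obtains \<tau> where "bij_betw \<tau> {..<p} {..<p}" "\<And>i. i < p \<Longrightarrow> s i = s' (\<tau> i)"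
proof -
  define A where "A = {i \<in> {..<p}. s i = q + 1}"
  define A' where "A' = {i \<in> {..<p}. s' i = q + 1}"
  have "(\<Sum>i<p. s i) = (\<Sum>i<p. q + (if s i = q + 1 then 1 else 0))" using s by (intro sum.cong) auto
  then have 1: "(\<Sum>i<p. s i) = p * q + card A" by (simp add: sum.distrib A_def sum.If_cases Int_def)
  have "(\<Sum>i<p. s' i) = (\<Sum>i<p. q + (if s' i = q + 1 then 1 else 0))" using s' by (intro sum.cong) auto
  then have 2: "(\<Sum>i<p. s' i) = p * q + card A'" by (simp add: sum.distrib A'_def sum.If_cases Int_def)
  have sub: "A \<subseteq> {..<p}" "A' \<subseteq> {..<p}" by (auto simp: A_def A'_def)
  have fin: "finite A" "finite A'" by (auto simp: A_def A'_def)
  have cA: "card A = card A'" using 1 2 eq by simp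
  then have "card ({..<p} - A) = card ({..<p} - A')" using sub fin by (simp add: card_Diff_subset)
  then obtain g where g: "bij_betw g ({..<p} - A) ({..<p} - A')" using finite_same_card_bij[of "{..<p} - A" "{..<p} - A'"] by auto
  obtain f where f: "bij_betw f A A'" using finite_same_card_bij[OF fin cA] by auto
  define \<tau> where "\<tau> i = (if i \<in> A then f i else g i)" for i
  have "bij_betw \<tau> (A \<union> ({..<p} - A)) (A' \<union> ({..<p} - A'))"
    unfolding \<tau>_def by (rule bij_betw_disjoint_Un[OF f g]) auto
  moreover have "A \<union> ({..<p} - A) = {..<p}" "A' \<union> ({..<p} - A') = {..<p}" using sub by auto
  ultimately have "bij_betw \<tau> {..<p} {..<p}" by simp
  moreover have "s i = s' (\<tau> i)" if "i < p" for i
  proof (cases "i \<in> A")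
    case True
    then have "f i \<in> A'" using f by (auto simp: bij_betw_def)
    then show ?thesis using True by (simp add: \<tau>_def A_def A'_def)
  next
    case False
    then have "g i \<in> {..<p} - A'" using g that by (auto simp: bij_betw_def)
    then have "s' (g i) = q" using s'[of "g i"] by (auto simp: A'_def)
    then show ?thesis using False that s by (auto simp: \<tau>_def A_def)
  qed
  ultimately show thesis by (rule that)
qed

lemma match_parts:
  assumes part: "part \<in> {..<n} \<rightarrow> {..<p}" and \<tau>: "bij_betw \<tau> {..<p} {..<p}"
    and sz: "\<And>i. i < p \<Longrightarrow> part_size n part i = part_size n part' (\<tau> i)"
  obtains \<sigma> where "bij_betw \<sigma> {..<n} {..<n}" "\<And>v. v < n \<Longrightarrow> part' (\<sigma> v) = \<tau> (part v)"
proof -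
  define P where "P i = {v \<in> {..<n}. part v = i}" for i
  define P' where "P' i = {v \<in> {..<n}. part' v = i}" for i
  have "\<exists>f. bij_betw f (P i) (P' (\<tau> i))" if "i < p" for i
    using sz[OF that] by (intro finite_same_card_bij) (auto simp: P_def P'_def part_size_def)
  then obtain f where f: "\<And>i. i < p \<Longrightarrow> bij_betw (f i) (P i) (P' (\<tau> i))" by metis
  define \<sigma> where "\<sigma> v = f (part v) v" for v
  have sP: "\<sigma> v \<in> P' (\<tau> (part v))" "part v < p" if "v < n" for v
  proof -
    show p: "part v < p" using that part by auto
    then show "\<sigma> v \<in> P' (\<tau> (part v))" using f[OF p] that by (auto simp: \<sigma>_def bij_betw_def P_def)
  qed
  have "inj_on \<sigma> {..<n}"
  proof (rule inj_onI)
    fix u v assume uv: "u \<in> {..<n}" "v \<in> {..<n}" "\<sigma> u = \<sigma> v"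
    have "\<tau> (part u) = \<tau> (part v)" using sP[of u] sP[of v] uv by (auto simp: P'_def)
    then have e: "part u = part v" using \<tau> sP uv by (auto simp: bij_betw_def inj_on_def)
    have "inj_on (f (part u)) (P (part u))" using f[OF sP(2)[of u]] uv by (auto simp: bij_betw_def)
    then show "u = v" using uv e by (auto simp: \<sigma>_def P_def inj_on_def)
  qed
  moreover have "\<sigma> ` {..<n} \<subseteq> {..<n}" using sP by (auto simp: P'_def)
  ultimately have "bij_betw \<sigma> {..<n} {..<n}" by (simp add: bij_betw_def endo_inj_surj)
  moreover have "part' (\<sigma> v) = \<tau> (part v)" if "v < n" for v using sP[OF that] by (auto simp: P'_def)
  ultimately show thesis by (rule that)
qed

context pendant_graph
begin

text \<open>A pendant edge of the graph can be placed on an \<open>a\<close>-edge between two parts, with everything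
  else inside one part; so recolouring all pairs between parts loses a copy and gains none.\<close>

lemma no_a_edge_across:
  assumes ab: "a \<noteq> b" and part: "part \<in> {..<n} \<rightarrow> {..<p}" and size: "\<And>i. i < p \<Longrightarrow> t \<le> part_size n part i"
    and inside: "\<And>u v. u < n \<Longrightarrow> v < n \<Longrightarrow> u \<noteq> v \<Longrightarrow> part u = part v \<Longrightarrow> c {u, v} = a"
    and cmin: "mono_copies H n c = min_mono_copies H n" and W: "W \<noteq> {}"
    and uv: "u < n" "v < n" "part u \<noteq> part v"
  shows "c {u, v} = b"
proof (rule ccontr)
  assume "c {u, v} \<noteq> b"
  then have ca: "c {u, v} = a" using colour_cases[OF ab] by auto
  define c' where "c' = restrict (\<lambda>e. if card (part ` e) = 1 then a else b) (nsets {..<n} 2)"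
  have c': "c' \<in> edge_colourings n" by (simp add: c'_def edge_colourings_def)
  have c'e: "c' {x, y} = (if part x = part y then a else b)" if "x < n" "y < n" "x \<noteq> y" for x y
  proof -
    have "{x, y} \<in> nsets {..<n} 2" using that by (simp add: nsets_def)
    then show ?thesis by (simp add: c'_def card_insert_if)
  qed
  have b0: "emb (adj c' b) n = {}"
    by (rule emb_multipartite_empty[OF part]) (use c'e ab in \<open>auto simp: adj_def split: if_splits\<close>)
  have adj_sub: "adj c a x y" if "adj c' a x y" "x < n" "y < n" for x y
    using that c'e[of x y] inside[of x y] ab by (auto simp: adj_def split: if_splits)
  have sub: "emb (adj c' a) n \<subseteq> emb (adj c a) n"
  proof
    fix f assume f: "f \<in> emb (adj c' a) n"
    have fn: "f x < n" if "x \<in> U \<union> W" for x using f that by (auto simp: emb_def)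
    have "adj c a (f x) (f y)" if "F x y" for x y
      using f that F(1,2)[OF that] adj_sub fn by (auto simp: emb_def)
    moreover have "adj c a (f (att w)) (f w)" if "w \<in> W" for w
      using f that att[OF that] adj_sub fn by (auto simp: emb_def)
    ultimately show "f \<in> emb (adj c a) n" using f by (simp add: emb_def)
  qed
  obtain w where w: "w \<in> W" using W by auto
  define P where "P = {q \<in> {..<n}. part q = part u}"
  have aw: "att w \<in> U" "att w \<noteq> w" "w \<notin> U" using att[OF w] w UW by auto
  define X where "X = U \<union> W - {w} - {att w}"
  \<comment> \<open>The \<open>t - 2\<close> vertices other than \<open>w\<close> and
    \<open>att w\<close> have to fit beside \<open>u\<close> into its part.\<close>
  have "card X \<le> card (P - {u})"
  proof -
    have "card X = t - 1 - 1" unfolding X_def using w aw fin t by (subst card_Diff_singleton; simp)+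
    moreover have "part u < p" using uv part by auto
    then have "t \<le> card P" using size by (simp add: P_def part_size_def)
    moreover have "card (P - {u}) = card P - 1" using uv by (simp add: P_def)
    ultimately show ?thesis by simp
  qed
  then obtain g where g: "g ` X \<subseteq> P - {u}" "inj_on g X"
    using card_le_inj[of X "P - {u}"] fin by (auto simp: X_def P_def)
  define f where "f x = (if x = w then v else if x = att w then u else if x \<in> X then g x else undefined)" for x
  have fP: "f x \<in> P" "f x < n" "part (f x) = part u" if "x \<in> U \<union> W" "x \<noteq> w" for x
  proof -
    show "f x \<in> P" using that g uv by (auto simp: f_def P_def X_def)
    then show "f x < n" "part (f x) = part u" by (auto simp: P_def)
  qed
  have fw: "f w = v" by (simp add: f_def)
  have inj: "inj_on f (U \<union> W)"
  proof (rule inj_onI)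
    fix x y assume xy: "x \<in> U \<union> W" "y \<in> U \<union> W" "f x = f y"
    show "x = y"
    proof (cases "x = w \<or> y = w")
      case True
      then show ?thesis using fP[of x] fP[of y] xy fw uv by metis
    next
      case False
      have "g z \<noteq> u" if "z \<in> X" for z using g that by auto
      moreover have "f z = (if z = att w then u else g z)" "z \<noteq> att w \<longrightarrow> z \<in> X" if "z = x \<or> z = y" for z
        using that False xy by (auto simp: f_def X_def)
      ultimately show ?thesis using xy(3) inj_onD[OF g(2), of x y] by metis
    qed
  qed
  have "f \<in> emb (adj c a) n"
    unfolding emb_def
  proof (intro CollectI conjI allI impI ballI)
    have "f x < n" if "x \<in> U \<union> W" for x using fP[OF that] fw uv by (cases "x = w") auto
    moreover have "f x = undefined" if "x \<notin> U \<union> W" for x using that w aw by (auto simp: f_def X_def)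
    ultimately show "f \<in> U \<union> W \<rightarrow>\<^sub>E {..<n}" by (auto simp: PiE_def extensional_def)
    show "inj_on f (U \<union> W)" by (rule inj)
    show "adj c a (f x) (f y)" if "F x y" for x y
    proof -
      have "x \<in> U \<union> W" "y \<in> U \<union> W" "x \<noteq> y" "x \<noteq> w" "y \<noteq> w" using F[OF that] aw by auto
      then have "f x \<noteq> f y" "c {f x, f y} = a" using inj inside[of "f x" "f y"] fP by (auto simp: inj_on_def)
      then show ?thesis by (simp add: adj_def)
    qed
    show "adj c a (f (att q)) (f q)" if "q \<in> W" for q
    proof (cases "q = w")
      case True
      have "f (att w) = u" using aw by (simp add: f_def)
      moreover have "u \<noteq> v" using uv by auto
      ultimately show ?thesis using True fw ca by (simp add: adj_def)
    next
      case False
      have "att q \<in> U \<union> W" "q \<in> U \<union> W" "att q \<noteq> q" "att q \<noteq> w" using att[OF that] that UW aw by auto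
      then have "f (att q) \<noteq> f q" "c {f (att q), f q} = a"
        using inj inside[of "f (att q)" "f q"] fP False by (auto simp: inj_on_def)
      then show ?thesis by (simp add: adj_def)
    qed
  qed
  moreover have "f \<notin> emb (adj c' a) n"
  proof
    assume "f \<in> emb (adj c' a) n"
    then have "adj c' a (f (att w)) (f w)" using w by (auto simp: emb_def)
    moreover have "f (att w) = u" using aw by (simp add: f_def)
    ultimately show False using c'e[of u v] uv fw ab by (auto simp: adj_def)
  qed
  ultimately have "emb (adj c' a) n \<subset> emb (adj c a) n" using sub by blast
  then have "card (emb (adj c' a) n) < card (emb (adj c a) n)" by (intro psubset_card_mono finite_emb)
  then have "mono_copies H n c' < mono_copies H n c" by (simp add: mono_copies_emb'[OF ab] b0)
  then show False using cmin min_mono_copies_le[OF c', of H] by simp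
qed

definition multipartite :: "(nat set \<Rightarrow> colour) \<Rightarrow> nat \<Rightarrow> bool" where
  "multipartite c n \<longleftrightarrow> (\<exists>a b part. a \<noteq> b \<and> part \<in> {..<n} \<rightarrow> {..<p} \<and>
     (\<forall>u<n. \<forall>v<n. u \<noteq> v \<longrightarrow> c {u, v} = (if part u = part v then a else b)))"

text \<open>A multipartite minimiser is balanced, since it has no more copies than
  \<open>mod_colouring\<close>. Its part sizes are therefore those of the residue classes up to
  order, which gives both the equal count and the vertex permutation.\<close>

lemma mod_colouring_minimal:
  assumes mp: "\<And>c. c \<in> edge_colourings n \<Longrightarrow> mono_copies H n c = min_mono_copies H n \<Longrightarrow> multipartite c n"
    and np: "t \<le> n div p"
  shows "mono_copies H n (mod_colouring n) = min_mono_copies H n" (is ?A)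
    and "\<And>c. c \<in> edge_colourings n \<Longrightarrow> mono_copies H n c = min_mono_copies H n \<Longrightarrow> colouring_equiv n c (mod_colouring n)"
proof -
  have t2: "t \<ge> 2" using h_ge_2 card_W by linarith
  have bal: "\<exists>a b part. a \<noteq> b \<and> part \<in> {..<n} \<rightarrow> {..<p} \<and>
     (\<forall>u<n. \<forall>v<n. u \<noteq> v \<longrightarrow> c {u, v} = (if part u = part v then a else b)) \<and>
     (\<forall>i<p. part_size n part i = n div p \<or> part_size n part i = n div p + 1)"
    if c: "c \<in> edge_colourings n" "mono_copies H n c = min_mono_copies H n" for c
  proof -
    obtain a b part where m: "a \<noteq> b" "part \<in> {..<n} \<rightarrow> {..<p}"
      "\<And>u v. u < n \<Longrightarrow> v < n \<Longrightarrow> u \<noteq> v \<Longrightarrow> c {u, v} = (if part u = part v then a else b)"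
      using mp[OF c] unfolding multipartite_def by blast
    have "(\<Sum>i<p. ffact (part_size n part i) t) = mono_copies H n c"
      by (rule mono_copies_multipartite[OF m, symmetric])
    also have "\<dots> \<le> mono_copies H n (mod_colouring n)" using c min_mono_copies_le[OF mod_colouring_in] by simp
    finally have "part_size n part i = n div p \<or> part_size n part i = n div p + 1" if "i < p" for i
      unfolding mono_copies_mod_colouring
      by (intro balanced_sizes[OF t2 np p_pos sum_part_size[OF m(2)] _ that])
    then show ?thesis using m by blast
  qed
  have mod_part: "(\<lambda>v. v mod p) \<in> {..<n} \<rightarrow> {..<p}" using p_pos by auto
  have mod_size: "part_size n (\<lambda>v. v mod p) i = n div p \<or> part_size n (\<lambda>v. v mod p) i = n div p + 1" if "i < p" for i
    using part_size_mod[OF that] by simp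
  have match: "\<exists>\<tau>. bij_betw \<tau> {..<p} {..<p} \<and> (\<forall>i<p. part_size n part i = part_size n (\<lambda>v. v mod p) (\<tau> i))"
    if pt: "part \<in> {..<n} \<rightarrow> {..<p}" "\<forall>i<p. part_size n part i = n div p \<or> part_size n part i = n div p + 1" for part
  proof -
    obtain \<tau> where "bij_betw \<tau> {..<p} {..<p}" "\<And>i. i < p \<Longrightarrow> part_size n part i = part_size n (\<lambda>v. v mod p) (\<tau> i)"
      by (rule match_sizes[of p "part_size n part" "n div p" "part_size n (\<lambda>v. v mod p)"])
        (use pt mod_size sum_part_size[OF pt(1)] sum_part_size[OF mod_part] in auto)
    then show ?thesis by blast
  qed
  show ?A
  proof -
    obtain c where c: "c \<in> edge_colourings n" "mono_copies H n c = min_mono_copies H n"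
      using ex_min_mono_copies by blast
    obtain a b part where m: "a \<noteq> b" "part \<in> {..<n} \<rightarrow> {..<p}"
      "\<And>u v. u < n \<Longrightarrow> v < n \<Longrightarrow> u \<noteq> v \<Longrightarrow> c {u, v} = (if part u = part v then a else b)"
      "\<forall>i<p. part_size n part i = n div p \<or> part_size n part i = n div p + 1" using bal[OF c] by blast
    obtain \<tau> where \<tau>: "bij_betw \<tau> {..<p} {..<p}" "\<forall>i<p. part_size n part i = part_size n (\<lambda>v. v mod p) (\<tau> i)"
      using match[OF m(2,4)] by blast
    have "mono_copies H n c = (\<Sum>i<p. ffact (part_size n part i) t)" by (rule mono_copies_multipartite[OF m(1-3)])
    also have "\<dots> = (\<Sum>i<p. ffact (part_size n (\<lambda>v. v mod p) (\<tau> i)) t)" using \<tau>(2) by simp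
    also have "\<dots> = (\<Sum>i<p. ffact (part_size n (\<lambda>v. v mod p) i) t)"
      by (rule sum.reindex_bij_betw[OF \<tau>(1)])
    also have "\<dots> = mono_copies H n (mod_colouring n)"
      by (rule mono_copies_multipartite[of Red Blue, symmetric]) (use mod_colouring mod_part in auto)
    finally show ?thesis using c by simp
  qed
  fix c assume c: "c \<in> edge_colourings n" "mono_copies H n c = min_mono_copies H n"
  obtain a b part where m: "a \<noteq> b" "part \<in> {..<n} \<rightarrow> {..<p}"
    "\<And>u v. u < n \<Longrightarrow> v < n \<Longrightarrow> u \<noteq> v \<Longrightarrow> c {u, v} = (if part u = part v then a else b)"
    "\<forall>i<p. part_size n part i = n div p \<or> part_size n part i = n div p + 1" using bal[OF c] by blast
  obtain \<tau> where \<tau>: "bij_betw \<tau> {..<p} {..<p}" "\<forall>i<p. part_size n part i = part_size n (\<lambda>v. v mod p) (\<tau> i)"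
    using match[OF m(2,4)] by blast
  obtain \<sigma> where \<sigma>: "bij_betw \<sigma> {..<n} {..<n}" "\<And>v. v < n \<Longrightarrow> \<sigma> v mod p = \<tau> (part v)"
    using match_parts[OF m(2) \<tau>(1), of "\<lambda>v. v mod p"] \<tau>(2) by blast
  \<comment> \<open>Names the colour inside the parts of \<open>c\<close> by \<open>Red\<close>, as
    the Turan colouring does.\<close>
  define \<pi> where "\<pi> x = (if x = Red then a else b)" for x :: colour
  have "bij \<pi>"
  proof (rule bijI)
    show "inj \<pi>"
    proof (rule injI)
      fix x y assume "\<pi> x = \<pi> y"
      then show "x = y" using m(1) by (cases x; cases y) (auto simp: \<pi>_def)
    qed
    show "surj \<pi>"
    proof (rule surjI)
      fix x
      show "\<pi> (if x = a then Red else Blue) = x" using colour_cases[OF m(1), of x] by (auto simp: \<pi>_def)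
    qed
  qed
  moreover have "c e = \<pi> (mod_colouring n (\<sigma> ` e))" if e: "e \<in> nsets {..<n} 2" for e
  proof -
    obtain u v where uv: "e = {u, v}" "u \<noteq> v" "u < n" "v < n"
      using e by (auto simp: nsets_def card_2_iff)
    have "\<sigma> u < n" "\<sigma> v < n" "\<sigma> u \<noteq> \<sigma> v" using \<sigma>(1) uv by (auto simp: bij_betw_def inj_on_def)
    then have "mod_colouring n {\<sigma> u, \<sigma> v} = (if \<tau> (part u) = \<tau> (part v) then Red else Blue)"
      using mod_colouring \<sigma>(2) uv by simp
    moreover have "\<tau> (part u) = \<tau> (part v) \<longleftrightarrow> part u = part v"
      using \<tau>(1) m(2) uv by (auto simp: bij_betw_def inj_on_def)
    ultimately show ?thesis using m(3) uv by (auto simp: \<pi>_def)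
  qed
  ultimately show "colouring_equiv n c (mod_colouring n)"
    unfolding colouring_equiv_def using \<sigma>(1) by blast
qed

lemma turan_mod_colouring: "turan_colouring n p (mod_colouring n)"
  unfolding turan_colouring_def
proof (intro conjI bexI allI impI)
  show "mod_colouring n \<in> edge_colourings n" by (rule mod_colouring_in)
  show "(\<lambda>v. v mod p) \<in> {..<n} \<rightarrow> {..<p}" using p_pos by auto
  show "mod_colouring n {u, v} = (if u mod p = v mod p then Red else Blue)" if "u < n" "v < n" "u \<noteq> v" for u v
    by (rule mod_colouring[OF that])
  fix i assume i: "i < p"
  have fl: "\<lfloor>real n / real p\<rfloor> = int (n div p)" by (simp add: floor_divide_of_nat_eq)
  have "int (part_size n (\<lambda>v. v mod p) i) \<in> {\<lfloor>real n / real p\<rfloor>, \<lceil>real n / real p\<rceil>}"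
  proof (cases "i < n mod p")
    case True
    \<comment> \<open>A part of size \<open>n div p + 1\<close> exists only if \<open>p\<close> does
      not divide \<open>n\<close>, and then this size is the ceiling.\<close>
    have "real n / real p \<noteq> real_of_int \<lfloor>real n / real p\<rfloor>"
    proof
      assume "real n / real p = real_of_int \<lfloor>real n / real p\<rfloor>"
      then have "real n = real (p * (n div p))" using p_pos by (simp add: fl field_simps)
      then have "n = p * (n div p)" by (simp only: of_nat_eq_iff)
      then have "n mod p = 0" by (metis mod_mult_self1_is_0)
      then show False using True by simp
    qed
    then have "\<lceil>real n / real p\<rceil> = int (n div p) + 1" unfolding ceiling_altdef fl by simp
    then show ?thesis using True part_size_mod[OF i, of n] by simp
  next
    case False
    then show ?thesis using part_size_mod[OF i, of n] fl by simp
  qed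
  then show "int (card {v \<in> {..<n}. v mod p = i}) \<in> {\<lfloor>real n / real p\<rfloor>, \<lceil>real n / real p\<rceil>}"
    by (simp add: part_size_def)
qed

text \<open>Eventually the minimum is an explicit sum of \<open>p\<close> falling factorials,
  squeezed between the t-th powers of n/p - 1 - t and n/p + 1.\<close>

lemma density_limit:
  assumes ev: "\<forall>\<^sub>F n in sequentially. mono_copies H n (mod_colouring n) = min_mono_copies H n"
  shows "mono_density H \<longlonglongrightarrow> p * (1 / p) ^ t"
proof -
  have p: "real p > 0" using p_pos by simp
  have div0: "(\<lambda>n. C / real n) \<longlonglongrightarrow> 0" for C by (rule lim_const_over_n)
  have up: "(\<lambda>n. p * (1 / p + 1 / n) ^ t) \<longlonglongrightarrow> p * (1 / p + 0) ^ t"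
    by (intro tendsto_intros div0)
  have low: "(\<lambda>n. p * (1 / p - (real t + 1) / n) ^ t) \<longlonglongrightarrow> p * (1 / p - 0) ^ t"
    by (intro tendsto_intros div0)
  have den: "(\<lambda>n. \<Prod>i<t. 1 - real i / n) \<longlonglongrightarrow> (\<Prod>i<t. 1 - 0)"
    by (intro tendsto_intros div0)
  have lim: "(\<lambda>n. real (min_mono_copies H n) / real n ^ t) \<longlonglongrightarrow> p * (1 / p) ^ t"
  proof (rule tendsto_sandwich)
    show "\<forall>\<^sub>F n in sequentially. real (min_mono_copies H n) / real n ^ t \<le> p * (1 / p + 1 / n) ^ t"
      using eventually_gt_at_top[of 0]
    proof eventually_elim
      case (elim n)
      have "real (min_mono_copies H n) / real n ^ t \<le> p * (n / p + 1) ^ t / real n ^ t"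
        by (intro divide_right_mono min_mono_copies_upper) auto
      also have "\<dots> = p * ((n / p + 1) / n) ^ t" by (simp add: power_divide)
      also have "(n / p + 1) / n = 1 / p + 1 / n" using elim p by (simp add: field_simps)
      finally show ?case .
    qed
    show "\<forall>\<^sub>F n in sequentially. p * (1 / p - (real t + 1) / n) ^ t \<le> real (min_mono_copies H n) / real n ^ t"
      using ev eventually_gt_at_top[of "p * (t + 1)"]
    proof eventually_elim
      case (elim n)
      have n0: "real n > 0" using elim(2) by auto
      have "n < (n div p + 1) * p" using p_pos by (metis add.commute dividend_less_div_times mult_Suc Suc_eq_plus1)
      then have "real n < real ((n div p + 1) * p)" by (rule of_nat_less_iff[THEN iffD2])
      then have "n / p < real (n div p) + 1" using p by (simp add: divide_less_eq algebra_simps)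
      then have q: "n / p - 1 - t \<le> real (n div p) - t" by simp
      have "real (p * (t + 1)) \<le> real n" using elim(2) by (intro of_nat_mono) simp
      then have "real t + 1 \<le> n / p" using p by (simp add: le_divide_eq algebra_simps)
      then have q0: "0 \<le> n / p - 1 - t" by simp
      have "(n / p - 1 - t) ^ t \<le> (\<Prod>i<t. real (n div p) - t)"
        using power_mono[OF q q0, of t] by simp
      also have "\<dots> \<le> (\<Prod>i<t. real (n div p - i))"
        using q q0 by (intro prod_mono) auto
      also have "\<dots> = real (ffact (n div p) t)" by (simp add: ffact_def)
      finally have f: "(n / p - 1 - t) ^ t \<le> ffact (n div p) t" .
      have "p * (n / p - 1 - t) ^ t \<le> (\<Sum>i<p. real (ffact (n div p) t))" using f by (simp add: mult_left_mono)
      also have "\<dots> \<le> (\<Sum>i<p. real (ffact (n div p + (if i < n mod p then 1 else 0)) t))"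
        by (intro sum_mono of_nat_mono ffact_mono) simp
      also have "\<dots> = min_mono_copies H n"
        using elim(1) mono_copies_mod_colouring[of n] by (simp only: of_nat_sum[symmetric])
      finally have "p * (n / p - 1 - t) ^ t / real n ^ t \<le> min_mono_copies H n / real n ^ t"
        by (intro divide_right_mono) auto
      moreover have "p * (n / p - 1 - t) ^ t / real n ^ t = p * ((n / p - 1 - t) / n) ^ t" by (simp add: power_divide)
      moreover have "(n / p - 1 - t) / n = 1 / p - (real t + 1) / n" using n0 p by (simp add: field_simps)
      ultimately show ?case by simp
    qed
  qed (use up low in auto)
  have "(\<lambda>n. real (min_mono_copies H n) / real n ^ t / (\<Prod>i<t. 1 - real i / n)) \<longlonglongrightarrow> p * (1 / p) ^ t / (\<Prod>i<t. 1 - 0)"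
    by (intro tendsto_divide lim den) simp
  then have "(\<lambda>n. real (min_mono_copies H n) / real n ^ t / (\<Prod>i<t. 1 - real i / n)) \<longlonglongrightarrow> p * (1 / p) ^ t" by simp
  moreover have "\<forall>\<^sub>F n in sequentially. real (min_mono_copies H n) / real n ^ t / (\<Prod>i<t. 1 - real i / n) = mono_density H n"
    using eventually_gt_at_top[of 0]
  proof eventually_elim
    case (elim n)
    have "real n ^ t * (\<Prod>i<t. 1 - real i / n) = (\<Prod>i<t. real n * (1 - real i / n))" by (simp add: prod.distrib)
    also have "\<dots> = falling_factorial n t" unfolding falling_factorial_def
      using elim by (intro prod.cong) (auto simp: field_simps)
    finally show ?case by (simp add: mono_density_def verts t)
  qed
  ultimately show ?thesis by (rule Lim_transform_eventually)
qed

end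

section \<open>Numerical estimates and the choice of constants\<close>

lemma eventually_linear_ge: "d > 0 \<Longrightarrow> \<forall>\<^sub>F n in sequentially. C \<le> d * real n"
proof -
  assume d: "d > 0"
  show ?thesis using eventually_ge_at_top[of "nat \<lceil>C / d\<rceil>"]
  proof eventually_elim
    case (elim n)
    then have "C / d \<le> real n" by linarith
    then show ?case using d by (simp add: field_simps)
  qed
qed

text \<open>By Bernoulli each block of \<open>L ^ Suc d\<close> factors contributes at least
  \<open>L\<close>; there is room for \<open>s\<close> blocks.\<close>

lemma growth_power:
  fixes L s m d :: nat and x :: real
  assumes L: "L \<ge> 1" and x: "1 / real L ^ d \<le> x" and m: "L ^ Suc d * s \<le> m"
  shows "real L ^ s \<le> (1 + x) ^ m"
proof -
  have x0: "0 \<le> x" using x by (smt (verit) zero_le_divide_1_iff zero_le_power of_nat_0_le_iff)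
  have "real L = real (L ^ Suc d) * (1 / real L ^ d)" using L by simp
  also have "\<dots> \<le> real (L ^ Suc d) * x" using x by (intro mult_left_mono) auto
  finally have "real L \<le> 1 + real (L ^ Suc d) * x" by simp
  also have "\<dots> \<le> (1 + x) ^ (L ^ Suc d)" using x0 by (intro Bernoulli_inequality) auto
  finally have "real L ^ s \<le> ((1 + x) ^ (L ^ Suc d)) ^ s" by (intro power_mono) auto
  also have "\<dots> = (1 + x) ^ (L ^ Suc d * s)" by (simp add: power_mult)
  also have "\<dots> \<le> (1 + x) ^ m" using x0 m by (intro power_increasing) auto
  finally show ?thesis .
qed

text \<open>The difficulty is the factor \<open>t\<close>, which has no upper bound in terms of
  \<open>L\<close>. Squaring a Bernoulli bound that is linear in \<open>t\<close> gives quadratic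
  growth, enough for \<open>t * L\<close>; a separate block of the exponent supplies
  \<open>L ^ (2 * h)\<close>.\<close>

lemma growth_linear_factor:
  fixes L h t m :: nat and x :: real
  assumes h: "h \<ge> 1" and L: "L \<ge> 1000 * h" and t: "t \<ge> L ^ 10" and m: "t \<le> 2 * h * m" and x: "1 / real L ^ 2 \<le> x"
  shows "t * real L ^ (2 * h + 1) \<le> (1 + x) ^ m"
proof -
  have L1: "real L \<ge> 1000 * real h" "real L \<ge> 1000" "real h \<ge> 1" using L h by auto
  have x0: "0 \<le> x" using x by (smt (verit) zero_le_divide_1_iff zero_le_power of_nat_0_le_iff)
  \<comment> \<open>The exponent is at least t/(2h); this \<open>j\<close> lets \<open>2 * j\<close>
    take about half of that and leaves the rest for the power of \<open>L\<close>.\<close>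
  define j where "j = t div (8 * h)"
  have tr: "real L ^ 10 \<le> real t" using t by (metis of_nat_mono of_nat_power)
  have hL: "1000 * 1000 * real h ^ 2 \<le> real L ^ 2"
    using power_mono[of "1000 * real h" "real L" 2] L1 by (simp add: power_mult_distrib)
  have "j * (8 * h) \<le> t" by (simp add: j_def)
  then have j1: "real j * (8 * real h) \<le> t" by (metis of_nat_mult of_nat_mono of_nat_numeral)
  have "t < (j + 1) * (8 * h)" unfolding j_def using h by (metis add.commute dividend_less_div_times mult_Suc Suc_eq_plus1 mult_pos_pos zero_less_numeral less_le_trans zero_less_one)
  then have "real t < real ((j + 1) * (8 * h))" by (rule of_nat_less_iff[THEN iffD2])
  then have j2: "real t < (real j + 1) * (8 * real h)" by (simp add: algebra_simps)
  have big: "real h ^ 2 * real L ^ 3 * 1000 \<le> t"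
  proof -
    have "real h ^ 2 * real L ^ 3 * 1000 \<le> real L ^ 2 * real L ^ 3 * real L"
      using hL L1 by (intro mult_mono) auto
    also have "\<dots> = real L ^ 6" by (simp add: eval_nat_numeral)
    also have "\<dots> \<le> real L ^ 10" using L1 by (intro power_increasing) auto
    finally show ?thesis using tr by linarith
  qed
  have hh: "real h \<le> real h ^ 2" using L1 by (simp add: power2_eq_square)
  have L3: "1 \<le> real L ^ 3" using L1 by (intro one_le_power) auto
  have t16: "16 * real h \<le> t"
  proof -
    have "real h * 1 \<le> real h ^ 2 * real L ^ 3" using hh L3 by (intro mult_mono) auto
    then show ?thesis using big by linarith
  qed
  have j3: "real t \<le> real j * (16 * real h)" using j2 t16 by (simp add: algebra_simps)
  have "2 * j + L ^ 3 * (2 * h) \<le> m"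
  proof -
    have "(2 * real j + real L ^ 3 * (2 * real h)) * (4 * real h) = real j * (8 * real h) + 8 * (real h ^ 2 * real L ^ 3)"
      by (simp add: algebra_simps power2_eq_square)
    also have "\<dots> \<le> 2 * real t" using j1 big by linarith
    also have "\<dots> \<le> real m * (4 * real h)"
      using of_nat_mono[OF m, where ?'a = real] by (simp add: mult_ac)
    finally have "2 * real j + real L ^ 3 * (2 * real h) \<le> real m" using L1 by (simp add: mult_le_cancel_right)
    then have "real (2 * j + L ^ 3 * (2 * h)) \<le> real m" by simp
    then show ?thesis by (simp only: of_nat_le_iff)
  qed
  then have m2: "(1 + x) ^ (2 * j + L ^ 3 * (2 * h)) \<le> (1 + x) ^ m" using x0 by (intro power_increasing) auto
  have "real L ^ (2 * h) \<le> (1 + x) ^ (L ^ 3 * (2 * h))"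
    by (rule growth_power[of L 2]) (use L1 x in \<open>auto simp: numeral_3_eq_3 numeral_2_eq_2\<close>)
  moreover have "t * real L \<le> (1 + x) ^ (2 * j)"
  proof -
    have "real t * real L * (256 * real h ^ 2 * real L ^ 4) \<le> real t * real t"
    proof -
      have "256 * real h ^ 2 \<le> real L ^ 2" using hL zero_le_power2[of "real h"] by linarith
      then have "real L * (256 * real h ^ 2 * real L ^ 4) \<le> real L * (real L ^ 2 * real L ^ 4)"
        by (intro mult_left_mono mult_right_mono) auto
      also have "\<dots> = real L ^ 7" by (simp add: eval_nat_numeral)
      also have "\<dots> \<le> real L ^ 10" using L1 by (intro power_increasing) auto
      finally have "real L * (256 * real h ^ 2 * real L ^ 4) \<le> t" using tr by linarith
      then show ?thesis by (simp only: mult.assoc) (intro mult_left_mono, auto)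
    qed
    also have "\<dots> \<le> (real j * (16 * real h)) * (real j * (16 * real h))" using j3 by (intro mult_mono) auto
    also have "\<dots> = real j ^ 2 * (256 * real h ^ 2)" by (simp add: power2_eq_square)
    also have "\<dots> = real j ^ 2 * (1 / real L ^ 2) ^ 2 * (256 * real h ^ 2 * real L ^ 4)"
      using L1 by (simp add: power_divide flip: power_mult)
    finally have "real t * real L \<le> real j ^ 2 * (1 / real L ^ 2) ^ 2"
      using L1 by (subst (asm) mult_le_cancel_right_pos) auto
    also have "\<dots> \<le> real j ^ 2 * x ^ 2" using x by (intro mult_left_mono power_mono) auto
    also have "\<dots> = (real j * x) ^ 2" by (simp add: power_mult_distrib)
    also have "\<dots> \<le> ((1 + x) ^ j) ^ 2"
    proof (rule power_mono)
      have "1 + real j * x \<le> (1 + x) ^ j" using x0 by (intro Bernoulli_inequality) auto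
      then show "real j * x \<le> (1 + x) ^ j" by simp
    qed (use x0 in auto)
    also have "\<dots> = (1 + x) ^ (2 * j)" by (simp add: mult.commute flip: power_mult)
    finally show ?thesis .
  qed
  ultimately have "(t * real L) * real L ^ (2 * h) \<le> (1 + x) ^ (2 * j) * (1 + x) ^ (L ^ 3 * (2 * h))"
    using x0 by (intro mult_mono) auto
  then show ?thesis using m2 by (simp add: power_add mult_ac)
qed

context pendant_graph
begin

text \<open>The conditions on \<open>t\<close> are checked once and for all. Those on
  \<open>n\<close> are finitely many linear lower bounds and the convergence of (1 + p/n)^t to 1, so
  they hold eventually.\<close>

lemma minimal_multipartite:
  assumes p3: "p \<ge> 3" and tbig: "t \<ge> (1000 * (p + 1) * h) ^ 10 * h ^ (10 * (p + 1))"
  shows "\<forall>\<^sub>F n in sequentially. (\<forall>c\<in>edge_colourings n. mono_copies H n c = min_mono_copies H n \<longrightarrow> multipartite c n)"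
proof -
  define k where "k = p + 1"
  define Ln where "Ln = 1000 * k * h"
  define L where "L = real Ln"
  define e where "e = 1 / L ^ 7"
  define \<omega> where "\<omega> = 1 / L ^ 2"
  \<comment> \<open>The requirements are the exponents 8 p for Turan, (7 + k) k for Ramsey and k + 7
    for the averaging over cliques; 10 k^2 dominates all three.\<close>
  define \<gamma> where "\<gamma> = (1 / L) ^ (10 * k ^ 2)"
  have pp: "real p \<ge> 3" using p3 by simp
  have h2: "h \<ge> 2" by (rule h_ge_2)
  have k4: "k \<ge> 4" using p3 by (simp add: k_def)
  have Lnk: "1000 * k \<le> Ln" "1000 * h \<le> Ln" using h2 k4 by (auto simp: Ln_def)
  have L1000: "L \<ge> 1000 * real k" "L \<ge> 1000 * real h" using Lnk unfolding L_def by linarith+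
  have L1: "L \<ge> 1000" using L1000 k4 by linarith
  have Lp: "0 < L ^ j" for j using L1 by simp
  have t10: "Ln ^ 10 * h ^ (10 * k) \<le> t" using tbig by (simp add: Ln_def k_def)
  have "1 \<le> h ^ (10 * k)" using h2 by simp
  then have tL: "Ln ^ 10 \<le> t" using t10 by (metis dual_order.trans mult.right_neutral mult_le_mono2)
  have Ln1: "1 \<le> Ln" using L1 by (simp add: L_def)
  have hLn: "1000 * h \<le> Ln ^ 10" using Lnk(2) self_le_power[of Ln 10] Ln1 by linarith
  have ht: "1000 * h \<le> t" using tL hLn by linarith
  have e0: "e > 0" unfolding e_def by (intro divide_pos_pos Lp) simp
  have w0: "\<omega> > 0" unfolding \<omega>_def by (intro divide_pos_pos Lp) simp
  have g0: "\<gamma> > 0" using L1 by (simp add: \<gamma>_def)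
  have g1: "\<gamma> \<le> 1" using L1 by (auto simp: \<gamma>_def intro!: power_le_one)
  have L16: "16 \<le> L" using L1 by simp
  have gle: "\<gamma> \<le> (1 / L) ^ j" if "j \<le> 10 * k ^ 2" for j
    unfolding \<gamma>_def using L1 that by (intro power_decreasing) auto
  have kk: "4 * k \<le> k ^ 2" using k4 by (simp add: power2_eq_square)
  have ga: "\<gamma> \<le> (e / 2) ^ p"
  proof -
    have "\<gamma> \<le> (1 / L) ^ (8 * p)" using kk by (intro gle) (simp add: k_def)
    also have "\<dots> = (1 / L ^ 8) ^ p" by (simp add: power_mult power_one_over)
    also have "\<dots> \<le> (e / 2) ^ p"
    proof (rule power_mono)
      have "L ^ 7 * 2 \<le> L ^ 7 * L" using L1 by (intro mult_left_mono) auto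
      then have "1 / (L ^ 7 * L) \<le> 1 / (L ^ 7 * 2)" using L1 by (intro divide_left_mono) auto
      then show "1 / L ^ 8 \<le> e / 2" by (simp add: e_def eval_nat_numeral mult_ac)
    qed (use L1 in auto)
    finally show ?thesis .
  qed
  have gb: "\<gamma> \<le> (e / 16 ^ (p + 1)) ^ (p + 1)"
  proof -
    have "(7 + k) * k \<le> 10 * k ^ 2" using kk by (simp add: algebra_simps power2_eq_square)
    then have "\<gamma> \<le> (1 / L) ^ ((7 + k) * k)" by (rule gle)
    also have "\<dots> = (1 / L ^ (7 + k)) ^ k" by (simp add: power_mult power_one_over)
    also have "\<dots> \<le> (e / 16 ^ k) ^ k"
    proof (rule power_mono)
      have "L ^ 7 * 16 ^ k \<le> L ^ 7 * L ^ k" using L16 L1 by (intro mult_left_mono power_mono) auto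
      then have "1 / (L ^ 7 * L ^ k) \<le> 1 / (L ^ 7 * 16 ^ k)" using L1 by (intro divide_left_mono) auto
      then show "1 / L ^ (7 + k) \<le> e / 16 ^ k" by (simp add: e_def power_add)
    qed (use L1 in auto)
    finally show ?thesis by (simp add: k_def)
  qed
  have gc: "(real p + 1) * \<gamma> * (2 * real p) ^ p \<le> e"
  proof -
    have "(real p + 1) * (2 * real p) ^ p \<le> L * L ^ p"
      using L1000 L1 by (intro mult_mono power_mono) (auto simp: k_def)
    then have "(real p + 1) * (2 * real p) ^ p * \<gamma> \<le> L ^ k * \<gamma>" using g0 by (intro mult_right_mono) (auto simp: k_def)
    also have "\<dots> \<le> L ^ k * (1 / L) ^ (k + 7)" using kk k4 L1 by (intro mult_left_mono gle) auto
    also have "\<dots> = e" using L1 by (simp add: e_def power_add power_one_over)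
    finally show ?thesis by (simp add: mult_ac)
  qed
  have gd: "\<gamma> ^ (h ^ (p + 1)) * (1 + p * e / 2) ^ (t - h) > 4"
  proof -
    \<comment> \<open>The core density is L^(-s), and p e/2 is at least L^-7, so
      \<open>s + 1\<close> blocks of length L^8 must fit into \<open>t - h\<close>. Together with
      the factor k^2 in \<open>s\<close> this consumes L^10 and a power of h.\<close>
    define s where "s = 10 * k ^ 2 * h ^ k"
    have "1 / real Ln ^ 7 \<le> p * e / 2"
    proof -
      have "2 * e \<le> p * e" using pp e0 by (intro mult_right_mono) auto
      then show ?thesis by (simp add: e_def L_def)
    qed
    moreover have "Ln ^ Suc 7 * (s + 1) \<le> t - h"
    proof -
      have hk: "1 \<le> h ^ k" "h \<le> h ^ k" using h2 k4 self_le_power[of h k] by auto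
      have "k \<le> k ^ 2" "1 \<le> k ^ 2" using k4 by (auto simp: power2_eq_square)
      then have "1 * 1 \<le> k ^ 2 * h ^ k" using hk by (intro mult_le_mono) auto
      then have "s + 2 \<le> 12 * k ^ 2 * h ^ k" by (simp add: s_def)
      also have "\<dots> \<le> Ln ^ 2 * h ^ k"
      proof (rule mult_le_mono1)
        have "(1000 * k) ^ 2 \<le> Ln ^ 2" using Lnk by (intro power_mono) auto
        then show "12 * k ^ 2 \<le> Ln ^ 2" by (simp add: power_mult_distrib)
      qed
      finally have "Ln ^ 8 * (s + 2) \<le> Ln ^ 8 * (Ln ^ 2 * h ^ k)" by (rule mult_le_mono2)
      also have "\<dots> = Ln ^ 10 * h ^ k" by (simp add: eval_nat_numeral)
      also have "\<dots> \<le> Ln ^ 10 * h ^ (10 * k)" using h2 by (intro mult_le_mono2 power_increasing) auto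
      finally have "Ln ^ 8 * (s + 2) \<le> t" using t10 by simp
      moreover have "h \<le> Ln ^ 8" using Lnk(2) self_le_power[of Ln 8] Ln1 by linarith
      ultimately show ?thesis by simp
    qed
    ultimately have "real Ln ^ (s + 1) \<le> (1 + p * e / 2) ^ (t - h)" by (rule growth_power[OF Ln1])
    then have "\<gamma> ^ (h ^ k) * L ^ (s + 1) \<le> \<gamma> ^ (h ^ k) * (1 + p * e / 2) ^ (t - h)"
      using g0 by (intro mult_left_mono) (auto simp: L_def)
    moreover have "\<gamma> ^ (h ^ k) = (1 / L) ^ s" by (simp add: \<gamma>_def s_def flip: power_mult)
    moreover have "(1 / L) ^ s * L ^ (s + 1) = L" using L1 by (simp add: power_one_over)
    ultimately have "L \<le> \<gamma> ^ (h ^ k) * (1 + p * e / 2) ^ (t - h)" by (simp only:)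
    then show ?thesis using L1 unfolding k_def by linarith
  qed
  have w: "1000 * real p * h ^ 2 * \<omega> \<le> 1"
  proof -
    have "1000 * real p * real h ^ 2 \<le> (1000 * k * real h) ^ 2"
    proof -
      have "1 * 1 \<le> real k * 1000" using k4 by simp
      then have "1 * (1000 * real k * real h ^ 2) \<le> real k * 1000 * (1000 * real k * real h ^ 2)"
        by (intro mult_right_mono) auto
      moreover have "1000 * real p * real h ^ 2 \<le> 1000 * real k * real h ^ 2"
        by (intro mult_right_mono) (auto simp: k_def)
      ultimately show ?thesis by (simp add: power2_eq_square mult_ac)
    qed
    also have "\<dots> = L ^ 2" by (simp add: L_def Ln_def)
    finally show ?thesis using Lp[of 2] by (simp add: \<omega>_def divide_le_eq)
  qed
  have w': "1000 * real p * h * \<omega> \<le> 1"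
  proof -
    have "real h \<le> real h ^ 2" using h2 by (simp add: power2_eq_square)
    then have "1000 * real p * h * \<omega> \<le> 1000 * real p * h ^ 2 * \<omega>" using w0 by (intro mult_right_mono mult_left_mono) auto
    then show ?thesis using w by linarith
  qed
  have ph1: "1 \<le> real p * real h" using pp h2 mult_mono[of 1 "real p" 1 "real h"] by simp
  have phw: "1 / real Ln ^ 2 \<le> p * (h * \<omega>)"
  proof -
    have "1 * \<omega> \<le> (p * h) * \<omega>" using ph1 w0 by (intro mult_right_mono) auto
    then show ?thesis by (simp add: \<omega>_def L_def)
  qed
  have G2: "(1 + p * (h * \<omega>)) ^ m > real t * 4 ^ h" if m: "t - h \<le> h * m" for m
  proof -
    have "m \<noteq> 0" using m ht h2 by (cases m) auto
    then have "h * 1 \<le> h * m" by (intro mult_le_mono2) simp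
    then have "t \<le> 2 * h * m" using m by linarith
    then have "t * real Ln ^ (2 * h + 1) \<le> (1 + p * (h * \<omega>)) ^ m"
      using h2 Lnk tL phw by (intro growth_linear_factor[of h]) auto
    moreover have "real t * 4 ^ h < t * real Ln ^ (2 * h + 1)"
    proof (rule mult_strict_left_mono)
      have "(4::real) ^ h \<le> L ^ h" using L1 by (intro power_mono) auto
      also have "\<dots> < L ^ (2 * h + 1)" using L1 by (intro power_strict_increasing) auto
      finally show "4 ^ h < real Ln ^ (2 * h + 1)" by (simp add: L_def)
    qed (use ht h2 in auto)
    ultimately show ?thesis by linarith
  qed
  have G1: "(p * (h * \<omega>) / 2) ^ (h - 1) * (1 + 7 * (p * (h * \<omega>))) ^ (t - h) > 4 * real t"
  proof -
    have "1 * t \<le> h * (t - h)" 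
    proof -
      have "2 * (t - h) \<le> h * (t - h)" using h2 by (intro mult_le_mono1)
      moreover have "t \<le> 2 * (t - h)" using ht by linarith
      ultimately show ?thesis by linarith
    qed
    then have "t \<le> 2 * h * (t - h)" by linarith
    moreover have "1 / real Ln ^ 2 \<le> 7 * (p * (h * \<omega>))" using phw w0 by (smt (verit) mult_nonneg_nonneg of_nat_0_le_iff)
    ultimately have 1: "t * real Ln ^ (2 * h + 1) \<le> (1 + 7 * (p * (h * \<omega>))) ^ (t - h)"
      using h2 Lnk tL by (intro growth_linear_factor[of h]) auto
    have "1 / L ^ 2 \<le> p * (h * \<omega>) / 2"
    proof -
      have "3 * 2 \<le> real p * real h" using pp h2 by (intro mult_mono) auto
      then have "2 * \<omega> \<le> (p * h) * \<omega>" using w0 by (intro mult_right_mono) auto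
      then have "\<omega> \<le> p * (h * \<omega>) / 2" by simp
      then show ?thesis by (simp only: \<omega>_def[symmetric])
    qed
    then have "(1 / L ^ 2) ^ (h - 1) \<le> (p * (h * \<omega>) / 2) ^ (h - 1)" by (intro power_mono) auto
    then have "(1 / L ^ 2) ^ (h - 1) * (t * L ^ (2 * h + 1)) \<le> (p * (h * \<omega>) / 2) ^ (h - 1) * (1 + 7 * (p * (h * \<omega>))) ^ (t - h)"
      using 1 w0 L1 by (intro mult_mono) (auto simp: L_def)
    moreover have "(1 / L ^ 2) ^ (h - 1) * (t * L ^ (2 * h + 1)) = t * L ^ 3"
    proof -
      have "2 * h + 1 = 2 * (h - 1) + 3" using h2 by simp
      then have "L ^ (2 * h + 1) = (L ^ 2) ^ (h - 1) * L ^ 3" by (simp only: power_add power_mult)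
      then show ?thesis using L1 by (simp add: power_one_over)
    qed
    moreover have "4 * real t < t * L ^ 3"
    proof -
      have "4 < L" using L1 by simp
      also have "L \<le> L ^ 3" using L1 by (intro self_le_power) auto
      finally show ?thesis using ht h2 by (simp add: mult.commute)
    qed
    ultimately show ?thesis by linarith
  qed
  have G3: "(11 / 8) ^ (t - h - 1) > 2 * (real h ^ 2 + 2 * t) * (2 * real p) ^ h"
  proof -
    have "1 * t \<le> h * (t - h - 1)" 
    proof -
      have "2 * (t - h - 1) \<le> h * (t - h - 1)" using h2 by (intro mult_le_mono1)
      moreover have "t \<le> 2 * (t - h - 1)" using ht h2 by linarith
      ultimately show ?thesis by linarith
    qed
    then have "t \<le> 2 * h * (t - h - 1)" by linarith
    moreover have "1 / real Ln ^ 2 \<le> 3 / 8"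
    proof -
      have "1000 * 1 \<le> L * L" using L1 by (intro mult_mono) auto
      then show ?thesis using Lp[of 2] by (simp add: L_def power2_eq_square divide_le_eq)
    qed
    ultimately have 1: "t * real Ln ^ (2 * h + 1) \<le> (1 + 3 / 8) ^ (t - h - 1)"
      using h2 Lnk tL by (intro growth_linear_factor[of h]) auto
    have "real h ^ 2 \<le> t"
    proof -
      have "h ^ 2 \<le> Ln ^ 2" using Lnk by (intro power_mono) auto
      also have "\<dots> \<le> Ln ^ 10" using Ln1 by (intro power_increasing) auto
      finally have "h ^ 2 \<le> t" using tL by simp
      then show ?thesis by (metis of_nat_mono of_nat_power)
    qed
    then have "2 * (real h ^ 2 + 2 * t) \<le> 6 * real t" by simp
    moreover have "(2 * real p) ^ h \<le> L ^ h" using L1000 by (intro power_mono) (auto simp: k_def)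
    ultimately have "2 * (real h ^ 2 + 2 * t) * (2 * real p) ^ h \<le> 6 * real t * L ^ h"
      by (rule mult_mono) auto
    also have "\<dots> < t * L ^ (2 * h + 1)"
    proof -
      have "6 * L ^ h < L * L ^ h" using L1 by (intro mult_strict_right_mono) auto
      also have "\<dots> = L ^ (h + 1)" by simp
      also have "\<dots> \<le> L ^ (2 * h + 1)" using L1 by (intro power_increasing) auto
      finally show ?thesis using ht h2 by simp
    qed
    finally show ?thesis using 1 by (simp add: L_def)
  qed
  have th: "h < t" using ht h2 by linarith
  have Wne: "W \<noteq> {}" using card_W th by auto
  have "(\<lambda>n. (1 + real p / real n) ^ t) \<longlonglongrightarrow> (1 + 0) ^ t" by (intro tendsto_intros lim_const_over_n)
  then have ev1: "\<forall>\<^sub>F n in sequentially. (1 + real p / real n) ^ t < 2" by (rule order_tendstoD) simp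
  have wp: "1 / real p - \<omega> > 0"
  proof -
    have "p * \<omega> < 1" 
    proof -
      have "p * (1 * \<omega>) \<le> p * (h * \<omega>)" using h2 w0 by (intro mult_left_mono mult_right_mono) auto
      then show ?thesis using w' by simp
    qed
    then show ?thesis using pp by (simp add: field_simps)
  qed
  have gg: "\<gamma> ^ (h ^ (p + 1)) > 0" using g0 by simp
  note evs = eventually_linear_ge[OF e0, of "16 ^ (p + 1)"] eventually_linear_ge[OF gg, of "2 * real h ^ 2"]
    eventually_linear_ge[OF e0, of "2 * real t"] eventually_linear_ge[OF w0, of "2 * real t"]
    eventually_linear_ge[OF zero_less_one, of "t * real p ^ t"] eventually_linear_ge[OF zero_less_one, of "100 * real t * p"]
    eventually_linear_ge[OF wp, of "real t"]
  have "\<forall>\<^sub>F n in sequentially. n > 0 \<and> (1 + real p / real n) ^ t < 2 \<and> 16 ^ (p + 1) \<le> e * n \<and>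
      2 * real h ^ 2 \<le> \<gamma> ^ (h ^ (p + 1)) * n \<and> 2 * real t \<le> e * n \<and> 2 * real t \<le> \<omega> * n \<and>
      t * real p ^ t \<le> 1 * real n \<and> 100 * real t * p \<le> 1 * real n \<and> real t \<le> (1 / p - \<omega>) * n"
    by (intro eventually_conj eventually_gt_at_top ev1 evs)
  then show ?thesis
  proof eventually_elim
    case (elim n)
    then have n: "n > 0" "(1 + p / n) ^ t \<le> 2" "16 ^ (p + 1) \<le> e * n" "2 * h ^ 2 \<le> \<gamma> ^ (h ^ (p + 1)) * n"
      "2 * t \<le> e * n" "2 * t \<le> \<omega> * n" "t * real p ^ t \<le> n" "100 * real t * p \<le> n" "real t \<le> (1 / p - \<omega>) * n"
      by auto
    have w1: "1000 * p * h * \<omega> \<le> 1" and w2: "1000 * p * h ^ 2 * \<omega> \<le> 1" using w w' by simp_all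
    show ?case
    proof (intro ballI impI)
      fix c assume c: "c \<in> edge_colourings n" and cmin: "mono_copies H n c = min_mono_copies H n"
      have Lk: "L \<ge> 1000 * (real p + 1)" using L1000 by (simp add: k_def)
      have F: "card (cliq (adj c col) (p + 1) A) < \<gamma> * real n ^ (p + 1)"
        if "A \<subseteq> {..<n}" "\<And>v. v \<in> A \<Longrightarrow> (1 / p + e) * n \<le> card (nb c n col v)" for col A
        by (rule few_cliques_in_high_degree[OF n(1,2,4,5) g0 g1 gd e0 cmin that])
      obtain a b V where ab: "a \<noteq> b" and st: "parts_structure c n a b p \<omega> V"
        using parts_structure_exists[OF p3 Lk e_def ga gb gc n(3), of c] F unfolding \<omega>_def by blast
      obtain part where fs: "full_structure c n a b \<omega> part"
        using full_structure_exists[OF st w1 w0 p3 ab n(1,2,7,6) cmin c G1 G2] by blast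
      have part: "part \<in> {..<n} \<rightarrow> {..<p}" and size: "\<And>i. i < p \<Longrightarrow> (1 / p - \<omega>) * n \<le> part_size n part i"
        using fs by (auto simp: full_structure_def)
      have size': "t \<le> part_size n part i" if "i < p" for i using size[OF that] n(9) by linarith
      have inside: "c {u, v} = a" if "u < n" "v < n" "u \<noteq> v" "part u = part v" for u v
        by (rule no_b_edge_inside[OF fs w2 w0 p3 ab n(1,8) cmin c G3 th that])
      have across: "c {u, v} = b" if "u < n" "v < n" "part u \<noteq> part v" for u v
        by (rule no_a_edge_across[OF ab part size' inside cmin Wne that])
      show "multipartite c n"
        unfolding multipartite_def using ab part inside across by metis
    qed
  qed
qed

end

section \<open>Chromatic numbers and the instantiation for the given graph\<close>

lemma chromatic_number_colouring:
  assumes "simple_graph G"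
  shows "\<exists>f. proper_colouring G (chromatic_number G) f"
proof -
  obtain f where f: "f ` verts G = {..<card (verts G)}" "inj_on f (verts G)"
    using ex_bij_betw_finite_nat[of "verts G"] assms by (auto simp: simple_graph_def bij_betw_def atLeast0LessThan)
  have "proper_colouring G (card (verts G)) f"
    unfolding proper_colouring_def
  proof (intro conjI allI impI)
    show "f \<in> verts G \<rightarrow> {..<card (verts G)}" using f by auto
    fix u v assume "{u, v} \<in> edges G"
    then have "{u, v} \<subseteq> verts G" "card {u, v} = 2" using assms by (auto simp: simple_graph_def nsets_def)
    then have "u \<in> verts G" "v \<in> verts G" "u \<noteq> v" by auto
    then show "f u \<noteq> f v" using f by (auto simp: inj_on_def)
  qed
  then have "\<exists>k f. proper_colouring G k f" by blast
  then show ?thesis unfolding chromatic_number_def by (rule LeastI_ex)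
qed

lemma chromatic_number_le: "proper_colouring G k f \<Longrightarrow> chromatic_number G \<le> k"
  unfolding chromatic_number_def by (intro Least_le) blast

text \<open>Were a colour missing, renumbering the used ones would need fewer colours. Surjectivity
  is what the blow-up argument requires, as it starts from one representative per colour.\<close>

lemma optimal_colouring_surj:
  assumes G: "simple_graph G" and f: "proper_colouring G (chromatic_number G) f"
  shows "f ` verts G = {..<chromatic_number G}"
proof -
  define k where "k = chromatic_number G"
  have sub: "f ` verts G \<subseteq> {..<k}" using f by (auto simp: proper_colouring_def k_def)
  have fin: "finite (f ` verts G)" using G by (simp add: simple_graph_def)
  obtain g where g: "g ` f ` verts G = {..<card (f ` verts G)}" "inj_on g (f ` verts G)"
    using ex_bij_betw_finite_nat[OF fin] by (auto simp: bij_betw_def atLeast0LessThan)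
  have "proper_colouring G (card (f ` verts G)) (g \<circ> f)"
    unfolding proper_colouring_def
  proof (intro conjI allI impI)
    show "g \<circ> f \<in> verts G \<rightarrow> {..<card (f ` verts G)}" using g by auto
    fix u v assume uv: "{u, v} \<in> edges G"
    then have "{u, v} \<subseteq> verts G" using G by (auto simp: simple_graph_def nsets_def)
    moreover have "f u \<noteq> f v" using f uv by (auto simp: proper_colouring_def)
    ultimately show "(g \<circ> f) u \<noteq> (g \<circ> f) v" using g by (auto simp: inj_on_def)
  qed
  then have "k \<le> card (f ` verts G)" unfolding k_def by (rule chromatic_number_le)
  then show ?thesis using card_subset_eq[OF _ sub] card_mono[OF _ sub] by (simp add: k_def)
qed

theorem theorem1p2:
  fixes k h t :: nat and H0 H :: "'a sgraph"
  assumes "k \<ge> 4"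
    and "simple_graph H0" and "connected_graph H0" and "critical k H0"
    and "card (verts H0) = h"
    and "simple_graph H" and "card (verts H) = t"
    and "adds_pendant_edges H0 H"
    and "t \<ge> (1000 * k * h) ^ 10 * h ^ (10 * k)"
  shows "bonbon H \<and>
         convergent (mono_density H) \<and>
         ramsey_multiplicity_constant H = (real k - 1) powi (1 - int t)"
proof -
  define U where "U = verts H0"
  define W where "W = verts H - verts H0"
  define F where "F x y \<longleftrightarrow> {x, y} \<in> edges H0" for x y
  define p where "p = k - 1"
  have k: "k = p + 1" "p \<ge> 3" using assms(1) by (auto simp: p_def)
  have UH: "U \<subseteq> verts H" and EH: "edges H0 = {e \<in> edges H. e \<subseteq> U}"
    using assms(8) by (auto simp: adds_pendant_edges_def induced_subgraph_def U_def)
  have e0: "\<exists>x y. e = {x, y} \<and> x \<noteq> y \<and> x \<in> U \<and> y \<in> U" if "e \<in> edges H0" for e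
  proof -
    have "e \<subseteq> U" "card e = 2" using that assms(2) by (auto simp: simple_graph_def nsets_def U_def)
    then show ?thesis by (auto simp: card_2_iff)
  qed
  have FU: "x \<in> U \<and> y \<in> U \<and> x \<noteq> y" if "F x y" for x y
    using e0[of "{x, y}"] that by (auto simp: F_def doubleton_eq_iff)
  have "\<exists>u. neighbours H w = {u}" if "w \<in> W" for w
    using that assms(8) by (auto simp: adds_pendant_edges_def W_def degree_def card_1_singleton_iff)
  then obtain att where att: "\<And>w. w \<in> W \<Longrightarrow> neighbours H w = {att w}" by metis
  have attU: "att w \<in> U" if "w \<in> W" for w
    using att[OF that] that assms(8) by (auto simp: adds_pendant_edges_def W_def U_def)
  have edges: "edges H = {{x, y} |x y. F x y} \<union> {{att w, w} |w. w \<in> W}"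
  proof
    show "edges H \<subseteq> {{x, y} |x y. F x y} \<union> {{att w, w} |w. w \<in> W}"
    proof
      fix e assume e: "e \<in> edges H"
      then have "e \<subseteq> verts H" "card e = 2" using assms(6) by (auto simp: simple_graph_def nsets_def)
      then obtain x y where xy: "e = {x, y}" "x \<in> verts H" "y \<in> verts H" by (auto simp: card_2_iff)
      consider "x \<in> U" "y \<in> U" | "x \<in> W" | "y \<in> W" using xy by (auto simp: U_def W_def)
      then show "e \<in> {{x, y} |x y. F x y} \<union> {{att w, w} |w. w \<in> W}"
      proof cases
        case 1
        then have "F x y" using e xy EH by (simp add: F_def)
        then show ?thesis using xy by blast
      next
        case 2
        then have "y \<in> neighbours H x" using e xy by (simp add: neighbours_def insert_commute)
        then have "e = {att x, x}" using att[OF 2] xy by auto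
        then show ?thesis using 2 by blast
      next
        case 3
        then have "x \<in> neighbours H y" using e xy by (simp add: neighbours_def)
        then have "e = {att y, y}" using att[OF 3] xy by auto
        then show ?thesis using 3 by blast
      qed
    qed
    show "{{x, y} |x y. F x y} \<union> {{att w, w} |w. w \<in> W} \<subseteq> edges H"
      using EH att by (auto simp: F_def neighbours_def)
  qed
  have chi: "chromatic_number H0 = k" using assms(4) by (simp add: critical_def)
  obtain \<phi> where \<phi>: "proper_colouring H0 k \<phi>" using chromatic_number_colouring[OF assms(2)] chi by auto
  have phi: "\<phi> ` U = {..<p + 1}" using optimal_colouring_surj[OF assms(2), of \<phi>] \<phi> chi k by (simp add: U_def)
  have notcol: "\<exists>x y. F x y \<and> f x = f y" if "f \<in> U \<rightarrow> {..<j}" "j < k" for f j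
  proof (rule ccontr)
    assume "\<not> ?thesis"
    then have "proper_colouring H0 j f" using that by (auto simp: proper_colouring_def F_def U_def)
    then show False using chromatic_number_le[of H0 j f] chi that by simp
  qed
  obtain e where e: "e \<in> edges H0" "chromatic_number (delete_edge H0 e) < k"
    using assms(4) chi by (auto simp: critical_def)
  obtain x0 y0 where xy0: "e = {x0, y0}" using e0[OF e(1)] by blast
  have "simple_graph (delete_edge H0 e)" using assms(2) by (auto simp: simple_graph_def delete_edge_def)
  then obtain \<psi> where \<psi>: "proper_colouring (delete_edge H0 e) (chromatic_number (delete_edge H0 e)) \<psi>"
    using chromatic_number_colouring by blast
  have psi1: "\<psi> \<in> U \<rightarrow> {..<p}"
  proof (rule Pi_I)
    fix x assume "x \<in> U"
    then have "\<psi> x \<in> {..<chromatic_number (delete_edge H0 e)}"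
      using \<psi> by (auto simp: proper_colouring_def delete_edge_def U_def)
    then show "\<psi> x \<in> {..<p}" using e(2) k by simp
  qed
  have psi2: "\<psi> x \<noteq> \<psi> y" if "F x y" "{x, y} \<noteq> {x0, y0}" for x y
    using \<psi> that xy0 by (auto simp: proper_colouring_def delete_edge_def F_def)
  interpret pendant_graph U W F att p h t \<phi> \<psi> x0 y0 H
  proof
    show "finite U" using assms(2) by (simp add: U_def simple_graph_def)
    show "finite W" using assms(6) by (simp add: W_def simple_graph_def)
    show "U \<inter> W = {}" by (auto simp: U_def W_def)
    show "card U = h" using assms(5) by (simp add: U_def)
    show v: "verts H = U \<union> W" using UH by (auto simp: U_def W_def)
    show "card (U \<union> W) = t" using assms(7) v by simp
    show "F x y \<Longrightarrow> F y x" for x y by (simp add: F_def insert_commute)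
    show "F x y \<Longrightarrow> \<phi> x \<noteq> \<phi> y" for x y using \<phi> by (auto simp: F_def proper_colouring_def)
    show "F x0 y0" using e xy0 by (simp add: F_def)
    show "\<exists>x y. F x y \<and> f x = f y" if "f \<in> U \<rightarrow> {..<p}" for f using notcol[OF that] k by simp
    show "(x, y) \<in> {(x, y). F x y}\<^sup>*" if "x \<in> U" "y \<in> U" for x y
      using assms(3) that by (auto simp: connected_graph_def U_def F_def)
  qed (use FU attU phi psi1 psi2 assms(6) edges in auto)
  have chiH: "chromatic_number H = k"
    unfolding chromatic_number_def
  proof (rule Least_equality)
    \<comment> \<open>A pendant vertex takes whichever of the colours 0 and 1 serves to differ from
      its only neighbour.\<close>
    define \<phi>' where "\<phi>' v = (if v \<in> U then \<phi> v else if \<phi> (att v) = 0 then 1 else 0)" for v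
    have "proper_colouring H k \<phi>'"
      unfolding proper_colouring_def
    proof (intro conjI allI impI)
      show "\<phi>' \<in> verts H \<rightarrow> {..<k}" using \<phi> assms(1) by (auto simp: \<phi>'_def proper_colouring_def U_def)
      fix u v assume "{u, v} \<in> edges H"
      then consider x y where "{u, v} = {x, y}" "F x y" | w where "{u, v} = {att w, w}" "w \<in> W" unfolding edges by blast
      then show "\<phi>' u \<noteq> \<phi>' v"
      proof cases
        case 1
        then show ?thesis using FU[OF 1(2)] \<phi> by (auto simp: \<phi>'_def proper_colouring_def F_def doubleton_eq_iff insert_commute)
      next
        case 2
        then show ?thesis using attU[OF 2(2)] by (auto simp: \<phi>'_def W_def U_def doubleton_eq_iff)
      qed
    qed
    then show "\<exists>f. proper_colouring H k f" by blast
    fix j assume "\<exists>f. proper_colouring H j f"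
    then obtain f where f: "proper_colouring H j f" by blast
    show "k \<le> j"
    proof (rule ccontr)
      assume "\<not> k \<le> j"
      moreover have "f \<in> U \<rightarrow> {..<j}" using f UH by (auto simp: proper_colouring_def)
      ultimately obtain x y where "F x y" "f x = f y" using notcol[of f j] by auto
      then show False using f EH by (auto simp: proper_colouring_def F_def)
    qed
  qed
  have conn: "connected_graph H"
    unfolding connected_graph_def
  proof (intro conjI ballI)
    show "verts H \<noteq> {}" using UH assms(3) by (auto simp: connected_graph_def U_def)
    let ?R = "{(x, y). {x, y} \<in> edges H}"
    have sub: "{(x, y). F x y}\<^sup>* \<subseteq> ?R\<^sup>*" using EH by (intro rtrancl_mono) (auto simp: F_def)
    have core: "(x, y) \<in> ?R\<^sup>*" if "x \<in> U" "y \<in> U" for x y using connected[OF that] sub by auto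
    have toU: "\<exists>x\<in>U. (v, x) \<in> ?R\<^sup>* \<and> (x, v) \<in> ?R\<^sup>*" if "v \<in> verts H" for v
    proof (cases "v \<in> U")
      case False
      then have "v \<in> W" using that by (simp add: W_def U_def)
      then have "(v, att v) \<in> ?R" "(att v, v) \<in> ?R" by (auto simp: edges insert_commute)
      then show ?thesis using attU[OF \<open>v \<in> W\<close>] by blast
    qed auto
    fix u v assume "u \<in> verts H" "v \<in> verts H"
    then obtain x y where "x \<in> U" "(u, x) \<in> ?R\<^sup>*" "y \<in> U" "(y, v) \<in> ?R\<^sup>*" using toU by meson
    then show "(u, v) \<in> ?R\<^sup>*" using core[of x y] by (meson rtrancl_trans)
  qed
  have ev: "\<forall>\<^sub>F n in sequentially. mono_copies H n (mod_colouring n) = min_mono_copies H n \<and>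
     (\<forall>c\<in>edge_colourings n. mono_copies H n c = min_mono_copies H n \<longrightarrow> colouring_equiv n c (mod_colouring n))"
    using minimal_multipartite[OF k(2) assms(9)[unfolded k(1)]] eventually_ge_at_top[of "p * t"]
  proof eventually_elim
    case (elim n)
    have np: "t \<le> n div p" using elim(2) p_pos by (simp add: less_eq_div_iff_mult_less_eq mult.commute)
    show ?case using mod_colouring_minimal[OF _ np] elim(1) by blast
  qed
  have "bonbon H"
    unfolding bonbon_def
  proof (intro conjI conn)
    have "chromatic_number H - 1 = p" using chiH k by simp
    then show "\<forall>\<^sub>F n in sequentially. \<exists>T. turan_colouring n (chromatic_number H - 1) T \<and>
        mono_copies H n T = min_mono_copies H n \<and>
        (\<forall>c\<in>edge_colourings n. mono_copies H n c = min_mono_copies H n \<longrightarrow> colouring_equiv n c T)"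
      using turan_mod_colouring by (intro eventually_mono[OF ev]) auto
  qed
  moreover have lim: "mono_density H \<longlonglongrightarrow> p * (1 / p) ^ t"
    by (rule density_limit, rule eventually_mono[OF ev]) simp
  moreover have "p * (1 / p) ^ t = (real k - 1) powi (1 - int t)"
    using k by (simp add: power_int_diff power_one_over)
  ultimately show ?thesis
    unfolding ramsey_multiplicity_constant_def by (simp add: convergentI limI)
qed

end
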